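(* Let $\Sigma$ be a closed oriented surface of genus $\geq 1$, let $(\mathbf g,\mathbf I,\mathbf J,\mathbf K)$ be the para-hyperK\"ahler structure on $\mathcal{MGH}(\Sigma)$ described in the context, $\omega_{\mathbf I}^{\mathbb C}=\omega_{\mathbf J}+i\omega_{\mathbf K}$, and let $R_\theta:\mathcal{MGH}(\Sigma)\to\mathcal{MGH}(\Sigma)$ be the circle action given, in terms of the pair (complex structure $J$ of the maximal Cauchy surface, holomorphic quadratic differential $q$ whose real part is its second fundamental form), by $(J,q)\mapsto(J,e^{i\theta}q)$. Then the circle action is Hamiltonian with respect to $\omega_{\mathbf I}$, and for every $\theta$ $$R_\theta^*\mathbf g=\mathbf g,\qquad R_\theta^*\omega_{\mathbf I}=\omega_{\mathbf I},\qquad R_\theta^*\omega_{\mathbf I}^{\mathbb C}=e^{-i\theta}\omega_{\mathbf I}^{\mathbb C}.$$ When $\Sigma$ has genus $\geq 2$, the function $\mathcal A:\mathcal{MGH}(\Sigma)\to\mathbb R$ assigning to a MGHC AdS manifold the area of its unique maximal Cauchy surface is a Hamiltonian function for the circle action.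
   Context: MGHC AdS means maximal globally hyperbolic, Lorentzian of constant curvature $-1$, with closed Cauchy surface; $\mathcal{MGH}(\Sigma)$ is the space of such metrics on $\Sigma\times\mathbb R$ modulo $\mathrm{Diff}_0$. Each contains a unique maximal Cauchy surface, with first fundamental form $h$ and shape operator $B$ ($h$-self-adjoint, traceless), satisfying (GC): $K_h=-1-\det B$, $d^{\nabla^h}B=0$. A circle action generated by a vector field $V$ is Hamiltonian with Hamiltonian function $H$ if $dH=\omega(V,\cdot)$. Pointwise structure. For an oriented real plane $E$ with area form $\rho$: $\mathcal J(E)=\{J\in\mathrm{End}(E): J^2=-\mathbf 1,\ \rho(v,Jv)>0\ \forall v\ne0\}$, $g_J=\rho(\cdot,J\cdot)$, $T_J\mathcal J(E)=\{\dot J:\dot JJ+J\dot J=0\}$, $T_J^*\mathcal J(E)=\{\sigma \text{ symmetric bilinear}: \sigma(J\cdot,J\cdot)=-\sigma\}$; $g_J^{-1}\sigma$ is the endomorphism with $\sigma=g_J(\cdot,(g_J^{-1}\sigma)\cdot)$; $\langle\sigma|\dot J\rangle=\frac12\mathrm{tr}(g_J^{-1}\sigma\dot J)$, $\langle\dot J,\dot J'\rangle=\frac12\mathrm{tr}(\dot J\dot J')$, $\langle\sigma,\sigma'\rangle=\frac12\mathrm{tr}(g_J^{-1}\sigma g_J^{-1}\sigma')$, $\|\sigma\|^2=\langle\sigma,\sigma\rangle$, $f=\sqrt{1+\|\sigma\|^2}$. Tangent vectors to $T^*\mathcal J(E)$ at $(J,\sigma)$ are pairs $(\dot J,\dot\sigma)$,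 $\dot J\in T_J\mathcal J(E)$, $\dot\sigma=\dot\sigma_0-\langle\sigma|J\dot J\rangle g_J$, $\dot\sigma_0\in T_J^*\mathcal J(E)$. Set $\mathbf g((\dot J,\dot\sigma),(\dot J',\dot\sigma'))=f\langle\dot J,\dot J'\rangle-f^{-1}\langle\dot\sigma_0,\dot\sigma_0'\rangle$; $\mathbf I(\dot J,\dot\sigma)=(-J\dot J,\,-\dot\sigma_0(\cdot,J\cdot)-\langle\sigma|\dot J\rangle g_J)$; $\mathbf J(\dot J,\dot\sigma)=(f^{-1}g_J^{-1}\dot\sigma_0,\ f g_J(\cdot,\dot J\cdot)+f^{-1}\langle\sigma,\dot\sigma_0(\cdot,J\cdot)\rangle g_J)$; $\mathbf K=\mathbf I\mathbf J$; $\omega_{\mathbf X}=\mathbf g(\cdot,\mathbf X\cdot)$. Genus one. Take $E=\mathbb R^2$, $\rho=dx\wedge dy$, $T^2=\mathbb R^2/\mathbb Z^2$. Constant tensors identify $T^*\mathcal J(\mathbb R^2)$ with $T^*\mathcal T(T^2)$, $(J,\sigma)\mapsto(J,q=\sigma-i\sigma(\cdot,J\cdot))$, and $\mathcal{MGH}(T^2)$ with the complement of the zero section (complex structure of the maximal surface, and $q$ with real part its second fundamental form); the structure $(\mathbf g,\mathbf I,\mathbf J,\mathbf K)$ on $\mathcal{MGH}(T^2)$ is the quadruple $(\mathbf g,\mathbf I,\mathbf J,\mathbf K)$ given on $T^*\mathcal J(E)$, $E=\mathbb R^2$, by the formulas of the pointwise structure, restricted to the complement of the zero section and transported to $\mathcal{MGH}(T^2)$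 through these identifications. Genus $\geq2$. Fix an area form $\rho$ on $\Sigma$ of total area $-\pi\chi(\Sigma)$. $T^*\mathcal J(\Sigma)$ is the space of pairs $(J,\sigma)$ of smooth tensors lying pointwise in $T^*\mathcal J(T_p\Sigma)$; tangent vectors at $(J,\sigma)$ are pairs $(\dot J,\dot\sigma)$ of smooth tensors such that at every $p\in\Sigma$ one has $\dot J\in T_J\mathcal J(T_p\Sigma)$ and $\dot\sigma=\dot\sigma_0-\langle\sigma|J\dot J\rangle g_J$ with $\dot\sigma_0\in T_J^*\mathcal J(T_p\Sigma)$; $\mathbf I,\mathbf J,\mathbf K$ act pointwise and $\mathbf g,\omega_{\mathbf X}$ are the integrals over $\Sigma$ against $\rho$ of the pointwise ones. $\widetilde{\mathcal{MS}}_0(\Sigma,\rho)$ is the set of $(J,\sigma)$ such that $h=(1+f)g_J$, $B=h^{-1}\sigma$ satisfy (GC). Its quotient by $\mathrm{Symp}_0(\Sigma,\rho)$ (identity component of area-preserving diffeomorphisms) is identified with $\mathcal{MGH}(\Sigma)$: $(J,\sigma)$ corresponds to the manifold whose maximal surface has data $(h,B)$. The tangent space of the quotient at $[J,\sigma]$ is identified, via the projection, with the space $V_{(J,\sigma)}$ of $(\dot J,\dot\sigma)$ satisfying $\mathrm{div}_g(f^{-1}g^{-1}\dot\sigma_0)=-f^{-1}\langle\nabla^g_{J\bullet}\sigma|\dot J\rangle$ and $\mathrm{div}_g\dot J=-f^{-2}\langle\nabla^g_{J\bullet}\sigma,\dot\sigma_0\rangle$, where $g=g_J$, $(\mathrm{div}_gA)(X)=\sum_ig((\nabla^g_{e_i}A)X,e_i)$.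 $V_{(J,\sigma)}$ is invariant under $\mathbf I,\mathbf J,\mathbf K$, and the structure on $\mathcal{MGH}(\Sigma)$ is the restriction of $(\mathbf g,\mathbf I,\mathbf J,\mathbf K)$ to $V_{(J,\sigma)}$. In all cases, in terms of $(J,\sigma)$ with $\sigma=\mathrm{Re}\,q$, $R_\theta(J,\sigma)=(J,\cos\theta\,\sigma+\sin\theta\,\sigma(\cdot,J\cdot))$; for genus $\ge2$, $\mathcal A([J,\sigma])=\int_\Sigma(1+\sqrt{1+\|\sigma\|^2})\rho$. *)

theory Defs
  imports "HOL-Analysis.Analysis" "HOL-Homology.Homology"
begin

section \<open>The pointwise structure on the cotangent bundle of the space of complex structures\<close>

text \<open>
  The oriented plane with area form is \<open>\<real>\<^sup>2\<close> with the area form \<open>r dx \<and> dy\<close>, \<open>r > 0\<close>; for a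
  tangent plane of a surface, \<open>r\<close> is the coefficient of the area form in an oriented chart.
  An endomorphism is the matrix \<open>A\<close> acting by \<open>v \<mapsto> A *v v\<close>, a bilinear form is its Gram matrix
  \<open>S\<close>, standing for \<open>(v, w) \<mapsto> v \<bullet> (S *v w)\<close>.  Hence \<open>\<sigma>(\<cdot>, A\<cdot>)\<close> is \<open>S ** A\<close> and
  \<open>\<sigma>(A\<cdot>, A\<cdot>)\<close> is \<open>transpose A ** S ** A\<close>.
\<close>

type_synonym mat2 = "real^2^2"

definition area_form :: "real \<Rightarrow> real^2 \<Rightarrow> real^2 \<Rightarrow> real" where
  "area_form r v w = r * (v$1 * w$2 - v$2 * w$1)"

definition complex_structures :: "real \<Rightarrow> mat2 set" where
  "complex_structures r = {J. J ** J = - mat 1 \<and> (\<forall>v. v \<noteq> 0 \<longrightarrow> area_form r v (J *v v) > 0)}"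

definition gJ :: "real \<Rightarrow> mat2 \<Rightarrow> mat2" where
  "gJ r J = (\<chi> i j. area_form r (axis i 1) (J *v axis j 1))"

definition TJ :: "mat2 \<Rightarrow> mat2 set" where
  "TJ J = {A. A ** J + J ** A = 0}"

definition TJ_dual :: "mat2 \<Rightarrow> mat2 set" where
  "TJ_dual J = {S. transpose S = S \<and> transpose J ** S ** J = - S}"

definition sharp :: "real \<Rightarrow> mat2 \<Rightarrow> mat2 \<Rightarrow> mat2" where
  "sharp r J S = matrix_inv (gJ r J) ** S"

definition pairing :: "real \<Rightarrow> mat2 \<Rightarrow> mat2 \<Rightarrow> mat2 \<Rightarrow> real" where
  "pairing r J S A = 1/2 * trace (sharp r J S ** A)"

definition inner_end :: "mat2 \<Rightarrow> mat2 \<Rightarrow> real" where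
  "inner_end A B = 1/2 * trace (A ** B)"

definition inner_form :: "real \<Rightarrow> mat2 \<Rightarrow> mat2 \<Rightarrow> mat2 \<Rightarrow> real" where
  "inner_form r J S T = 1/2 * trace (sharp r J S ** sharp r J T)"

definition ff :: "real \<Rightarrow> mat2 \<times> mat2 \<Rightarrow> real" where
  "ff r x = sqrt (1 + inner_form r (fst x) (snd x) (snd x))"

definition cotangent_points :: "real \<Rightarrow> (mat2 \<times> mat2) set" where
  "cotangent_points r = {(J, S). J \<in> complex_structures r \<and> S \<in> TJ_dual J}"

definition tangent_vectors :: "real \<Rightarrow> mat2 \<times> mat2 \<Rightarrow> (mat2 \<times> mat2) set" where
  "tangent_vectors r x = (case x of (J, S) \<Rightarrow>
     {(A, T). A \<in> TJ J \<and> (\<exists>T0 \<in> TJ_dual J. T = T0 - pairing r J S (J ** A) *\<^sub>R gJ r J)})"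

text \<open>The component \<open>\<sigma>\<^sub>0\<close> of a tangent vector, recovered from the pair.\<close>

definition form0 :: "real \<Rightarrow> mat2 \<times> mat2 \<Rightarrow> mat2 \<times> mat2 \<Rightarrow> mat2" where
  "form0 r x v = snd v + pairing r (fst x) (snd x) (fst x ** fst v) *\<^sub>R gJ r (fst x)"

definition pmetric ::
  "real \<Rightarrow> mat2 \<times> mat2 \<Rightarrow> mat2 \<times> mat2 \<Rightarrow> mat2 \<times> mat2 \<Rightarrow> real" where
  "pmetric r x v w = ff r x * inner_end (fst v) (fst w)
     - inverse (ff r x) * inner_form r (fst x) (form0 r x v) (form0 r x w)"

definition pI :: "real \<Rightarrow> mat2 \<times> mat2 \<Rightarrow> mat2 \<times> mat2 \<Rightarrow> mat2 \<times> mat2" where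
  "pI r x v = (let J = fst x; S = snd x; A = fst v; T0 = form0 r x v in
     (- (J ** A), - (T0 ** J) - pairing r J S A *\<^sub>R gJ r J))"

definition pJ :: "real \<Rightarrow> mat2 \<times> mat2 \<Rightarrow> mat2 \<times> mat2 \<Rightarrow> mat2 \<times> mat2" where
  "pJ r x v = (let J = fst x; S = snd x; A = fst v; T0 = form0 r x v; f = ff r x in
     (inverse f *\<^sub>R sharp r J T0,
      f *\<^sub>R (gJ r J ** A) + (inverse f * inner_form r J S (T0 ** J)) *\<^sub>R gJ r J))"

text \<open>The quadratic differential \<open>q = \<sigma> - i \<sigma>(\<cdot>, J\<cdot>)\<close>, and the pair whose quadratic differential
  is \<open>e\<^sup>i\<^sup>\<theta> q\<close>.\<close>

definition quad_diff :: "mat2 \<times> mat2 \<Rightarrow> complex^2^2" where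
  "quad_diff x = (\<chi> i j. complex_of_real (snd x $ i $ j)
                       - \<i> * complex_of_real ((snd x ** fst x) $ i $ j))"

definition rot :: "real \<Rightarrow> mat2 \<times> mat2 \<Rightarrow> mat2 \<times> mat2" where
  "rot \<theta> x = (fst x, \<chi> i j. Re (cis \<theta> * quad_diff x $ i $ j))"

lemma rot_eq: "rot \<theta> (J, S) = (J, cos \<theta> *\<^sub>R S + sin \<theta> *\<^sub>R (S ** J))"
  by (simp add: rot_def quad_diff_def vec_eq_iff)

section \<open>Moduli spaces as quotients, and Hamiltonian circle actions\<close>

text \<open>
  A moduli space is presented by its representatives (\<open>pts\<close>) and the gauge orbit of each
  representative; the points of the moduli space are the orbits.  The tangent space of the moduli
  space at the class of \<open>p\<close> is identified with \<open>tangent M p\<close>, a vector \<open>u\<close> tangent to \<open>pts\<close>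
  projecting to \<open>v \<in> tangent M p\<close> iff \<open>u - v\<close> is tangent to the gauge orbit.
  \<open>velocity\<close> is the velocity at time 0.
\<close>

record 'p moduli_space =
  pts :: "'p set"
  gauge_orbit :: "'p \<Rightarrow> 'p set"
  tangent :: "'p \<Rightarrow> 'p set"
  orbit_tangent :: "'p \<Rightarrow> 'p set"
  smooth_curve :: "(real \<Rightarrow> 'p) \<Rightarrow> bool"
  velocity :: "(real \<Rightarrow> 'p) \<Rightarrow> 'p"
  metric :: "'p \<Rightarrow> 'p \<Rightarrow> 'p \<Rightarrow> real"
  opI :: "'p \<Rightarrow> 'p \<Rightarrow> 'p"
  opJ :: "'p \<Rightarrow> 'p \<Rightarrow> 'p"

definition moduli :: "'p moduli_space \<Rightarrow> 'p set set" where
  "moduli M = gauge_orbit M ` pts M"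

definition omegaI :: "'p moduli_space \<Rightarrow> 'p \<Rightarrow> 'p \<Rightarrow> 'p \<Rightarrow> real" where
  "omegaI M p v w = metric M p v (opI M p w)"

definition omegaJ :: "'p moduli_space \<Rightarrow> 'p \<Rightarrow> 'p \<Rightarrow> 'p \<Rightarrow> real" where
  "omegaJ M p v w = metric M p v (opJ M p w)"

definition omegaK :: "'p moduli_space \<Rightarrow> 'p \<Rightarrow> 'p \<Rightarrow> 'p \<Rightarrow> real" where
  "omegaK M p v w = metric M p v (opI M p (opJ M p w))"

definition omegaIC :: "'p moduli_space \<Rightarrow> 'p \<Rightarrow> 'p \<Rightarrow> 'p \<Rightarrow> complex" where
  "omegaIC M p v w = complex_of_real (omegaJ M p v w) + \<i> * complex_of_real (omegaK M p v w)"

definition curve_in :: "'p moduli_space \<Rightarrow> 'p \<Rightarrow> 'p \<Rightarrow> (real \<Rightarrow> 'p) \<Rightarrow> bool" where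
  "curve_in M p v \<gamma> \<longleftrightarrow>
     smooth_curve M \<gamma> \<and> (\<forall>t. \<gamma> t \<in> pts M) \<and> \<gamma> 0 = p \<and> velocity M \<gamma> = v"

definition projects_to :: "'p::minus moduli_space \<Rightarrow> 'p \<Rightarrow> 'p \<Rightarrow> 'p \<Rightarrow> bool" where
  "projects_to M p u v \<longleftrightarrow> v \<in> tangent M p \<and> u - v \<in> orbit_tangent M p"

text \<open>The projection identifies \<open>tangent M p\<close> with the quotient of the tangent space of \<open>pts\<close>
  by the tangent space of the orbit.\<close>

definition tangent_identified :: "'p::minus moduli_space \<Rightarrow> bool" where
  "tangent_identified M \<longleftrightarrow> (\<forall>p \<in> pts M.
     (\<forall>v \<in> tangent M p. \<exists>\<gamma>. curve_in M p v \<gamma>) \<and>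
     (\<forall>u \<gamma>. curve_in M p u \<gamma> \<longrightarrow> (\<exists>!v. projects_to M p u v)))"

text \<open>\<open>R\<close> descends to a circle action on the moduli space, whose differential is the restriction
  of \<open>dR\<close> to the tangent spaces of the moduli space.\<close>

definition circle_action ::
  "'p moduli_space \<Rightarrow> (real \<Rightarrow> 'p \<Rightarrow> 'p) \<Rightarrow> (real \<Rightarrow> 'p \<Rightarrow> 'p \<Rightarrow> 'p) \<Rightarrow> bool" where
  "circle_action M R dR \<longleftrightarrow> (\<forall>p \<in> pts M.
     R 0 p = p \<and> R (2 * pi) p = p \<and> (\<forall>\<theta> \<phi>. R (\<theta> + \<phi>) p = R \<theta> (R \<phi> p)) \<and>
     (\<forall>\<theta>. R \<theta> p \<in> pts M \<and> gauge_orbit M (R \<theta> p) = R \<theta> ` gauge_orbit M p \<and>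
          dR \<theta> p ` tangent M p \<subseteq> tangent M (R \<theta> p)))"

text \<open>\<open>v \<in> tangent M p\<close> is the value at the class of \<open>p\<close> of the vector field generating \<open>R\<close>.\<close>

definition generates :: "'p::minus moduli_space \<Rightarrow> (real \<Rightarrow> 'p \<Rightarrow> 'p) \<Rightarrow> 'p \<Rightarrow> 'p \<Rightarrow> bool" where
  "generates M R p v \<longleftrightarrow> projects_to M p (velocity M (\<lambda>\<theta>. R \<theta> p)) v"

text \<open>No vector in \<open>tangent M p\<close> is assumed to represent the generator here; it exists and is
  unique under \<open>tangent_identified\<close>.  The equation is \<open>dH = \<omega>\<^sub>I(V, \<cdot>)\<close> for the generator \<open>V\<close> of \<open>R\<close>, where \<open>H\<close> is a function on the moduli space
  and \<open>dH(w)\<close> is the derivative of \<open>H\<close> along smooth curves with velocity \<open>w\<close>.\<close>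

definition hamiltonian_function ::
  "'p::minus moduli_space \<Rightarrow> (real \<Rightarrow> 'p \<Rightarrow> 'p) \<Rightarrow> ('p set \<Rightarrow> real) \<Rightarrow> bool" where
  "hamiltonian_function M R H \<longleftrightarrow>
     (\<forall>p \<in> pts M. \<forall>v w \<gamma>. generates M R p v \<and> w \<in> tangent M p \<and> curve_in M p w \<gamma> \<longrightarrow>
        ((\<lambda>t. H (gauge_orbit M (\<gamma> t))) has_real_derivative omegaI M p v w) (at 0))"

section \<open>Smooth functions on open subsets of Euclidean spaces\<close>

definition dpartial ::
  "'e::euclidean_space \<Rightarrow> ('e \<Rightarrow> 'b::real_normed_vector) \<Rightarrow> 'e \<Rightarrow> 'b" where
  "dpartial b F x = frechet_derivative F (at x) b"

definition smooth_on :: "'e::euclidean_space set \<Rightarrow> ('e \<Rightarrow> 'b::real_normed_vector) \<Rightarrow> bool" where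
  "smooth_on S F \<longleftrightarrow> (\<forall>bs. set bs \<subseteq> Basis \<longrightarrow> (\<forall>x \<in> S. foldr dpartial bs F differentiable at x))"

section \<open>Genus one\<close>

definition torus_mgh :: "(mat2 \<times> mat2) moduli_space" where
  "torus_mgh = \<lparr>
     pts = {(J, S) \<in> cotangent_points 1. S \<noteq> 0},
     gauge_orbit = (\<lambda>x. {x}),
     tangent = tangent_vectors 1,
     orbit_tangent = (\<lambda>x. {0}),
     smooth_curve = smooth_on UNIV,
     velocity = (\<lambda>\<gamma>. vector_derivative \<gamma> (at 0)),
     metric = pmetric 1,
     opI = pI 1,
     opJ = pJ 1\<rparr>"

definition torus_drot :: "real \<Rightarrow> mat2 \<times> mat2 \<Rightarrow> mat2 \<times> mat2 \<Rightarrow> mat2 \<times> mat2" where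
  "torus_drot \<theta> x v = frechet_derivative (rot \<theta>) (at x) v"

section \<open>Closed oriented surfaces\<close>

text \<open>A chart is a domain with a coordinate map.  The surface is a whole type, with a smooth
  structure given by an atlas.\<close>

type_synonym 'a chart = "'a set \<times> ('a \<Rightarrow> real^2)"

definition chart_inv :: "'a chart \<Rightarrow> real^2 \<Rightarrow> 'a" where
  "chart_inv c = inv_into (fst c) (snd c)"

definition in_charts :: "'a chart \<Rightarrow> 'a chart \<Rightarrow> ('a \<Rightarrow> 'a) \<Rightarrow> real^2 \<Rightarrow> real^2" where
  "in_charts c d \<phi> = snd d \<circ> \<phi> \<circ> chart_inv c"

definition jacobian :: "'a chart \<Rightarrow> 'a chart \<Rightarrow> ('a \<Rightarrow> 'a) \<Rightarrow> 'a \<Rightarrow> mat2" where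
  "jacobian c d \<phi> p = matrix (frechet_derivative (in_charts c d \<phi>) (at (snd c p)))"

definition is_chart :: "'a::topological_space chart \<Rightarrow> bool" where
  "is_chart c \<longleftrightarrow> open (fst c) \<and> open (snd c ` fst c) \<and>
     homeomorphism (fst c) (snd c ` fst c) (snd c) (chart_inv c)"

definition smooth_map :: "'a::topological_space chart set \<Rightarrow> ('a \<Rightarrow> 'a) \<Rightarrow> bool" where
  "smooth_map A \<phi> \<longleftrightarrow> continuous_on UNIV \<phi> \<and>
     (\<forall>c \<in> A. \<forall>d \<in> A. smooth_on (snd c ` (fst c \<inter> \<phi> -` fst d)) (in_charts c d \<phi>))"

definition oriented_atlas :: "'a::topological_space chart set \<Rightarrow> bool" where
  "oriented_atlas A \<longleftrightarrow> (\<forall>c \<in> A. is_chart c) \<and> (\<Union>c \<in> A. fst c) = UNIV \<and> smooth_map A id \<and>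
     (\<forall>c \<in> A. \<forall>d \<in> A. \<forall>p \<in> fst c \<inter> fst d. det (jacobian c d id p) > 0)"

definition closed_oriented_surface :: "'a::t2_space chart set \<Rightarrow> bool" where
  "closed_oriented_surface A \<longleftrightarrow>
     compact (UNIV :: 'a set) \<and> connected (UNIV :: 'a set) \<and> oriented_atlas A"

definition has_genus :: "'a::topological_space itself \<Rightarrow> nat \<Rightarrow> bool" where
  "has_genus TYPE('a) g \<longleftrightarrow>
     homology_group 1 (euclidean :: 'a topology) \<cong> free_Abelian_group {..<2 * g}"

section \<open>Tensor fields, area forms and integration\<close>

text \<open>A field gives the components of a tensor in each chart at each point.  Fields vanish where
  they carry no information, so that equal tensor fields are equal functions.\<close>

type_synonym ('a, 'b) field = "'a chart \<Rightarrow> 'a \<Rightarrow> 'b"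

definition loc :: "'a chart \<Rightarrow> ('a, 'b) field \<Rightarrow> real^2 \<Rightarrow> 'b" where
  "loc c F = F c \<circ> chart_inv c"

definition valid_at :: "'a chart set \<Rightarrow> 'a chart \<Rightarrow> 'a \<Rightarrow> bool" where
  "valid_at A c p \<longleftrightarrow> c \<in> A \<and> p \<in> fst c"

definition smooth_field :: "'a chart set \<Rightarrow> ('a, 'b::real_normed_vector) field \<Rightarrow> bool" where
  "smooth_field A F \<longleftrightarrow> (\<forall>c \<in> A. smooth_on (snd c ` fst c) (loc c F)) \<and>
     (\<forall>c p. \<not> valid_at A c p \<longrightarrow> F c p = 0)"

text \<open>Components of an endomorphism and a bilinear form, pulled back by an invertible matrix.\<close>

definition pull_pair :: "mat2 \<Rightarrow> mat2 \<times> mat2 \<Rightarrow> mat2 \<times> mat2" where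
  "pull_pair D x = (matrix_inv D ** fst x ** D, transpose D ** snd x ** D)"

definition pair_field :: "'a chart set \<Rightarrow> ('a, mat2 \<times> mat2) field \<Rightarrow> bool" where
  "pair_field A x \<longleftrightarrow> smooth_field A x \<and>
     (\<forall>c \<in> A. \<forall>d \<in> A. \<forall>p \<in> fst c \<inter> fst d. x c p = pull_pair (jacobian c d id p) (x d p))"

definition vector_field :: "'a chart set \<Rightarrow> ('a, real^2) field \<Rightarrow> bool" where
  "vector_field A X \<longleftrightarrow> smooth_field A X \<and>
     (\<forall>c \<in> A. \<forall>d \<in> A. \<forall>p \<in> fst c \<inter> fst d. X d p = jacobian c d id p *v X c p)"

text \<open>The area form is \<open>\<rho> c p dx \<and> dy\<close> in the chart \<open>c\<close>.\<close>

definition area_form_field :: "'a chart set \<Rightarrow> ('a, real) field \<Rightarrow> bool" where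
  "area_form_field A \<rho> \<longleftrightarrow> smooth_field A \<rho> \<and> (\<forall>c p. valid_at A c p \<longrightarrow> \<rho> c p > 0) \<and>
     (\<forall>c \<in> A. \<forall>d \<in> A. \<forall>p \<in> fst c \<inter> fst d. \<rho> c p = det (jacobian c d id p) * \<rho> d p)"

definition area_measure ::
  "'a::topological_space chart set \<Rightarrow> ('a, real) field \<Rightarrow> 'a measure" where
  "area_measure A \<rho> = (THE \<mu>. sets \<mu> = sets borel \<and>
     (\<forall>c \<in> A. \<forall>B \<in> sets borel. B \<subseteq> fst c \<longrightarrow>
        emeasure \<mu> B = (\<integral>\<^sup>+ x. ennreal (loc c \<rho> x) * indicator (snd c ` B) x \<partial>lborel)))"

text \<open>The integral against the area form of a function given by a chart-independent expression.\<close>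

definition surface_integral ::
  "'a::topological_space chart set \<Rightarrow> ('a, real) field \<Rightarrow> ('a, real) field \<Rightarrow> real" where
  "surface_integral A \<rho> u = (\<integral>p. u (SOME c. valid_at A c p) p \<partial>area_measure A \<rho>)"

section \<open>Levi-Civita connection and curvature in coordinates\<close>

definition pd :: "2 \<Rightarrow> (real^2 \<Rightarrow> 'b::real_normed_vector) \<Rightarrow> real^2 \<Rightarrow> 'b" where
  "pd i F x = dpartial (axis i 1) F x"

text \<open>\<open>christoffel G x i\<close> is the matrix with entry \<open>\<Gamma>\<^sup>k\<^sub>i\<^sub>j\<close> in row \<open>k\<close>, column \<open>j\<close>.\<close>

definition christoffel :: "(real^2 \<Rightarrow> mat2) \<Rightarrow> real^2 \<Rightarrow> 2 \<Rightarrow> mat2" where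
  "christoffel G x i = (\<chi> k j. 1/2 * (\<Sum>l\<in>UNIV. matrix_inv (G x) $ k $ l *
     (pd i G x $ j $ l + pd j G x $ i $ l - pd l G x $ i $ j)))"

definition nabla_end :: "(real^2 \<Rightarrow> mat2) \<Rightarrow> (real^2 \<Rightarrow> mat2) \<Rightarrow> real^2 \<Rightarrow> real^2 \<Rightarrow> mat2" where
  "nabla_end G B x X = (\<Sum>i\<in>UNIV. X $ i *\<^sub>R
     (pd i B x + christoffel G x i ** B x - B x ** christoffel G x i))"

definition nabla_form :: "(real^2 \<Rightarrow> mat2) \<Rightarrow> (real^2 \<Rightarrow> mat2) \<Rightarrow> real^2 \<Rightarrow> real^2 \<Rightarrow> mat2" where
  "nabla_form G S x X = (\<Sum>i\<in>UNIV. X $ i *\<^sub>R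
     (pd i S x - transpose (christoffel G x i) ** S x - S x ** christoffel G x i))"

text \<open>\<open>(div B)(X) = \<Sum>\<^sub>i g((\<nabla>\<^sub>e\<^sub>i B) X, e\<^sub>i)\<close> over a \<open>g\<close>-orthonormal frame is the trace of
  \<open>Y \<mapsto> (\<nabla>\<^sub>Y B) X\<close>, computed here in the coordinate frame.\<close>

definition divergence :: "(real^2 \<Rightarrow> mat2) \<Rightarrow> (real^2 \<Rightarrow> mat2) \<Rightarrow> real^2 \<Rightarrow> real^2 \<Rightarrow> real" where
  "divergence G B x X = (\<Sum>i\<in>UNIV. (nabla_end G B x (axis i 1) *v X) $ i)"

text \<open>\<open>K = g(R(\<partial>\<^sub>1, \<partial>\<^sub>2) \<partial>\<^sub>2, \<partial>\<^sub>1) / det g\<close>.\<close>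

definition gauss_curvature :: "(real^2 \<Rightarrow> mat2) \<Rightarrow> real^2 \<Rightarrow> real" where
  "gauss_curvature G x =
     (let \<Gamma> = (\<lambda>i y. christoffel G y i);
          R12 = pd 1 (\<Gamma> 2) x - pd 2 (\<Gamma> 1) x + \<Gamma> 1 x ** \<Gamma> 2 x - \<Gamma> 2 x ** \<Gamma> 1 x
      in axis 1 1 \<bullet> (G x *v (R12 *v axis 2 1)) / det (G x))"

section \<open>Area-preserving diffeomorphisms\<close>

definition diffeos :: "'a::topological_space chart set \<Rightarrow> ('a \<Rightarrow> 'a) set" where
  "diffeos A = {\<phi>. bij \<phi> \<and> smooth_map A \<phi> \<and> smooth_map A (inv_into UNIV \<phi>)}"

definition symp :: "'a::topological_space chart set \<Rightarrow> ('a, real) field \<Rightarrow> ('a \<Rightarrow> 'a) set" where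
  "symp A \<rho> = {\<phi> \<in> diffeos A. \<forall>c \<in> A. \<forall>d \<in> A. \<forall>p \<in> fst c \<inter> \<phi> -` fst d.
     \<rho> c p = det (jacobian c d \<phi> p) * \<rho> d (\<phi> p)}"

text \<open>The smooth topology: uniform convergence of all partial derivatives on compact subsets of
  charts.\<close>

definition smooth_topology :: "'a::topological_space chart set \<Rightarrow> ('a \<Rightarrow> 'a) topology" where
  "smooth_topology A = topology_generated_by
     {N. \<exists>\<phi> c d K bs \<epsilon>. smooth_map A \<phi> \<and> c \<in> A \<and> d \<in> A \<and> compact K \<and> K \<subseteq> fst c \<and>
        \<phi> ` K \<subseteq> fst d \<and> set bs \<subseteq> Basis \<and> \<epsilon> > 0 \<and>
        N = {\<psi>. \<psi> ` K \<subseteq> fst d \<and>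
               (\<forall>x \<in> snd c ` K. norm (foldr dpartial bs (in_charts c d \<psi>) x
                                    - foldr dpartial bs (in_charts c d \<phi>) x) < \<epsilon>)}}"

definition symp0 :: "'a::topological_space chart set \<Rightarrow> ('a, real) field \<Rightarrow> ('a \<Rightarrow> 'a) set" where
  "symp0 A \<rho> = connected_component_of_set (subtopology (smooth_topology A) (symp A \<rho>)) id"

definition pullback ::
  "'a chart set \<Rightarrow> ('a \<Rightarrow> 'a) \<Rightarrow> ('a, mat2 \<times> mat2) field \<Rightarrow> ('a, mat2 \<times> mat2) field" where
  "pullback A \<phi> x = (\<lambda>c p. if valid_at A c p
     then (let d = (SOME d. valid_at A d (\<phi> p)) in pull_pair (jacobian c d \<phi> p) (x d (\<phi> p)))
     else 0)"

text \<open>The Lie algebra of the group: the fields \<open>X\<close> with \<open>L\<^sub>X \<rho> = 0\<close>.\<close>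

definition symplectic_vector_field ::
  "'a chart set \<Rightarrow> ('a, real) field \<Rightarrow> ('a, real^2) field \<Rightarrow> bool" where
  "symplectic_vector_field A \<rho> X \<longleftrightarrow> vector_field A X \<and>
     (\<forall>c p. valid_at A c p \<longrightarrow>
        (\<Sum>i\<in>UNIV. pd i (\<lambda>y. loc c \<rho> y * loc c X y $ i) (snd c p)) = 0)"

text \<open>The Lie derivative, that is, the derivative at \<open>t = 0\<close> of the pullback by the flow of \<open>X\<close>.\<close>

definition lie_derivative ::
  "'a chart set \<Rightarrow> ('a, real^2) field \<Rightarrow> ('a, mat2 \<times> mat2) field \<Rightarrow> ('a, mat2 \<times> mat2) field" where
  "lie_derivative A X x = (\<lambda>c p. if valid_at A c p
     then (let y = snd c p; J = fst (x c p); S = snd (x c p);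
               D = matrix (frechet_derivative (loc c X) (at y));
               dx = frechet_derivative (loc c x) (at y) (X c p)
           in (fst dx + J ** D - D ** J, snd dx + transpose D ** S + S ** D))
     else 0)"

section \<open>Genus at least two\<close>

definition cotangent_fields ::
  "'a chart set \<Rightarrow> ('a, real) field \<Rightarrow> ('a, mat2 \<times> mat2) field set" where
  "cotangent_fields A \<rho> = {x. pair_field A x \<and>
     (\<forall>c p. valid_at A c p \<longrightarrow> x c p \<in> cotangent_points (\<rho> c p))}"

definition tangent_fields ::
  "'a chart set \<Rightarrow> ('a, real) field \<Rightarrow> ('a, mat2 \<times> mat2) field \<Rightarrow> ('a, mat2 \<times> mat2) field set" where
  "tangent_fields A \<rho> x = {v. pair_field A v \<and>
     (\<forall>c p. valid_at A c p \<longrightarrow> v c p \<in> tangent_vectors (\<rho> c p) (x c p))}"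

text \<open>The Gauss--Codazzi equations for \<open>h = (1 + f) g\<^sub>J\<close> and \<open>B = h\<^sup>-\<^sup>1 \<sigma>\<close>.\<close>

definition MS0 :: "'a chart set \<Rightarrow> ('a, real) field \<Rightarrow> ('a, mat2 \<times> mat2) field set" where
  "MS0 A \<rho> = {x \<in> cotangent_fields A \<rho>. \<forall>c p. valid_at A c p \<longrightarrow>
     (let h = loc c (\<lambda>c p. (1 + ff (\<rho> c p) (x c p)) *\<^sub>R gJ (\<rho> c p) (fst (x c p)));
          B = (\<lambda>y. matrix_inv (h y) ** snd (loc c x y));
          y = snd c p
      in gauss_curvature h y = - 1 - det (B y) \<and>
         (\<forall>X Y. nabla_end h B y X *v Y - nabla_end h B y Y *v X = 0))}"

definition V_space ::
  "'a chart set \<Rightarrow> ('a, real) field \<Rightarrow> ('a, mat2 \<times> mat2) field \<Rightarrow> ('a, mat2 \<times> mat2) field set" where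
  "V_space A \<rho> x = {v \<in> tangent_fields A \<rho> x. \<forall>c p. valid_at A c p \<longrightarrow>
     (let g = loc c (\<lambda>c p. gJ (\<rho> c p) (fst (x c p)));
          C = loc c (\<lambda>c p. inverse (ff (\<rho> c p) (x c p)) *\<^sub>R
                sharp (\<rho> c p) (fst (x c p)) (form0 (\<rho> c p) (x c p) (v c p)));
          S = loc c (\<lambda>c p. snd (x c p));
          Jdot = loc c (\<lambda>c p. fst (v c p));
          r = \<rho> c p; J = fst (x c p); f = ff r (x c p); S0 = form0 r (x c p) (v c p);
          y = snd c p
      in \<forall>X. divergence g C y X = - inverse f * pairing r J (nabla_form g S y (J *v X)) (Jdot y) \<and>
             divergence g Jdot y X = - inverse (f\<^sup>2) * inner_form r J (nabla_form g S y (J *v X)) S0)}"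

definition surface_mgh ::
  "'a::topological_space chart set \<Rightarrow> ('a, real) field \<Rightarrow> ('a, mat2 \<times> mat2) field moduli_space" where
  "surface_mgh A \<rho> = \<lparr>
     pts = MS0 A \<rho>,
     gauge_orbit = (\<lambda>x. {pullback A \<phi> x | \<phi>. \<phi> \<in> symp0 A \<rho>}),
     tangent = V_space A \<rho>,
     orbit_tangent = (\<lambda>x. {lie_derivative A X x | X. symplectic_vector_field A \<rho> X}),
     smooth_curve = (\<lambda>\<gamma>. \<forall>c \<in> A. smooth_on (UNIV \<times> snd c ` fst c) (\<lambda>(t, y). loc c (\<gamma> t) y)),
     velocity = (\<lambda>\<gamma> c p. vector_derivative (\<lambda>t. \<gamma> t c p) (at 0)),
     metric = (\<lambda>x v w. surface_integral A \<rho> (\<lambda>c p. pmetric (\<rho> c p) (x c p) (v c p) (w c p))),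
     opI = (\<lambda>x v c p. pI (\<rho> c p) (x c p) (v c p)),
     opJ = (\<lambda>x v c p. pJ (\<rho> c p) (x c p) (v c p))\<rparr>"

definition surface_rot ::
  "real \<Rightarrow> ('a, mat2 \<times> mat2) field \<Rightarrow> ('a, mat2 \<times> mat2) field" where
  "surface_rot \<theta> x = (\<lambda>c p. rot \<theta> (x c p))"

definition surface_drot ::
  "real \<Rightarrow> ('a, mat2 \<times> mat2) field \<Rightarrow> ('a, mat2 \<times> mat2) field \<Rightarrow> ('a, mat2 \<times> mat2) field" where
  "surface_drot \<theta> x v = (\<lambda>c p. frechet_derivative (rot \<theta>) (at (x c p)) (v c p))"

text \<open>The area of the maximal surface: \<open>h = (1 + f) g\<^sub>J\<close> has area form \<open>(1 + f) \<rho>\<close>.\<close>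

definition maximal_surface_area ::
  "'a::topological_space chart set \<Rightarrow> ('a, real) field \<Rightarrow> ('a, mat2 \<times> mat2) field \<Rightarrow> real" where
  "maximal_surface_area A \<rho> x = surface_integral A \<rho> (\<lambda>c p. 1 + ff (\<rho> c p) (x c p))"

text \<open>The area as a function of the point of the moduli space, that is, of the gauge orbit.\<close>

definition area_function ::
  "'a::topological_space chart set \<Rightarrow> ('a, real) field \<Rightarrow> ('a, mat2 \<times> mat2) field set \<Rightarrow> real" where
  "area_function A \<rho> C = (THE a. \<forall>x \<in> C. maximal_surface_area A \<rho> x = a)"

end

theory Submission
  imports Defs
begin

text \<open>
  In terms of endomorphisms \<open>s = g\<^sup>-\<^sup>1\<sigma>\<close> and \<open>t = g\<^sup>-\<^sup>1\<sigma>\<^sub>0\<close> the rotation multiplies \<open>s\<close> and \<open>t\<close> by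
  \<open>cos \<theta> + sin \<theta> J\<close>, so \<open>\<bold>g\<close> and \<open>\<omega>\<^sub>I\<close> are visibly invariant and \<open>\<omega>\<^sub>J + i \<omega>\<^sub>K\<close> is multiplied by
  \<open>e\<^sup>-\<^sup>i\<^sup>\<theta>\<close>; as \<open>J\<close> is parallel, the Gauss--Codazzi equations and the equations of \<open>V\<close> are preserved.
  Pointwise, \<open>f\<close> is a Hamiltonian function for the velocity \<open>(0, \<sigma>(\<cdot>, J\<cdot>))\<close> of the rotation.

  In genus at least two the generator differs from this velocity by a Lie derivative \<open>L\<^sub>X(J, \<sigma>)\<close> with
  \<open>X\<close> symplectic.  For \<open>w = (A, \<sigma>\<^sub>0) \<in> V\<close> and \<open>\<tau> = f\<^sup>-\<^sup>1t\<close>, the Codazzi equation (which is conformally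
  invariant and says \<open>\<nabla>\<^sub>J\<^sub>X s = (\<nabla>\<^sub>X s) J\<close>) and the equations of \<open>V\<close> show that the density
  \<open>\<omega>\<^sub>I(L\<^sub>X(J, \<sigma>), w)\<close> is minus the divergence of \<open>f AX + \<langle>s, \<tau>\<rangle> JX + \<langle>sJ, \<tau>\<rangle> X\<close>, so by the divergence
  theorem the generator may be replaced by the velocity, and differentiating the area under the
  integral sign gives the claim.
\<close>

section \<open>Matrix algebra of the pointwise structure\<close>

text \<open>The vector representing the generator is known only through the condition that its
  difference from the velocity of the rotation is a Lie derivative. It is never computed: the
  Hamiltonian equation is verified for the velocity, which need not lie in V, and the difference is
  shown to pair to zero with V. Passing to endomorphisms pays off because in dimension two the maps
  anticommuting with J form a complex line, and a product of two of them commutes with J, hence is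
  \<alpha> + \<beta> J; most pointwise identities are this fact followed by a trace. The area
  measure is given only by a definite description, so integrals say nothing until a Borel measure
  with the prescribed values in charts has been constructed and shown to be unique and finite. Since
  f contains a square root, quantities built from it are tracked only as continuously
  differentiable, which is what the divergence theorem and differentiation under the integral use.
  In genus one the Hamiltonian function is f itself.\<close>

lemma mat2_eq_iff:
  "X = Y \<longleftrightarrow> X$1$1 = Y$1$1 \<and> X$1$2 = Y$1$2 \<and> X$2$1 = Y$2$1 \<and> X$2$2 = Y$2$2" for X Y :: mat2
  by (auto simp: vec_eq_iff forall_2)

lemma mat2_mult: "(X ** Y) $ i $ j = X$i$1 * Y$1$j + X$i$2 * Y$2$j" for X Y :: mat2
  by (simp add: matrix_matrix_mult_def sum_2)

lemma mat2_trace: "trace X = X$1$1 + X$2$2" for X :: mat2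
  by (simp add: trace_def sum_2)

lemmas mat2_simps = mat2_eq_iff mat2_mult mat2_trace transpose_def mat_def det_2

lemma matrix_neg_left: "(- X) ** Y = - (X ** Y)" for X Y :: mat2
  by (simp add: mat2_simps)

lemma matrix_neg_right: "X ** (- Y) = - (X ** Y)" for X Y :: mat2
  by (simp add: mat2_simps)

lemma trace_neg: "trace (- X) = - trace X" for X :: mat2
  by (simp add: mat2_simps)

lemma trace_scaleR: "trace (k *\<^sub>R X) = k * trace X" for X :: mat2
  by (simp add: mat2_simps algebra_simps)

lemma trace_0: "trace (0 :: mat2) = 0"
  by (simp add: mat2_simps)

lemma transpose_scaleR: "transpose (k *\<^sub>R X) = k *\<^sub>R transpose X" for X :: mat2
  by (simp add: mat2_simps)

lemma transpose_add: "transpose (X + Y) = transpose X + transpose Y" for X Y :: mat2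
  by (simp add: mat2_simps)

lemma scaleR_mult_left: "(k *\<^sub>R X) ** Y = k *\<^sub>R (X ** Y)" for X Y :: mat2
  by (simp add: mat2_simps algebra_simps)

lemma scaleR_mult_right: "X ** (k *\<^sub>R Y) = k *\<^sub>R (X ** Y)" for X Y :: mat2
  by (simp add: mat2_simps algebra_simps)

lemma mult_add_left: "(X + Y) ** Z = X ** Z + Y ** Z" for X Y Z :: mat2
  by (simp add: mat2_simps algebra_simps)

lemma mult_add_right: "Z ** (X + Y) = Z ** X + Z ** Y" for X Y Z :: mat2
  by (simp add: mat2_simps algebra_simps)

lemma mult_diff_left: "(X - Y) ** Z = X ** Z - Y ** Z" for X Y Z :: mat2
  by (simp add: mat2_simps algebra_simps)

lemma mult_diff_right: "Z ** (X - Y) = Z ** X - Z ** Y" for X Y Z :: mat2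
  by (simp add: mat2_simps algebra_simps)

lemma mult_0_left: "(0 :: mat2) ** X = 0" for X :: mat2
  by (simp add: mat2_simps)

lemma mult_0_right: "X ** (0 :: mat2) = 0" for X :: mat2
  by (simp add: mat2_simps)

lemmas mat2_algebra = matrix_neg_left matrix_neg_right scaleR_mult_left scaleR_mult_right
  mult_add_left mult_add_right mult_diff_left mult_diff_right mult_0_left mult_0_right
  matrix_mul_assoc[symmetric]

lemmas trace_linear = trace_neg trace_scaleR trace_add trace_sub trace_0

text \<open>Gram matrix of dx \<and> dy. The area form is r times it, so \<open>gJ\<close> factors
  as r times this matrix times J, and its inverse becomes explicit.\<close>

definition area_mat :: mat2 where
  "area_mat = (\<chi> i j. if i = j then 0 else if i = 1 then 1 else - 1)"

lemma area_mat_nth [simp]: "area_mat$1$1 = 0" "area_mat$1$2 = 1" "area_mat$2$1 = -1" "area_mat$2$2 = 0"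
  by (simp_all add: area_mat_def)

lemma gJ_eq: "gJ r J = r *\<^sub>R (area_mat ** J)"
  by (simp add: mat2_simps gJ_def area_form_def axis_def matrix_vector_mult_def sum_2)

text \<open>Pulling back an area form of the plane multiplies it by the determinant; the first
  identity is the dual statement for bivectors.\<close>

lemma area_mat_conj: "D ** area_mat ** transpose D = det D *\<^sub>R area_mat"
  "transpose D ** area_mat ** D = det D *\<^sub>R area_mat"
  by (simp_all add: mat2_simps algebra_simps)

lemma area_mat_sq: "area_mat ** area_mat = - mat 1"
  by (simp add: mat2_simps)

text \<open>With entries a, b, c, -a the equation a^2 + bc = -1 makes bc negative, so neither
  off-diagonal entry vanishes; coordinate computations further on divide by b.\<close>

lemma complex_structure_trace_det:
  fixes J :: mat2
  assumes "J ** J = - mat 1"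
  shows "J$2$2 = - J$1$1" "J$1$1 * J$1$1 + J$1$2 * J$2$1 = - 1" "J$1$2 \<noteq> 0" "J$2$1 \<noteq> 0"
proof -
  have e: "J$1$1 * J$1$1 + J$1$2 * J$2$1 = - 1" "J$1$1 * J$1$2 + J$1$2 * J$2$2 = 0"
    using assms by (auto simp: mat2_simps)
  show nz: "J$1$2 \<noteq> 0" "J$2$1 \<noteq> 0"
    using e(1) zero_le_square[of "J$1$1"] by (auto simp del: zero_le_square)
  from e(2) have "J$1$2 * (J$1$1 + J$2$2) = 0" by (simp add: algebra_simps)
  with nz show "J$2$2 = - J$1$1" by auto
  show "J$1$1 * J$1$1 + J$1$2 * J$2$1 = - 1" by (rule e)
qed

lemma complex_structure_det:
  fixes J :: mat2
  assumes "J ** J = - mat 1"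
  shows "det J = 1"
  using complex_structure_trace_det(1,2)[OF assms] by (simp add: det_2)

lemma complex_structure_trace:
  fixes J :: mat2
  assumes "J ** J = - mat 1"
  shows "trace J = 0"
  using complex_structure_trace_det(1)[OF assms] by (simp add: mat2_trace)

lemma mult_complex_structure_twice:
  fixes J X :: mat2
  assumes "J ** J = - mat 1"
  shows "J ** (J ** X) = - X"
  using matrix_neg_left[of "mat 1" X] by (simp add: matrix_mul_assoc assms)

lemma transpose_area_mat_mult:
  fixes J :: mat2
  assumes "J ** J = - mat 1"
  shows "transpose J ** area_mat = - (area_mat ** J)"
  using complex_structure_trace_det(1)[OF assms] by (simp add: mat2_simps)

section \<open>The metric of a complex structure and raising an index\<close>

lemma transpose_gJ:
  assumes "J ** J = - mat 1"
  shows "transpose (gJ r J) = gJ r J"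
  using complex_structure_trace_det(1)[OF assms] by (simp add: gJ_eq mat2_simps)

lemma det_gJ:
  assumes "J ** J = - mat 1"
  shows "det (gJ r J) = r\<^sup>2"
proof -
  have "det (gJ r J) = r * r * det J"
    by (simp add: gJ_eq det_2 mat2_mult algebra_simps)
  thus ?thesis by (simp add: complex_structure_det[OF assms] power2_eq_square)
qed

lemma matrix_inv_unique:
  fixes X Y :: mat2
  assumes "X ** Y = mat 1"
  shows "matrix_inv X = Y"
proof -
  have "Y ** X = mat 1" using assms matrix_left_right_inverse by blast
  hence "invertible X" using assms unfolding invertible_def by blast
  hence "X ** matrix_inv X = mat 1 \<and> matrix_inv X ** X = mat 1"
    unfolding invertible_def matrix_inv_def by (rule someI_ex)
  hence "matrix_inv X ** X = mat 1" by simp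
  have "matrix_inv X = matrix_inv X ** (X ** Y)" by (simp add: assms)
  also have "\<dots> = Y" by (simp add: matrix_mul_assoc \<open>matrix_inv X ** X = mat 1\<close>)
  finally show ?thesis .
qed

text \<open>Both J and \<open>area_mat\<close> square to -1, so the two signs in the inverse of
  their product cancel.\<close>

lemma matrix_inv_gJ:
  assumes "J ** J = - mat 1" "r \<noteq> 0"
  shows "matrix_inv (gJ r J) = (1 / r) *\<^sub>R (J ** area_mat)"
proof (rule matrix_inv_unique)
  have "area_mat ** (J ** (J ** area_mat)) = mat 1"
    by (simp add: mult_complex_structure_twice[OF assms(1)] matrix_neg_right area_mat_sq)
  thus "gJ r J ** ((1 / r) *\<^sub>R (J ** area_mat)) = mat 1"
    using assms(2) by (simp add: gJ_eq mat2_algebra)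
qed

lemma sharp_eq:
  assumes "J ** J = - mat 1" "r \<noteq> 0"
  shows "sharp r J S = (1 / r) *\<^sub>R (J ** (area_mat ** S))"
  by (simp add: sharp_def matrix_inv_gJ assms mat2_algebra)

lemma gJ_sharp:
  assumes "J ** J = - mat 1" "r \<noteq> 0"
  shows "gJ r J ** sharp r J S = S" "sharp r J (gJ r J ** E) = E"
proof -
  have 1: "area_mat ** (J ** (J ** (area_mat ** X))) = X" for X :: mat2
    by (simp add: mult_complex_structure_twice[OF assms(1)] matrix_neg_right)
       (simp add: matrix_mul_assoc area_mat_sq matrix_neg_left)
  have 2: "area_mat ** (area_mat ** X) = - X" for X :: mat2
    by (simp add: matrix_mul_assoc area_mat_sq matrix_neg_left)
  show "gJ r J ** sharp r J S = S" "sharp r J (gJ r J ** E) = E"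
    using assms(2) 1[of S]
    by (simp_all add: sharp_eq[OF assms] gJ_eq mat2_algebra 2 mult_complex_structure_twice[OF assms(1)])
qed

lemma sharp_linear:
  "sharp r J (S + T) = sharp r J S + sharp r J T"
  "sharp r J (S - T) = sharp r J S - sharp r J T"
  "sharp r J (k *\<^sub>R S) = k *\<^sub>R sharp r J S"
  "sharp r J (- S) = - sharp r J S"
  "sharp r J (S ** X) = sharp r J S ** X"
  by (simp_all add: sharp_def mat2_algebra)

lemma sharp_gJ: "J ** J = - mat 1 \<Longrightarrow> r \<noteq> 0 \<Longrightarrow> sharp r J (gJ r J) = mat 1"
  using gJ_sharp(2)[of J r "mat 1"] by simp

section \<open>Endomorphisms anticommuting with J\<close>

lemma TJ_D: "E \<in> TJ J \<Longrightarrow> J ** E = - (E ** J)"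
  by (simp add: TJ_def eq_neg_iff_add_eq_0 add.commute)

lemma TJ_iff: "E \<in> TJ J \<longleftrightarrow> J ** E = - (E ** J)"
  by (auto simp add: TJ_def eq_neg_iff_add_eq_0 add.commute)

lemma TJ_components:
  assumes "J ** J = - mat 1" "E \<in> TJ J"
  shows "E$2$2 = - E$1$1" "2 * J$1$1 * E$1$1 + J$1$2 * E$2$1 + J$2$1 * E$1$2 = 0"
proof -
  note J = complex_structure_trace_det[OF assms(1)]
  have *: "E$1$1 * J$1$2 + E$1$2 * J$2$2 + (J$1$1 * E$1$2 + J$1$2 * E$2$2) = 0"
    and **: "E$1$1 * J$1$1 + E$1$2 * J$2$1 + (J$1$1 * E$1$1 + J$1$2 * E$2$1) = 0"
    using assms(2) by (auto simp: TJ_def mat2_simps)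
  from * J(1) have "J$1$2 * (E$1$1 + E$2$2) = 0" by (simp add: algebra_simps)
  with J(3) show "E$2$2 = - E$1$1" by auto
  from ** show "2 * J$1$1 * E$1$1 + J$1$2 * E$2$1 + J$2$1 * E$1$2 = 0" by (simp add: algebra_simps)
qed

lemma TJ_trace: "J ** J = - mat 1 \<Longrightarrow> E \<in> TJ J \<Longrightarrow> trace E = 0"
  using TJ_components[of J E] by (simp add: mat2_trace)

lemma TJ_push:
  fixes X :: mat2
  assumes "E \<in> TJ J"
  shows "J ** E = - (E ** J)" "J ** (E ** X) = - (E ** (J ** X))"
  using TJ_D[OF assms] by (simp_all add: matrix_mul_assoc matrix_neg_left)

lemma TJ_add: "E \<in> TJ J \<Longrightarrow> F \<in> TJ J \<Longrightarrow> E + F \<in> TJ J"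
  by (simp add: TJ_iff mult_add_left mult_add_right)

lemma TJ_scaleR: "E \<in> TJ J \<Longrightarrow> k *\<^sub>R E \<in> TJ J"
  by (simp add: TJ_iff scaleR_mult_left scaleR_mult_right)

lemma TJ_neg: "E \<in> TJ J \<Longrightarrow> - E \<in> TJ J"
  by (simp add: TJ_iff matrix_neg_left matrix_neg_right)

lemma TJ_mult_J:
  assumes "J ** J = - mat 1" "E \<in> TJ J"
  shows "E ** J \<in> TJ J"
  unfolding TJ_iff using TJ_push[OF assms(2)] by (simp add: mat2_algebra)

lemma TJ_J_mult: "J ** J = - mat 1 \<Longrightarrow> E \<in> TJ J \<Longrightarrow> J ** E \<in> TJ J"
  by (simp add: TJ_push(1) TJ_neg TJ_mult_J)

lemmas TJ_closed = TJ_add TJ_scaleR TJ_neg TJ_mult_J TJ_J_mult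

text \<open>With S = g E the condition \<sigma>(J., J.) = -\<sigma> becomes E J = -J E, because a J
  of determinant 1 preserves the area form. Symmetry of S is then automatic: it is the linear
  relation between the entries of J and E in \<open>TJ_components\<close>.\<close>

lemma TJ_dual_iff:
  assumes "J ** J = - mat 1" "r \<noteq> 0"
  shows "S \<in> TJ_dual J \<longleftrightarrow> sharp r J S \<in> TJ J"
proof -
  define E where "E = sharp r J S"
  have S: "S = r *\<^sub>R (area_mat ** J ** E)"
    using gJ_sharp(1)[OF assms, of S] by (simp add: E_def gJ_eq mat2_algebra)
  note J = complex_structure_trace_det[OF assms(1)]
  have tJ: "transpose J ** (area_mat ** J) = area_mat"
    using area_mat_conj(2)[of J] complex_structure_det[OF assms(1)] by (simp add: mat2_algebra)
  have *: "transpose J ** S ** J = r *\<^sub>R (area_mat ** (E ** J))"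
  proof -
    have "transpose J ** S ** J = r *\<^sub>R ((transpose J ** (area_mat ** J)) ** (E ** J))"
      by (simp add: S mat2_algebra)
    thus ?thesis by (simp only: tJ)
  qed
  have **: "r *\<^sub>R (area_mat ** X) = r *\<^sub>R (area_mat ** Y) \<longleftrightarrow> X = Y" for X Y :: mat2
    using assms(2) by (simp add: mat2_eq_iff mat2_mult) blast
  have a: "transpose J ** S ** J = - S \<longleftrightarrow> E ** J = - (J ** E)"
    unfolding * using **[of "E ** J" "- (J ** E)"] by (simp add: S mat2_algebra)
  have b: "transpose S = S" if "E \<in> TJ J"
  proof -
    have "2 * J$1$1 * E$1$1 + J$1$2 * E$2$1 + J$2$1 * E$1$2 = 0" "E$2$2 = - E$1$1"
      using TJ_components[OF assms(1) that] by simp_all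
    hence "transpose (area_mat ** J ** E) = area_mat ** J ** E"
      using J(1) by (auto simp: mat2_eq_iff mat2_mult transpose_def algebra_simps)
    thus ?thesis by (simp add: S transpose_scaleR)
  qed
  show ?thesis
    using a b by (auto simp: TJ_dual_def E_def[symmetric] TJ_iff)
qed

lemma trace_mult_commute: "trace (X ** Y) = trace (Y ** X)" for X Y :: mat2
  by (simp add: mat2_simps)

lemma TJ_trace_J:
  assumes "J ** J = - mat 1" "E \<in> TJ J" "F \<in> TJ J"
  shows "trace ((E ** J) ** (F ** J)) = trace (E ** F)"
    "trace (E ** (F ** J)) = - trace ((E ** J) ** F)"
  by (simp_all add: mat2_algebra TJ_push[OF assms(2)] TJ_push[OF assms(3)] assms(1) trace_neg)

section \<open>The structure in terms of endomorphisms\<close>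

text \<open>The pair (A, t) = (\<open>fst v\<close>, \<open>sdot r x v\<close>) serves as
  coordinates on tangent vectors: tangency means that A and t lie in \<open>TJ\<close>, the operator
  I acts by (-J A, -t J), and the operator J by (t / f, f A).\<close>

definition sdot :: "real \<Rightarrow> mat2 \<times> mat2 \<Rightarrow> mat2 \<times> mat2 \<Rightarrow> mat2" where
  "sdot r x v = sharp r (fst x) (form0 r x v)"

lemma inner_form_sharp: "inner_form r J S T = trace (sharp r J S ** sharp r J T) / 2"
  by (simp add: inner_form_def)

lemma pairing_sharp: "pairing r J S E = trace (sharp r J S ** E) / 2"
  by (simp add: pairing_def)

lemma pmetric_sdot:
  "pmetric r x v w = ff r x * trace (fst v ** fst w) / 2
     - inverse (ff r x) * trace (sdot r x v ** sdot r x w) / 2"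
  by (simp add: pmetric_def inner_end_def inner_form_sharp sdot_def)

text \<open>Completing the square. The left side is b^2 times half the trace of E^2, for E with
  entries p, q, q', -p anticommuting with the complex structure a, b, c, -a.\<close>

lemma complex_structure_square_identity:
  fixes a b c p q q' :: real
  assumes "a * a + b * c = - 1" "2 * a * p + b * q' + c * q = 0"
  shows "b * b * (p * p + q * q') = (b * p - a * q)\<^sup>2 + q\<^sup>2"
proof -
  have "b * b * (p * p + q * q') = b * b * p * p + b * q * (b * q')" by (simp add: algebra_simps)
  also have "b * q' = - (2 * a * p) - c * q" using assms(2) by linarith
  also have "b * b * p * p + b * q * (- (2 * a * p) - c * q) = b * b * p * p - 2 * a * b * p * q - (b * c) * q * q"
    by (simp add: algebra_simps)
  also have "b * c = - 1 - a * a" using assms(1) by linarith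
  finally show ?thesis by (simp add: algebra_simps power2_eq_square)
qed

text \<open>This positivity is the source of f \<ge> 1, hence of the invertibility of f.\<close>

lemma trace_sq_nonneg:
  assumes "J ** J = - mat 1" "E \<in> TJ J"
  shows "trace (E ** E) \<ge> 0"
proof -
  note J = complex_structure_trace_det[OF assms(1)] and E = TJ_components[OF assms]
  have t: "trace (E ** E) = 2 * (E$1$1 * E$1$1 + E$1$2 * E$2$1)"
    by (simp add: mat2_trace mat2_mult E(1))
  let ?a = "J$1$1" and ?b = "J$1$2" and ?c = "J$2$1" and ?p = "E$1$1" and ?q = "E$1$2" and ?q' = "E$2$1"
  have "?b * ?b * (?p * ?p + ?q * ?q') = (?b * ?p - ?a * ?q)\<^sup>2 + ?q\<^sup>2"
    by (rule complex_structure_square_identity[OF J(2) E(2)])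
  hence "?b * ?b * (?p * ?p + ?q * ?q') \<ge> 0" by simp
  moreover have "?b * ?b > 0" using J(3) by (auto simp: zero_less_mult_iff linorder_neq_iff)
  ultimately show ?thesis unfolding t by (simp add: zero_le_mult_iff)
qed

lemma ff_sq:
  assumes "J ** J = - mat 1" "r \<noteq> 0" "S \<in> TJ_dual J"
  shows "ff r (J, S) \<ge> 1" "(ff r (J, S))\<^sup>2 = 1 + trace (sharp r J S ** sharp r J S) / 2"
  using trace_sq_nonneg[OF assms(1), of "sharp r J S"] assms(3)[unfolded TJ_dual_iff[OF assms(1,2)]]
  by (simp_all add: ff_def inner_form_sharp)

section \<open>Tangent vectors and the operators I and J\<close>

lemma cotangent_points_iff:
  "x \<in> cotangent_points r \<longleftrightarrow> fst x \<in> complex_structures r \<and> snd x \<in> TJ_dual (fst x)"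
  by (cases x) (simp add: cotangent_points_def)

lemma cotangent_points_D:
  assumes "x \<in> cotangent_points r" "r > 0"
  shows "fst x ** fst x = - mat 1" "r \<noteq> 0" "sharp r (fst x) (snd x) \<in> TJ (fst x)" "ff r x \<ge> 1"
    "(ff r x)\<^sup>2 = 1 + trace (sharp r (fst x) (snd x) ** sharp r (fst x) (snd x)) / 2"
proof -
  obtain J S where x: "x = (J, S)" by (cases x)
  show *: "fst x ** fst x = - mat 1" "r \<noteq> 0"
    using assms by (auto simp: cotangent_points_iff complex_structures_def)
  have d: "snd x \<in> TJ_dual (fst x)" using assms(1) by (simp add: cotangent_points_iff)
  show "sharp r (fst x) (snd x) \<in> TJ (fst x)"
    using d TJ_dual_iff[OF *] by blast
  show "ff r x \<ge> 1" "(ff r x)\<^sup>2 = 1 + trace (sharp r (fst x) (snd x) ** sharp r (fst x) (snd x)) / 2"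
    using ff_sq[of J r S] * d by (simp_all add: x)
qed

lemma tangent_vectors_iff:
  assumes "fst x ** fst x = - mat 1" "r \<noteq> 0"
  shows "v \<in> tangent_vectors r x \<longleftrightarrow> fst v \<in> TJ (fst x) \<and> sdot r x v \<in> TJ (fst x)"
proof -
  obtain J S where x: "x = (J, S)" by (cases x)
  obtain B T where v: "v = (B, T)" by (cases v)
  have "(\<exists>T0 \<in> TJ_dual J. T = T0 - pairing r J S (J ** B) *\<^sub>R gJ r J) \<longleftrightarrow> form0 r x v \<in> TJ_dual J"
    by (force simp: form0_def x v)
  thus ?thesis using assms
    by (simp add: tangent_vectors_def x v sdot_def TJ_dual_iff)
qed

text \<open>The trace part in \<open>pI\<close> is the one prescribed for a tangent vector whose
  first component is -J A, since J (-J A) = A; adding the correction in \<open>form0\<close> removes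
  it.\<close>

lemma form0_pI:
  assumes "fst x ** fst x = - mat 1"
  shows "form0 r x (pI r x v) = - (form0 r x v ** fst x)"
proof -
  have "fst (pI r x v) = - (fst x ** fst v)"
    "snd (pI r x v) = - (form0 r x v ** fst x) - pairing r (fst x) (snd x) (fst v) *\<^sub>R gJ r (fst x)"
    by (simp_all add: pI_def Let_def)
  thus ?thesis
    by (simp add: form0_def[of r x "pI r x v"] matrix_neg_right mult_complex_structure_twice[OF assms])
qed

text \<open>Here too the g-term is the prescribed trace part: J t = -t J turns the pairing of
  \<sigma> with J (t / f) into minus the coefficient occurring in \<open>pJ\<close>.\<close>

lemma form0_pJ:
  assumes "fst x ** fst x = - mat 1" "r \<noteq> 0" "sharp r (fst x) (snd x) \<in> TJ (fst x)" "sdot r x v \<in> TJ (fst x)"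
  shows "form0 r x (pJ r x v) = ff r x *\<^sub>R (gJ r (fst x) ** fst v)"
proof -
  let ?J = "fst x" and ?s = "sharp r (fst x) (snd x)" and ?t = "sdot r x v" and ?f = "ff r x"
  have "pairing r ?J (snd x) (?J ** (inverse ?f *\<^sub>R ?t)) = - (inverse ?f * inner_form r ?J (snd x) (form0 r x v ** ?J))"
    by (simp add: pairing_sharp inner_form_sharp sharp_linear sdot_def[symmetric] scaleR_mult_right
        trace_scaleR TJ_push(1)[OF assms(4)] matrix_neg_right trace_neg)
  moreover have "fst (pJ r x v) = inverse ?f *\<^sub>R ?t"
    "snd (pJ r x v) = ?f *\<^sub>R (gJ r ?J ** fst v) + (inverse ?f * inner_form r ?J (snd x) (form0 r x v ** ?J)) *\<^sub>R gJ r ?J"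
    by (simp_all add: pJ_def Let_def sdot_def)
  ultimately show ?thesis
    by (simp add: form0_def[of r x "pJ r x v"])
qed

lemma pI_components:
  assumes "fst x ** fst x = - mat 1"
  shows "fst (pI r x v) = - (fst x ** fst v)" "sdot r x (pI r x v) = - (sdot r x v ** fst x)"
  by (simp_all add: sdot_def form0_pI assms sharp_linear) (simp add: pI_def Let_def)

lemma pJ_components:
  assumes "fst x ** fst x = - mat 1" "r \<noteq> 0" "sharp r (fst x) (snd x) \<in> TJ (fst x)" "sdot r x v \<in> TJ (fst x)"
  shows "fst (pJ r x v) = inverse (ff r x) *\<^sub>R sdot r x v" "sdot r x (pJ r x v) = ff r x *\<^sub>R fst v"
proof -
  show "fst (pJ r x v) = inverse (ff r x) *\<^sub>R sdot r x v"
    by (simp add: pJ_def Let_def sdot_def)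
  show "sdot r x (pJ r x v) = ff r x *\<^sub>R fst v"
    unfolding sdot_def[of r x "pJ r x v"] form0_pJ[OF assms] sharp_linear(3) gJ_sharp(2)[OF assms(1,2)] ..
qed

lemma form0_linear:
  "form0 r x (v + w) = form0 r x v + form0 r x w"
  "form0 r x (v - w) = form0 r x v - form0 r x w"
  by (simp_all add: form0_def pairing_def mult_add_right mult_diff_right trace_linear
      add_divide_distrib diff_divide_distrib algebra_simps)

lemma sdot_linear:
  "sdot r x (v + w) = sdot r x v + sdot r x w"
  "sdot r x (v - w) = sdot r x v - sdot r x w"
  by (simp_all add: sdot_def form0_linear sharp_linear)

lemma pmetric_diff: "pmetric r x (u - v) w = pmetric r x u w - pmetric r x v w"
  by (simp add: pmetric_sdot sdot_linear mult_diff_left trace_sub) (simp add: algebra_simps diff_divide_distrib)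

text \<open>The operator J exchanges the components A and t with weights 1 / f and f, which cancel
  the weights f and 1 / f of the metric. Hence \<omega>_J and \<omega>_K are free of f and only
  \<omega>_I contains it.\<close>

lemma omega_components:
  assumes "x \<in> cotangent_points r" "r > 0" "v \<in> tangent_vectors r x" "w \<in> tangent_vectors r x"
  shows "pmetric r x v (pI r x w) = - ff r x * trace (fst v ** (fst x ** fst w)) / 2
       + inverse (ff r x) * trace (sdot r x v ** (sdot r x w ** fst x)) / 2"
    "pmetric r x v (pJ r x w) = trace (fst v ** sdot r x w) / 2 - trace (sdot r x v ** fst w) / 2"
    "pmetric r x v (pI r x (pJ r x w)) = trace (fst v ** (sdot r x w ** fst x)) / 2
       - trace (sdot r x v ** (fst x ** fst w)) / 2"
proof -
  note x = cotangent_points_D[OF assms(1,2)]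
  have v: "fst v \<in> TJ (fst x)" "sdot r x v \<in> TJ (fst x)"
    and w: "fst w \<in> TJ (fst x)" "sdot r x w \<in> TJ (fst x)"
    using assms(3,4) tangent_vectors_iff[OF x(1,2)] by auto
  have f: "ff r x * (inverse (ff r x) * k) = k" "inverse (ff r x) * (ff r x * k) = k" for k
    using x(4) by simp_all
  show "pmetric r x v (pI r x w) = - ff r x * trace (fst v ** (fst x ** fst w)) / 2
       + inverse (ff r x) * trace (sdot r x v ** (sdot r x w ** fst x)) / 2"
    by (simp add: pmetric_sdot pI_components x mat2_algebra trace_linear)
  show "pmetric r x v (pJ r x w) = trace (fst v ** sdot r x w) / 2 - trace (sdot r x v ** fst w) / 2"
    by (simp add: f pmetric_sdot pJ_components x w mat2_algebra trace_linear)
  show "pmetric r x v (pI r x (pJ r x w)) = trace (fst v ** (sdot r x w ** fst x)) / 2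
       - trace (sdot r x v ** (fst x ** fst w)) / 2"
    by (simp add: f pmetric_sdot pI_components pJ_components x w mat2_algebra trace_linear
        TJ_push(1)[OF w(2)] TJ_push(1)[OF w(1)])
qed

section \<open>Rotations\<close>

text \<open>The last summand comes from the dependence of S J on J.\<close>

definition rot_deriv :: "real \<Rightarrow> mat2 \<times> mat2 \<Rightarrow> mat2 \<times> mat2 \<Rightarrow> mat2 \<times> mat2" where
  "rot_deriv \<theta> x v = (fst v, cos \<theta> *\<^sub>R snd v + sin \<theta> *\<^sub>R (snd v ** fst x + snd x ** fst v))"

lemma rot_components: "fst (rot \<theta> x) = fst x" "snd (rot \<theta> x) = cos \<theta> *\<^sub>R snd x + sin \<theta> *\<^sub>R (snd x ** fst x)"
  using rot_eq[of \<theta> "fst x" "snd x"] by simp_all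

lemma bounded_bilinear_matrix_mult: "bounded_bilinear ((**) :: mat2 \<Rightarrow> mat2 \<Rightarrow> mat2)"
proof -
  have "bilinear ((**) :: mat2 \<Rightarrow> mat2 \<Rightarrow> mat2)"
    by (simp add: bilinear_def linear_iff mat2_algebra)
  thus ?thesis by (simp add: bilinear_conv_bounded_bilinear)
qed

lemmas has_derivative_matrix_mult = bounded_bilinear.FDERIV[OF bounded_bilinear_matrix_mult]

lemma rot_has_derivative: "(rot \<theta> has_derivative rot_deriv \<theta> x) (at x)"
proof -
  have *: "((\<lambda>x. (fst x, cos \<theta> *\<^sub>R snd x + sin \<theta> *\<^sub>R (snd x ** fst x))) has_derivative rot_deriv \<theta> x) (at x)"
    unfolding rot_deriv_def
    by (rule derivative_eq_intros has_derivative_matrix_mult | rule ext | simp add: algebra_simps)+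
  have "rot \<theta> = (\<lambda>x. (fst x, cos \<theta> *\<^sub>R snd x + sin \<theta> *\<^sub>R (snd x ** fst x)))"
    by (rule ext) (simp add: prod_eq_iff rot_components)
  thus ?thesis using * by simp
qed

lemma rot_frechet_derivative: "frechet_derivative (rot \<theta>) (at x) = rot_deriv \<theta> x"
  using frechet_derivative_at[OF rot_has_derivative] by simp

lemma rot_0: "rot 0 x = x"
  by (simp add: prod_eq_iff rot_components)

lemma rot_2pi: "rot (2 * pi) x = x"
  by (simp add: prod_eq_iff rot_components)

lemma rot_zero: "rot \<theta> 0 = 0" "rot_deriv \<theta> 0 0 = 0"
  by (simp_all add: prod_eq_iff rot_components rot_deriv_def mult_0_left)

lemma rot_rot:
  assumes "fst x ** fst x = - mat 1"
  shows "rot (\<theta> + \<phi>) x = rot \<theta> (rot \<phi> x)"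
  using assms by (simp add: prod_eq_iff rot_components cos_add sin_add mat2_algebra matrix_neg_right)
     (simp add: algebra_simps)

lemma sharp_rot:
  "sharp r J (snd (rot \<theta> x)) = cos \<theta> *\<^sub>R sharp r J (snd x) + sin \<theta> *\<^sub>R (sharp r J (snd x) ** fst x)"
  by (simp add: rot_components sharp_linear)

text \<open>On \<open>TJ\<close> right multiplication by J is both an isometry of the trace form and
  skew for it, so the square terms combine by cos^2 + sin^2 = 1 and the mixed terms cancel.\<close>

lemma trace_rot:
  assumes "J ** J = - mat 1" "E \<in> TJ J" "F \<in> TJ J"
  shows "trace ((cos \<theta> *\<^sub>R E + sin \<theta> *\<^sub>R (E ** J)) ** (cos \<theta> *\<^sub>R F + sin \<theta> *\<^sub>R (F ** J))) = trace (E ** F)"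
proof -
  have "trace ((cos \<theta> *\<^sub>R E + sin \<theta> *\<^sub>R (E ** J)) ** (cos \<theta> *\<^sub>R F + sin \<theta> *\<^sub>R (F ** J)))
    = (cos \<theta>)\<^sup>2 * trace (E ** F) + (sin \<theta>)\<^sup>2 * trace ((E ** J) ** (F ** J))
      + cos \<theta> * sin \<theta> * (trace (E ** (F ** J)) + trace ((E ** J) ** F))"
    by (simp add: mult_add_left mult_add_right scaleR_mult_left scaleR_mult_right trace_linear
        power2_eq_square algebra_simps)
  also have "\<dots> = ((cos \<theta>)\<^sup>2 + (sin \<theta>)\<^sup>2) * trace (E ** F)"
    unfolding TJ_trace_J[OF assms] by (simp only: distrib_right) simp
  also have "\<dots> = trace (E ** F)" by (simp only: sin_cos_squared_add2 mult_1)
  finally show ?thesis .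
qed

lemma rot_cotangent_points:
  assumes "x \<in> cotangent_points r" "r > 0"
  shows "rot \<theta> x \<in> cotangent_points r" "ff r (rot \<theta> x) = ff r x"
proof -
  note x = cotangent_points_D[OF assms]
  have "sharp r (fst x) (snd (rot \<theta> x)) \<in> TJ (fst x)"
    unfolding sharp_rot by (intro TJ_closed x)
  thus "rot \<theta> x \<in> cotangent_points r"
    using assms(1) TJ_dual_iff[OF x(1,2)] by (simp add: cotangent_points_iff rot_components(1))
  show "ff r (rot \<theta> x) = ff r x"
    by (simp add: ff_def inner_form_sharp rot_components(1) sharp_rot trace_rot[OF x(1,3,3)])
qed

text \<open>In dimension two the commutant of a complex structure is the field it generates. The
  coefficients are read off from the first row, using that the entry b is nonzero.\<close>

lemma commuting_with_J:
  fixes J M :: mat2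
  assumes "J ** J = - mat 1" "J ** M = M ** J"
  shows "\<exists>\<alpha> \<beta>. M = \<alpha> *\<^sub>R mat 1 + \<beta> *\<^sub>R J"
proof -
  note J = complex_structure_trace_det[OF assms(1)]
  have 1: "J$1$2 * M$2$1 = M$1$2 * J$2$1" and 2: "J$1$1 * M$1$2 + J$1$2 * M$2$2 = M$1$1 * J$1$2 + M$1$2 * J$2$2"
    using arg_cong[OF assms(2), of "\<lambda>X. X$1$1"] arg_cong[OF assms(2), of "\<lambda>X. X$1$2"]
    by (simp_all add: mat2_mult)
  define \<beta> where "\<beta> = M$1$2 / J$1$2"
  define \<alpha> where "\<alpha> = M$1$1 - \<beta> * J$1$1"
  have m12: "M$1$2 = \<beta> * J$1$2" using J(3) by (simp add: \<beta>_def)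
  have "J$1$2 * M$2$1 = J$1$2 * (\<beta> * J$2$1)" using 1 by (simp add: m12)
  hence m21: "M$2$1 = \<beta> * J$2$1" using J(3) by (simp only: mult_cancel_left) simp
  have "J$1$2 * M$2$2 = J$1$2 * (M$1$1 - 2 * (\<beta> * J$1$1))"
    using 2 J(1) by (simp add: m12 algebra_simps)
  hence m22: "M$2$2 = M$1$1 - 2 * (\<beta> * J$1$1)" using J(3) by (simp only: mult_cancel_left) simp
  have "M = \<alpha> *\<^sub>R mat 1 + \<beta> *\<^sub>R J"
    by (simp add: mat2_eq_iff mat_def m12 m21 m22 J(1) \<alpha>_def)
  thus ?thesis by blast
qed

text \<open>A product of two J-antilinear maps is J-linear, hence a combination of 1 and J; traces
  recover the coefficients.\<close>

lemma TJ_mult: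
  assumes "J ** J = - mat 1" "E \<in> TJ J" "F \<in> TJ J"
  shows "E ** F = (trace (E ** F) / 2) *\<^sub>R mat 1 - (trace (E ** (F ** J)) / 2) *\<^sub>R J"
proof -
  have "J ** (E ** F) = (E ** F) ** J"
    by (simp add: TJ_push[OF assms(2)] TJ_push[OF assms(3)] mat2_algebra)
  then obtain \<alpha> \<beta> where EF: "E ** F = \<alpha> *\<^sub>R mat 1 + \<beta> *\<^sub>R J"
    using commuting_with_J[OF assms(1)] by blast
  have J: "trace J = 0" "trace (mat 1 :: mat2) = 2"
    by (rule complex_structure_trace[OF assms(1)]) (simp add: mat2_trace mat_def)
  have "trace (E ** F) = 2 * \<alpha>" by (simp add: EF trace_linear J)
  moreover have "trace (E ** (F ** J)) = - 2 * \<beta>"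
    by (simp add: matrix_mul_assoc EF mult_add_left scaleR_mult_left assms(1) trace_linear J)
  ultimately show ?thesis by (simp add: EF)
qed

text \<open>The variation of J contributes the term s A, which \<open>TJ_mult\<close> splits into
  tr(s A) / 2 plus tr(s J A) / 2 times J. The scalar part cancels the change of the trace
  correction, and the J part is what has to be added to T J to obtain t J.\<close>

lemma sdot_rot_deriv:
  assumes "fst x ** fst x = - mat 1" "r \<noteq> 0" "sharp r (fst x) (snd x) \<in> TJ (fst x)" "fst v \<in> TJ (fst x)"
  shows "sdot r (rot \<theta> x) (rot_deriv \<theta> x v) = cos \<theta> *\<^sub>R sdot r x v + sin \<theta> *\<^sub>R (sdot r x v ** fst x)"
proof -
  let ?J = "fst x" and ?s = "sharp r (fst x) (snd x)" and ?A = "fst v" and ?T = "sharp r (fst x) (snd v)"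
  have sdot: "sdot r x v = ?T + (trace (?s ** (?J ** ?A)) / 2) *\<^sub>R mat 1"
    by (simp add: sdot_def form0_def sharp_linear pairing_sharp sharp_gJ assms(1,2))
  have sA: "?s ** ?A = (trace (?s ** ?A) / 2) *\<^sub>R mat 1 + (trace (?s ** (?J ** ?A)) / 2) *\<^sub>R ?J"
    using TJ_mult[OF assms(1,3,4)]
    by (simp add: TJ_push(1)[OF assms(4)] matrix_neg_right trace_neg)
  have "sdot r (rot \<theta> x) (rot_deriv \<theta> x v)
    = cos \<theta> *\<^sub>R ?T + sin \<theta> *\<^sub>R (?T ** ?J + ?s ** ?A)
      + (trace ((cos \<theta> *\<^sub>R ?s + sin \<theta> *\<^sub>R (?s ** ?J)) ** (?J ** ?A)) / 2) *\<^sub>R mat 1"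
    by (simp add: sdot_def form0_def rot_components rot_deriv_def sharp_linear pairing_sharp sharp_gJ assms(1,2))
  also have "trace ((cos \<theta> *\<^sub>R ?s + sin \<theta> *\<^sub>R (?s ** ?J)) ** (?J ** ?A))
    = cos \<theta> * trace (?s ** (?J ** ?A)) - sin \<theta> * trace (?s ** ?A)"
    by (simp add: mat2_algebra trace_linear mult_complex_structure_twice[OF assms(1)])
  finally show ?thesis
    unfolding sdot by (subst (asm) sA) (simp add: mult_add_left scaleR_mult_left algebra_simps diff_divide_distrib)
qed

lemma rot_deriv_tangent_vectors:
  assumes "x \<in> cotangent_points r" "r > 0" "v \<in> tangent_vectors r x"
  shows "rot_deriv \<theta> x v \<in> tangent_vectors r (rot \<theta> x)"
proof -
  note x = cotangent_points_D[OF assms(1,2)]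
  have v: "fst v \<in> TJ (fst x)" "sdot r x v \<in> TJ (fst x)"
    using assms(3) tangent_vectors_iff[OF x(1,2)] by auto
  have "sdot r (rot \<theta> x) (rot_deriv \<theta> x v) \<in> TJ (fst x)"
    unfolding sdot_rot_deriv[OF x(1-3) v(1)] by (intro TJ_closed x v)
  thus ?thesis using v(1) x(1,2) by (subst tangent_vectors_iff) (simp_all add: rot_components(1), simp add: rot_deriv_def)
qed

text \<open>The component A is fixed and t is turned by \<theta>. The metric and \<omega>_I contain
  terms of type A A' and t t', in which the turning cancels; \<omega>_J and \<omega>_K pair one A
  with one t and so turn once, into each other.\<close>

lemma rot_deriv_omega:
  assumes "x \<in> cotangent_points r" "r > 0" "v \<in> tangent_vectors r x" "w \<in> tangent_vectors r x"
  shows "pmetric r (rot \<theta> x) (rot_deriv \<theta> x v) (rot_deriv \<theta> x w) = pmetric r x v w"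
    "pmetric r (rot \<theta> x) (rot_deriv \<theta> x v) (pI r (rot \<theta> x) (rot_deriv \<theta> x w)) = pmetric r x v (pI r x w)"
    "pmetric r (rot \<theta> x) (rot_deriv \<theta> x v) (pJ r (rot \<theta> x) (rot_deriv \<theta> x w))
      = cos \<theta> * pmetric r x v (pJ r x w) + sin \<theta> * pmetric r x v (pI r x (pJ r x w))"
    "pmetric r (rot \<theta> x) (rot_deriv \<theta> x v) (pI r (rot \<theta> x) (pJ r (rot \<theta> x) (rot_deriv \<theta> x w)))
      = cos \<theta> * pmetric r x v (pI r x (pJ r x w)) - sin \<theta> * pmetric r x v (pJ r x w)"
proof -
  note x = cotangent_points_D[OF assms(1,2)]
  have v: "fst v \<in> TJ (fst x)" "sdot r x v \<in> TJ (fst x)"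
    and w: "fst w \<in> TJ (fst x)" "sdot r x w \<in> TJ (fst x)"
    using assms(3,4) tangent_vectors_iff[OF x(1,2)] by auto
  note rx = rot_cotangent_points[OF assms(1,2), of \<theta>]
  note rv = rot_deriv_tangent_vectors[OF assms(1-3), of \<theta>] and rw = rot_deriv_tangent_vectors[OF assms(1,2,4), of \<theta>]
  note sv = sdot_rot_deriv[OF x(1-3) v(1), of \<theta>] and sw = sdot_rot_deriv[OF x(1-3) w(1), of \<theta>]
  have f: "fst (rot_deriv \<theta> x u) = fst u" for u by (simp add: rot_deriv_def)
  let ?r = "\<lambda>E. cos \<theta> *\<^sub>R E + sin \<theta> *\<^sub>R (E ** fst x)"
  have "?r (sdot r x w) ** fst x = ?r (sdot r x w ** fst x)"
    by (simp add: mult_add_left scaleR_mult_left)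
  hence tr: "trace (?r (sdot r x v) ** (?r (sdot r x w) ** fst x)) = trace (sdot r x v ** (sdot r x w ** fst x))"
    using trace_rot[OF x(1) v(2) TJ_mult_J[OF x(1) w(2)], of \<theta>] by simp
  show "pmetric r (rot \<theta> x) (rot_deriv \<theta> x v) (rot_deriv \<theta> x w) = pmetric r x v w"
    unfolding pmetric_sdot sv sw f trace_rot[OF x(1) v(2) w(2)] rx(2) ..
  show "pmetric r (rot \<theta> x) (rot_deriv \<theta> x v) (pI r (rot \<theta> x) (rot_deriv \<theta> x w)) = pmetric r x v (pI r x w)"
    unfolding omega_components[OF rx(1) assms(2) rv rw] omega_components[OF assms] f rot_components(1) rx(2) sv sw tr ..
  show "pmetric r (rot \<theta> x) (rot_deriv \<theta> x v) (pJ r (rot \<theta> x) (rot_deriv \<theta> x w))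
      = cos \<theta> * pmetric r x v (pJ r x w) + sin \<theta> * pmetric r x v (pI r x (pJ r x w))"
    unfolding omega_components[OF rx(1) assms(2) rv rw] omega_components[OF assms] f rot_components(1) rx(2) sv sw
    by (simp add: mat2_algebra trace_linear algebra_simps add_divide_distrib)
  show "pmetric r (rot \<theta> x) (rot_deriv \<theta> x v) (pI r (rot \<theta> x) (pJ r (rot \<theta> x) (rot_deriv \<theta> x w)))
      = cos \<theta> * pmetric r x v (pI r x (pJ r x w)) - sin \<theta> * pmetric r x v (pJ r x w)"
    unfolding omega_components[OF rx(1) assms(2) rv rw] omega_components[OF assms] f rot_components(1) rx(2) sv sw
    by (simp add: mat2_algebra trace_linear x(1) mult_complex_structure_twice[OF x(1)] algebra_simps add_divide_distrib
        diff_divide_distrib)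
qed

section \<open>The pointwise Hamiltonian equation\<close>

definition rot_velocity :: "mat2 \<times> mat2 \<Rightarrow> mat2 \<times> mat2" where
  "rot_velocity x = (0, snd x ** fst x)"

lemma sdot_rot_velocity: "sdot r x (rot_velocity x) = sharp r (fst x) (snd x) ** fst x"
  by (simp add: rot_velocity_def sdot_def form0_def pairing_def mat2_algebra sharp_linear trace_0 sharp_def)

lemma rot_velocity_tangent_vectors:
  assumes "x \<in> cotangent_points r" "r > 0"
  shows "rot_velocity x \<in> tangent_vectors r x"
proof -
  note x = cotangent_points_D[OF assms]
  show ?thesis
    unfolding tangent_vectors_iff[OF x(1,2)] sdot_rot_velocity
    using TJ_mult_J[OF x(1,3)] by (simp add: rot_velocity_def TJ_def mat2_algebra)
qed

text \<open>The velocity has A = 0 and t-component s J, and (s J)(t J) has the same trace as s t.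
  The right-hand side is df(w), because f^2 = 1 + tr(s^2) / 2; compare
  \<open>ff_has_derivative\<close>.\<close>

lemma omega_rot_velocity:
  assumes "x \<in> cotangent_points r" "r > 0" "w \<in> tangent_vectors r x"
  shows "pmetric r x (rot_velocity x) (pI r x w)
    = inverse (ff r x) * trace (sharp r (fst x) (snd x) ** sdot r x w) / 2"
proof -
  note x = cotangent_points_D[OF assms(1,2)]
  have w: "sdot r x w \<in> TJ (fst x)"
    using assms(3) tangent_vectors_iff[OF x(1,2)] by auto
  show ?thesis
    unfolding omega_components[OF assms(1,2) rot_velocity_tangent_vectors[OF assms(1,2)] assms(3)] sdot_rot_velocity
      TJ_trace_J(1)[OF x(1,3) w]
    by (simp add: rot_velocity_def mat2_algebra trace_0)
qed

section \<open>Change of coordinates\<close>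

lemma matrix_inv_inverse:
  fixes D :: mat2
  assumes "det D \<noteq> 0"
  shows "D ** matrix_inv D = mat 1" "matrix_inv D ** D = mat 1"
proof -
  obtain Y where Y: "D ** Y = mat 1" using assms unfolding invertible_det_nz[symmetric] invertible_def by blast
  have "matrix_inv D = Y" by (rule matrix_inv_unique[OF Y])
  thus "D ** matrix_inv D = mat 1" "matrix_inv D ** D = mat 1"
    using Y matrix_left_right_inverse by blast+
qed

lemma matrix_inv_cancel:
  fixes D X :: mat2
  assumes "det D \<noteq> 0"
  shows "D ** (matrix_inv D ** X) = X" "matrix_inv D ** (D ** X) = X"
  by (simp_all add: matrix_mul_assoc matrix_inv_inverse[OF assms])

lemma trace_conj: "det D \<noteq> 0 \<Longrightarrow> trace (matrix_inv D ** (X ** D)) = trace X" for D X :: mat2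
  by (subst trace_mult_commute) (simp add: mat2_algebra matrix_inv_inverse)

lemma pull_pair_fst: "fst (pull_pair D x) = matrix_inv D ** (fst x ** D)"
  and pull_pair_snd: "snd (pull_pair D x) = transpose D ** (snd x ** D)"
  by (simp_all add: pull_pair_def mat2_algebra)

lemma pull_pair_eqI:
  "fst y = matrix_inv D ** (fst x ** D) \<Longrightarrow> snd y = transpose D ** (snd x ** D) \<Longrightarrow> y = pull_pair D x"
  by (simp add: prod_eq_iff pull_pair_fst pull_pair_snd)

context
  fixes D :: mat2 and x :: "mat2 \<times> mat2" and r :: real
  assumes D: "det D \<noteq> 0" and sq: "fst x ** fst x = - mat 1" and r: "r \<noteq> 0"
begin

lemma pull_pair_sq: "fst (pull_pair D x) ** fst (pull_pair D x) = - mat 1"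
  by (simp add: pull_pair_fst mat2_algebra matrix_inv_cancel[OF D] mult_complex_structure_twice[OF sq]
      matrix_inv_inverse[OF D])

lemma area_mat_matrix_inv: "det D *\<^sub>R (area_mat ** (matrix_inv D ** X)) = transpose D ** (area_mat ** X)"
  for X :: mat2
proof -
  have "det D *\<^sub>R (area_mat ** (matrix_inv D ** X)) = (transpose D ** area_mat ** D) ** (matrix_inv D ** X)"
    by (simp only: area_mat_conj scaleR_mult_left)
  thus ?thesis by (simp add: mat2_algebra matrix_inv_cancel[OF D])
qed

text \<open>The density of the area form is multiplied by det D under pullback, which is exactly the
  factor that makes the metric transform as a bilinear form.\<close>

lemma gJ_pull_pair: "gJ (det D * r) (fst (pull_pair D x)) = transpose D ** (gJ r (fst x) ** D)"
proof -
  have "gJ (det D * r) (fst (pull_pair D x)) = r *\<^sub>R (det D *\<^sub>R (area_mat ** (matrix_inv D ** (fst x ** D))))"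
    by (simp add: gJ_eq pull_pair_fst)
  thus ?thesis unfolding area_mat_matrix_inv by (simp add: gJ_eq mat2_algebra)
qed

lemma sharp_pull_pair: "sharp (det D * r) (fst (pull_pair D x)) (transpose D ** (S ** D)) = matrix_inv D ** (sharp r (fst x) S ** D)"
proof -
  have r': "det D * r \<noteq> 0" using D r by simp
  have "transpose D ** (S ** D) = transpose D ** (gJ r (fst x) ** D) ** (matrix_inv D ** (sharp r (fst x) S ** D))"
    using gJ_sharp(1)[OF sq r, of S] by (simp add: mat2_algebra matrix_inv_cancel[OF D]) (simp add: matrix_mul_assoc)
  also have "\<dots> = gJ (det D * r) (fst (pull_pair D x)) ** (matrix_inv D ** (sharp r (fst x) S ** D))"
    by (simp only: gJ_pull_pair)
  finally show ?thesis by (simp only: gJ_sharp(2)[OF pull_pair_sq r'])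
qed

lemma pairing_pull_pair:
  "pairing (det D * r) (fst (pull_pair D x)) (transpose D ** (S ** D)) (matrix_inv D ** (B ** D)) = pairing r (fst x) S B"
  using trace_conj[OF D, of "sharp r (fst x) S ** B"]
  by (simp add: pairing_sharp sharp_pull_pair mat2_algebra matrix_inv_cancel[OF D])

lemma inner_form_pull_pair:
  "inner_form (det D * r) (fst (pull_pair D x)) (transpose D ** (S ** D)) (transpose D ** (T ** D)) = inner_form r (fst x) S T"
  using trace_conj[OF D, of "sharp r (fst x) S ** sharp r (fst x) T"]
  by (simp add: inner_form_sharp sharp_pull_pair mat2_algebra matrix_inv_cancel[OF D])

lemma ff_pull_pair: "ff (det D * r) (pull_pair D x) = ff r x"
  by (simp add: ff_def pull_pair_snd inner_form_pull_pair)

lemma form0_pull_pair: "form0 (det D * r) (pull_pair D x) (pull_pair D v) = transpose D ** (form0 r x v ** D)"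
proof -
  have "fst (pull_pair D x) ** fst (pull_pair D v) = matrix_inv D ** ((fst x ** fst v) ** D)"
    by (simp add: pull_pair_fst mat2_algebra matrix_inv_cancel[OF D])
  hence "pairing (det D * r) (fst (pull_pair D x)) (snd (pull_pair D x)) (fst (pull_pair D x) ** fst (pull_pair D v))
    = pairing r (fst x) (snd x) (fst x ** fst v)"
    by (simp only: pull_pair_snd pairing_pull_pair)
  thus ?thesis
    by (simp add: form0_def gJ_pull_pair) (simp add: pull_pair_snd mat2_algebra)
qed

lemma sdot_pull_pair: "sdot (det D * r) (pull_pair D x) (pull_pair D v) = matrix_inv D ** (sdot r x v ** D)"
  by (simp add: sdot_def form0_pull_pair sharp_pull_pair)

text \<open>Apart from f, which is invariant, only traces of products of endomorphisms occur, and
  these are conjugated by D.\<close>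

lemma pmetric_pull_pair: "pmetric (det D * r) (pull_pair D x) (pull_pair D v) (pull_pair D w) = pmetric r x v w"
  using trace_conj[OF D, of "fst v ** fst w"] trace_conj[OF D, of "sdot r x v ** sdot r x w"]
  by (simp add: pmetric_sdot ff_pull_pair sdot_pull_pair pull_pair_fst mat2_algebra matrix_inv_cancel[OF D])

lemma pI_pull_pair: "pI (det D * r) (pull_pair D x) (pull_pair D v) = pull_pair D (pI r x v)"
  using pairing_pull_pair[of "snd x" "fst v"]
  by (intro pull_pair_eqI; simp add: pI_def Let_def form0_pull_pair gJ_pull_pair pull_pair_snd)
     (simp_all add: pull_pair_fst mat2_algebra matrix_inv_cancel[OF D])

lemma pJ_pull_pair: "pJ (det D * r) (pull_pair D x) (pull_pair D v) = pull_pair D (pJ r x v)"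
proof (rule pull_pair_eqI)
  show "fst (pJ (det D * r) (pull_pair D x) (pull_pair D v)) = matrix_inv D ** (fst (pJ r x v) ** D)"
    using sdot_pull_pair[of v] by (simp add: pJ_def Let_def ff_pull_pair sdot_def mat2_algebra)
  have "transpose D ** (form0 r x v ** D) ** fst (pull_pair D x) = transpose D ** (form0 r x v ** fst x ** D)"
    by (simp add: pull_pair_fst mat2_algebra matrix_inv_cancel[OF D])
  thus "snd (pJ (det D * r) (pull_pair D x) (pull_pair D v)) = transpose D ** (snd (pJ r x v) ** D)"
    by (simp add: pJ_def Let_def ff_pull_pair form0_pull_pair gJ_pull_pair pull_pair_snd inner_form_pull_pair)
       (simp add: pull_pair_fst mat2_algebra matrix_inv_cancel[OF D])
qed

end

lemma rot_pull_pair: "det D \<noteq> 0 \<Longrightarrow> rot \<theta> (pull_pair D x) = pull_pair D (rot \<theta> x)"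
  by (rule pull_pair_eqI)
     (simp_all add: rot_components pull_pair_fst pull_pair_snd mat2_algebra matrix_inv_cancel)

lemma rot_deriv_pull_pair:
  "det D \<noteq> 0 \<Longrightarrow> rot_deriv \<theta> (pull_pair D x) (pull_pair D v) = pull_pair D (rot_deriv \<theta> x v)"
  by (rule pull_pair_eqI)
     (simp_all add: rot_deriv_def pull_pair_fst pull_pair_snd mat2_algebra matrix_inv_cancel)

lemma rot_velocity_pull_pair:
  "det D \<noteq> 0 \<Longrightarrow> rot_velocity (pull_pair D x) = pull_pair D (rot_velocity x)"
  by (rule pull_pair_eqI)
     (simp_all add: rot_velocity_def pull_pair_fst pull_pair_snd mat2_algebra matrix_inv_cancel)

section \<open>Smooth functions\<close>

text \<open>\<open>frechet_derivative\<close> is a choice among all derivatives. Functions with the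
  same germ have the same derivatives, so the choice agrees even at points where neither is
  differentiable.\<close>

lemma frechet_derivative_cong_open:
  assumes "open S" "x \<in> S" "\<And>y. y \<in> S \<Longrightarrow> F y = G y"
  shows "frechet_derivative F (at x) = frechet_derivative G (at x)"
proof -
  have "(F has_derivative F') (at x) \<longleftrightarrow> (G has_derivative F') (at x)" for F'
    using has_derivative_transform_within_open[OF _ assms(1,2), of F F' UNIV G]
      has_derivative_transform_within_open[OF _ assms(1,2), of G F' UNIV F] assms(3) by auto
  thus ?thesis by (simp add: frechet_derivative_def)
qed

lemma differentiable_cong_open:
  assumes "open S" "x \<in> S" "\<And>y. y \<in> S \<Longrightarrow> F y = G y" "F differentiable at x"
  shows "G differentiable at x"
  using assms has_derivative_transform_within_open[OF _ assms(1,2), of F _ UNIV G]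
  unfolding differentiable_def by blast

lemma dpartial_cong_open:
  assumes "open S" "x \<in> S" "\<And>y. y \<in> S \<Longrightarrow> F y = G y"
  shows "dpartial b F x = dpartial b G x"
  unfolding dpartial_def using frechet_derivative_cong_open[OF assms] by simp

lemma dpartial_eqI: "(F has_derivative F') (at x) \<Longrightarrow> dpartial b F x = F' b"
  unfolding dpartial_def using frechet_derivative_at by metis

lemma smooth_on_differentiable: "smooth_on S F \<Longrightarrow> x \<in> S \<Longrightarrow> F differentiable at x"
  unfolding smooth_on_def by (auto dest!: spec[of _ "[]"])

lemma smooth_on_dpartial: "smooth_on S F \<Longrightarrow> b \<in> Basis \<Longrightarrow> smooth_on S (dpartial b F)"
  unfolding smooth_on_def
proof (intro allI impI ballI)
  fix bs :: "'a list" and x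
  assume *: "\<forall>bs. set bs \<subseteq> Basis \<longrightarrow> (\<forall>x\<in>S. foldr dpartial bs F differentiable at x)" "b \<in> Basis"
    "set bs \<subseteq> Basis" "x \<in> S"
  show "foldr dpartial bs (dpartial b F) differentiable at x"
    using *(1)[rule_format, of "bs @ [b]" x] *(2-) by simp
qed

text \<open>Smoothness as a greatest fixed point: it is enough to exhibit a class of functions that
  are differentiable on S and closed under partial derivatives. Closure is asked only up to equality
  on S, which passes to derivatives because S is open.\<close>

lemma smooth_on_coinduct:
  assumes "open S" "P F"
    and diff: "\<And>F x. P F \<Longrightarrow> x \<in> S \<Longrightarrow> F differentiable at x"
    and step: "\<And>F b. P F \<Longrightarrow> b \<in> Basis \<Longrightarrow> \<exists>G. P G \<and> (\<forall>x\<in>S. dpartial b F x = G x)"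
  shows "smooth_on S F"
  unfolding smooth_on_def
proof (intro allI impI ballI)
  fix bs :: "'a list" and x assume bs: "set bs \<subseteq> Basis" and x: "x \<in> S"
  have "\<exists>G. P G \<and> (\<forall>x\<in>S. foldr dpartial bs F x = G x)"
    using bs
  proof (induction bs)
    case Nil then show ?case using assms(2) by auto
  next
    case (Cons b bs)
    then obtain G where G: "P G" "\<forall>x\<in>S. foldr dpartial bs F x = G x" by auto
    obtain H where H: "P H" "\<forall>x\<in>S. dpartial b G x = H x" using step[OF G(1), of b] Cons.prems by auto
    have "dpartial b (foldr dpartial bs F) x = H x" if "x \<in> S" for x
      using dpartial_cong_open[OF assms(1) that, of "foldr dpartial bs F" G] G(2) H(2) that by auto
    thus ?case using H(1) by auto
  qed
  then obtain G where G: "P G" "\<forall>x\<in>S. foldr dpartial bs F x = G x" by blast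
  show "foldr dpartial bs F differentiable at x"
    by (rule differentiable_cong_open[OF assms(1) x _ diff[OF G(1) x]]) (use G(2) in auto)
qed

lemma smooth_on_const: "open S \<Longrightarrow> smooth_on S (\<lambda>x. k)"
  by (rule smooth_on_coinduct[where P = "\<lambda>F. \<exists>k. F = (\<lambda>x. k)"])
     (auto intro!: exI dpartial_eqI[where F' = "\<lambda>_. 0"] has_derivative_const)

lemma differentiable_has_derivative:
  "F differentiable at x \<Longrightarrow> (F has_derivative frechet_derivative F (at x)) (at x)"
  by (simp add: frechet_derivative_works)

lemma smooth_on_add:
  assumes "open S" "smooth_on S F" "smooth_on S G"
  shows "smooth_on S (\<lambda>x. F x + G x)"
proof (rule smooth_on_coinduct[where P = "\<lambda>H. \<exists>F G. H = (\<lambda>x. F x + G x) \<and> smooth_on S F \<and> smooth_on S G"])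
  fix H assume "\<exists>F G. H = (\<lambda>x. F x + G x) \<and> smooth_on S F \<and> smooth_on S G"
  then obtain F G where H: "H = (\<lambda>x. F x + G x)" "smooth_on S F" "smooth_on S G" by blast
  have d: "(H has_derivative (\<lambda>v. frechet_derivative F (at x) v + frechet_derivative G (at x) v)) (at x)" if "x \<in> S" for x
    unfolding H(1) by (intro has_derivative_add differentiable_has_derivative smooth_on_differentiable[OF _ that] H)
  show "H differentiable at x" if "x \<in> S" for x
    using d[OF that] by (rule differentiableI)
  show "\<exists>G. (\<exists>F G'. G = (\<lambda>x. F x + G' x) \<and> smooth_on S F \<and> smooth_on S G') \<and> (\<forall>x\<in>S. dpartial b H x = G x)"
    if "b \<in> Basis" for b
  proof (intro exI conjI ballI, rule refl)
    show "smooth_on S (dpartial b F)" "smooth_on S (dpartial b G)"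
      by (rule smooth_on_dpartial[OF H(2) that], rule smooth_on_dpartial[OF H(3) that])
    show "dpartial b H x = dpartial b F x + dpartial b G x" if "x \<in> S" for x
      by (subst dpartial_eqI[OF d[OF that]]) (simp add: dpartial_def)
  qed
qed (use assms in auto)

lemma smooth_on_bounded_linear:
  assumes "bounded_linear L" "open S" "smooth_on S F"
  shows "smooth_on S (\<lambda>x. L (F x))"
proof (rule smooth_on_coinduct[where P = "\<lambda>H. \<exists>F. H = (\<lambda>x. L (F x)) \<and> smooth_on S F"])
  fix H assume "\<exists>F. H = (\<lambda>x. L (F x)) \<and> smooth_on S F"
  then obtain F where H: "H = (\<lambda>x. L (F x))" "smooth_on S F" by blast
  have d: "(H has_derivative (\<lambda>v. L (frechet_derivative F (at x) v))) (at x)" if "x \<in> S" for x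
    unfolding H(1)
    using bounded_linear.has_derivative[OF assms(1) differentiable_has_derivative[OF smooth_on_differentiable[OF H(2) that]]] .
  show "H differentiable at x" if "x \<in> S" for x
    using d[OF that] by (rule differentiableI)
  show "\<exists>G. (\<exists>F. G = (\<lambda>x. L (F x)) \<and> smooth_on S F) \<and> (\<forall>x\<in>S. dpartial b H x = G x)" if "b \<in> Basis" for b
  proof (intro exI conjI ballI, rule refl)
    show "smooth_on S (dpartial b F)" by (rule smooth_on_dpartial[OF H(2) that])
    show "dpartial b H x = L (dpartial b F x)" if "x \<in> S" for x
      by (subst dpartial_eqI[OF d[OF that]]) (simp add: dpartial_def)
  qed
qed (use assms in auto)

text \<open>The product rule turns one term into two, so the class closed under differentiation
  consists of finite sums of values of B.\<close>

lemma smooth_on_bounded_bilinear: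
  fixes F :: "'e::euclidean_space \<Rightarrow> 'b::real_normed_vector" and G :: "'e \<Rightarrow> 'c::real_normed_vector"
    and B :: "'b \<Rightarrow> 'c \<Rightarrow> 'd::real_normed_vector"
  assumes "bounded_bilinear B" "open S" "smooth_on S F" "smooth_on S G"
  shows "smooth_on S (\<lambda>x. B (F x) (G x))"
proof (rule smooth_on_coinduct[where P = "\<lambda>H. \<exists>n F G. (\<forall>i<n::nat. smooth_on S (F i) \<and> smooth_on S (G i)) \<and> H = (\<lambda>x. \<Sum>i<n. B (F i x) (G i x))"])
  show "\<exists>n Fa Ga. (\<forall>i<n::nat. smooth_on S (Fa i) \<and> smooth_on S (Ga i)) \<and>
      (\<lambda>x. B (F x) (G x)) = (\<lambda>x. \<Sum>i<n. B (Fa i x) (Ga i x))"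
    by (rule exI[of _ 1], rule exI[of _ "\<lambda>_. F"], rule exI[of _ "\<lambda>_. G"]) (use assms in auto)
next
  fix H assume "\<exists>n F G. (\<forall>i<n::nat. smooth_on S (F i) \<and> smooth_on S (G i)) \<and> H = (\<lambda>x. \<Sum>i<n. B (F i x) (G i x))"
  then obtain n :: nat and F G where FG: "\<And>i. i < n \<Longrightarrow> smooth_on S (F i)" "\<And>i. i < n \<Longrightarrow> smooth_on S (G i)"
    and H: "H = (\<lambda>x. \<Sum>i<n. B (F i x) (G i x))" by blast
  have d: "(H has_derivative (\<lambda>v. \<Sum>i<n. B (F i x) (frechet_derivative (G i) (at x) v) + B (frechet_derivative (F i) (at x) v) (G i x))) (at x)"
    if "x \<in> S" for x
    unfolding H by (intro has_derivative_sum bounded_bilinear.FDERIV[OF assms(1)] differentiable_has_derivative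
        smooth_on_differentiable[OF _ that] FG) auto
  show "H differentiable at x" if "x \<in> S" for x
    using d[OF that] by (rule differentiableI)
  fix b :: 'e assume b: "b \<in> Basis"
  \<comment> \<open>The first n indices carry the terms with the derivative on G, the next n those
    with the derivative on F.\<close>
  define F' where "F' i = (if i < n then F i else dpartial b (F (i - n)))" for i
  define G' where "G' i = (if i < n then dpartial b (G i) else G (i - n))" for i
  have "dpartial b H x = (\<Sum>i<n + n. B (F' i x) (G' i x))" if "x \<in> S" for x
  proof -
    have split: "(\<Sum>i<n + m. f i) = (\<Sum>i<n. f i) + (\<Sum>i<m. f (n + i))" for m and f :: "nat \<Rightarrow> 'd"
      by (induction m) (simp_all add: add.assoc)
    have "(\<Sum>i<n + n. B (F' i x) (G' i x)) = (\<Sum>i<n. B (F' i x) (G' i x)) + (\<Sum>i<n. B (F' (n + i) x) (G' (n + i) x))"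
      by (rule split)
    thus ?thesis
      unfolding dpartial_eqI[OF d[OF that]] by (simp add: F'_def G'_def sum.distrib dpartial_def)
  qed
  moreover have "\<forall>i<n + n. smooth_on S (F' i) \<and> smooth_on S (G' i)"
    by (auto simp: F'_def G'_def intro!: FG smooth_on_dpartial[OF _ b])
  ultimately show "\<exists>G. (\<exists>n F G'. (\<forall>i<n::nat. smooth_on S (F i) \<and> smooth_on S (G' i)) \<and> G = (\<lambda>x. \<Sum>i<n. B (F i x) (G' i x)))
      \<and> (\<forall>x\<in>S. dpartial b H x = G x)"
    by blast
qed (rule assms(2))

lemma smooth_on_Pair:
  assumes "open S" "smooth_on S F" "smooth_on S G"
  shows "smooth_on S (\<lambda>x. (F x, G x))"
proof -
  have "smooth_on S (\<lambda>x. (F x, 0) + (0, G x))"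
    by (intro smooth_on_add smooth_on_bounded_linear[of "\<lambda>y. (y, 0)"] smooth_on_bounded_linear[of "\<lambda>y. (0, y)"] assms
        bounded_linear_Pair bounded_linear_ident bounded_linear_zero)
  thus ?thesis by simp
qed

lemma smooth_on_compose_snd:
  fixes F :: "'e::euclidean_space \<Rightarrow> 'b::real_normed_vector"
  assumes "open S" "smooth_on S F"
  shows "smooth_on ((UNIV :: 'f::euclidean_space set) \<times> S) (\<lambda>z. F (snd z))"
proof (rule smooth_on_coinduct[where P = "\<lambda>H. \<exists>F. H = (\<lambda>z. F (snd z)) \<and> smooth_on S F"])
  fix H :: "'f \<times> 'e \<Rightarrow> 'b" assume "\<exists>F. H = (\<lambda>z. F (snd z)) \<and> smooth_on S F"
  then obtain F where H: "H = (\<lambda>z. F (snd z))" "smooth_on S F" by blast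
  have d: "(H has_derivative (\<lambda>v. frechet_derivative F (at (snd z)) (snd v))) (at z)" if "z \<in> UNIV \<times> S" for z
    unfolding H(1)
    using has_derivative_compose[OF has_derivative_snd[OF has_derivative_ident]
        differentiable_has_derivative[OF smooth_on_differentiable[OF H(2)]]] that by auto
  show "H differentiable at z" if "z \<in> UNIV \<times> S" for z
    using d[OF that] by (rule differentiableI)
  fix b :: "'f \<times> 'e" assume "b \<in> Basis"
  then consider "snd b = 0" | "snd b \<in> Basis" by (auto simp: Basis_prod_def)
  thus "\<exists>G. (\<exists>F. G = (\<lambda>z. F (snd z)) \<and> smooth_on S F) \<and> (\<forall>z\<in>UNIV \<times> S. dpartial b H z = G z)"
  proof cases
    case 1
    have "dpartial b H z = 0" if "z \<in> UNIV \<times> S" for z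
      using dpartial_eqI[OF d[OF that], of b] 1 that
        linear_0[OF has_derivative_linear[OF differentiable_has_derivative[OF smooth_on_differentiable[OF H(2)]]]]
      by auto
    thus ?thesis using smooth_on_const[OF assms(1), of "0 :: 'b"] by (intro exI[of _ "\<lambda>_. 0"]) auto
  next
    case 2
    have "dpartial b H z = dpartial (snd b) F (snd z)" if "z \<in> UNIV \<times> S" for z
      using dpartial_eqI[OF d[OF that], of b] by (simp add: dpartial_def)
    thus ?thesis using smooth_on_dpartial[OF H(2) 2] by blast
  qed
qed (use assms in \<open>auto simp: open_Times\<close>)

text \<open>The span of cos and sin is closed under differentiation, so it serves as the invariant
  class.\<close>

lemma smooth_on_compose_fst_cos_sin:
  "smooth_on (UNIV \<times> S) (\<lambda>z :: real \<times> 'e::euclidean_space. a * cos (fst z) + b * sin (fst z))" if "open S"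
proof (rule smooth_on_coinduct[where P = "\<lambda>H. \<exists>a b. H = (\<lambda>z. a * cos (fst z) + b * sin (fst z))"])
  fix H :: "real \<times> 'e \<Rightarrow> real" assume "\<exists>a b. H = (\<lambda>z. a * cos (fst z) + b * sin (fst z))"
  then obtain a b where H: "H = (\<lambda>z. a * cos (fst z) + b * sin (fst z))" by blast
  have d: "(H has_derivative (\<lambda>v. fst v * (b * cos (fst z) - a * sin (fst z)))) (at z)" for z
    unfolding H by (auto intro!: derivative_eq_intros simp: algebra_simps)
  show "H differentiable at z" for z
    using d by (rule differentiableI)
  fix k :: "real \<times> 'e"
  have "dpartial k H z = (fst k * b) * cos (fst z) + (- (fst k * a)) * sin (fst z)" for z
    by (subst dpartial_eqI[OF d]) (simp add: algebra_simps)
  thus "\<exists>G. (\<exists>a b. G = (\<lambda>z. a * cos (fst z) + b * sin (fst z))) \<and> (\<forall>z\<in>UNIV \<times> S. dpartial k H z = G z)"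
    by blast
qed (use that in \<open>auto simp: open_Times\<close>)

section \<open>Continuously differentiable functions\<close>

text \<open>Continuity of the derivative is required for each fixed direction v; in finite dimension
  this amounts to continuity of the derivative as a linear map.\<close>

definition C1_on :: "'e::euclidean_space set \<Rightarrow> ('e \<Rightarrow> 'b::real_normed_vector) \<Rightarrow> bool" where
  "C1_on S F \<longleftrightarrow> (\<forall>x\<in>S. F differentiable at x) \<and> (\<forall>v. continuous_on S (\<lambda>x. frechet_derivative F (at x) v))"

lemma C1_on_I:
  assumes "\<And>x. x \<in> S \<Longrightarrow> (F has_derivative F' x) (at x)" "\<And>v. continuous_on S (\<lambda>x. F' x v)"
  shows "C1_on S F"
proof -
  have "frechet_derivative F (at x) v = F' x v" if "x \<in> S" for x v
    using frechet_derivative_at[OF assms(1)[OF that]] by simp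
  thus ?thesis using assms unfolding C1_on_def by (auto intro: differentiableI cong: continuous_on_cong)
qed

lemma C1_on_D:
  assumes "C1_on S F"
  shows "x \<in> S \<Longrightarrow> (F has_derivative frechet_derivative F (at x)) (at x)"
    "continuous_on S (\<lambda>x. frechet_derivative F (at x) v)" "continuous_on S F"
  using assms unfolding C1_on_def
  by (auto intro!: differentiable_has_derivative continuous_at_imp_continuous_on differentiable_imp_continuous_within)

lemma C1_on_cong:
  assumes "open S" "\<And>y. y \<in> S \<Longrightarrow> F y = G y" "C1_on S F"
  shows "C1_on S G"
proof (rule C1_on_I)
  show "(G has_derivative frechet_derivative F (at x)) (at x)" if "x \<in> S" for x
    using has_derivative_transform_within_open[OF C1_on_D(1)[OF assms(3) that] assms(1) that] assms(2) by blast
qed (rule C1_on_D[OF assms(3)])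

lemma C1_on_smooth:
  fixes F :: "'e::euclidean_space \<Rightarrow> 'b::real_normed_vector"
  assumes "smooth_on S F"
  shows "C1_on S F"
proof (rule C1_on_I)
  show d: "(F has_derivative frechet_derivative F (at x)) (at x)" if "x \<in> S" for x
    using smooth_on_differentiable[OF assms that] by (rule differentiable_has_derivative)
  have c: "continuous_on S (dpartial b F)" if "b \<in> Basis" for b
    using smooth_on_differentiable[OF smooth_on_dpartial[OF assms that]]
    by (auto intro!: continuous_at_imp_continuous_on differentiable_imp_continuous_within)
  show "continuous_on S (\<lambda>x. frechet_derivative F (at x) v)" for v
  proof -
    have "frechet_derivative F (at x) v = (\<Sum>b\<in>Basis. (v \<bullet> b) *\<^sub>R dpartial b F x)" if "x \<in> S" for x
      using linear_sum[OF has_derivative_linear[OF d[OF that]], of "\<lambda>b. (v \<bullet> b) *\<^sub>R b" Basis]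
      by (simp add: euclidean_representation linear_cmul[OF has_derivative_linear[OF d[OF that]]] dpartial_def)
    moreover have "continuous_on S (\<lambda>x. \<Sum>b\<in>Basis. (v \<bullet> b) *\<^sub>R dpartial b F x)"
      by (intro continuous_intros c)
    ultimately show ?thesis by (simp cong: continuous_on_cong)
  qed
qed

lemma C1_on_const: "C1_on S (\<lambda>x. k)"
  by (rule C1_on_I[where F' = "\<lambda>_ _. 0"]) auto

lemma C1_on_add: "C1_on S F \<Longrightarrow> C1_on S G \<Longrightarrow> C1_on S (\<lambda>x. F x + G x)"
  by (rule C1_on_I, rule has_derivative_add) (auto dest: C1_on_D intro!: continuous_intros)

lemma C1_on_sum: "(\<And>i. i \<in> I \<Longrightarrow> C1_on S (F i)) \<Longrightarrow> C1_on S (\<lambda>x. \<Sum>i\<in>I. F i x)"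
  by (rule C1_on_I, rule has_derivative_sum) (auto dest: C1_on_D intro!: continuous_intros)

lemma C1_on_bounded_linear:
  assumes "bounded_linear L" "C1_on S F"
  shows "C1_on S (\<lambda>x. L (F x))"
proof (rule C1_on_I)
  show "((\<lambda>x. L (F x)) has_derivative (\<lambda>v. L (frechet_derivative F (at x) v))) (at x)" if "x \<in> S" for x
    by (rule bounded_linear.has_derivative[OF assms(1) C1_on_D(1)[OF assms(2) that]])
  show "continuous_on S (\<lambda>x. L (frechet_derivative F (at x) v))" for v
    by (rule bounded_linear.continuous_on[OF assms(1) C1_on_D(2)[OF assms(2)]])
qed

lemma C1_on_bounded_bilinear:
  assumes "bounded_bilinear B" "C1_on S F" "C1_on S G"
  shows "C1_on S (\<lambda>x. B (F x) (G x))"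
proof (rule C1_on_I)
  show "((\<lambda>x. B (F x) (G x)) has_derivative (\<lambda>v. B (F x) (frechet_derivative G (at x) v)
      + B (frechet_derivative F (at x) v) (G x))) (at x)" if "x \<in> S" for x
    by (intro bounded_bilinear.FDERIV[OF assms(1)] C1_on_D(1)[OF _ that] assms)
  show "continuous_on S (\<lambda>x. B (F x) (frechet_derivative G (at x) v) + B (frechet_derivative F (at x) v) (G x))" for v
    by (intro continuous_on_add bounded_bilinear.continuous_on[OF assms(1)] C1_on_D assms)
qed

lemma C1_on_compose_real:
  assumes "C1_on S F" "\<And>x. x \<in> S \<Longrightarrow> F x \<in> T" "\<And>y. y \<in> T \<Longrightarrow> (h has_real_derivative h' y) (at y)" "continuous_on T h'"
  shows "C1_on S (\<lambda>x. h (F x))"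
proof (rule C1_on_I)
  show "((\<lambda>x. h (F x)) has_derivative (\<lambda>v. h' (F x) * frechet_derivative F (at x) v)) (at x)" if "x \<in> S" for x
    using has_derivative_compose[OF C1_on_D(1)[OF assms(1) that], of h "(*) (h' (F x))"]
      assms(3)[OF assms(2)[OF that]] by (simp add: has_field_derivative_def)
  show "continuous_on S (\<lambda>x. h' (F x) * frechet_derivative F (at x) v)" for v
    by (intro continuous_intros C1_on_D(2)[OF assms(1)] continuous_on_compose2[OF assms(4) C1_on_D(3)[OF assms(1)]])
       (use assms(2) in auto)
qed

lemma C1_on_compose:
  fixes G :: "'f::euclidean_space \<Rightarrow> 'b::real_normed_vector"
  assumes "C1_on S F" "\<And>x. x \<in> S \<Longrightarrow> F x \<in> T" "C1_on T G"
  shows "C1_on S (\<lambda>x. G (F x))"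
proof (rule C1_on_I)
  show *: "((\<lambda>x. G (F x)) has_derivative (\<lambda>v. frechet_derivative G (at (F x)) (frechet_derivative F (at x) v))) (at x)" if "x \<in> S" for x
    using has_derivative_compose[OF C1_on_D(1)[OF assms(1) that] C1_on_D(1)[OF assms(3) assms(2)[OF that]]] .
  show "continuous_on S (\<lambda>x. frechet_derivative G (at (F x)) (frechet_derivative F (at x) v))" for v
  proof -
    \<comment> \<open>The inner derivative moves with x, while continuity of the outer one is known
      for fixed directions only; expanding in a basis separates the two dependences.\<close>
    have "frechet_derivative G (at (F x)) w = (\<Sum>b\<in>Basis. (w \<bullet> b) *\<^sub>R frechet_derivative G (at (F x)) b)" if "x \<in> S" for x w
    proof -
      note l = has_derivative_linear[OF C1_on_D(1)[OF assms(3) assms(2)[OF that]]]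
      show ?thesis using linear_sum[OF l, of "\<lambda>b. (w \<bullet> b) *\<^sub>R b" Basis]
        by (simp add: euclidean_representation linear_cmul[OF l])
    qed
    moreover have "continuous_on S (\<lambda>x. \<Sum>b\<in>Basis. (frechet_derivative F (at x) v \<bullet> b) *\<^sub>R frechet_derivative G (at (F x)) b)"
      by (intro continuous_intros C1_on_D(2)[OF assms(1)]
          continuous_on_compose2[OF C1_on_D(2)[OF assms(3)] C1_on_D(3)[OF assms(1)]]) (use assms(2) in auto)
    ultimately show ?thesis by (simp cong: continuous_on_cong)
  qed
qed

lemma C1_on_inverse:
  assumes "C1_on S F" "\<And>x. x \<in> S \<Longrightarrow> F x \<noteq> 0"
  shows "C1_on S (\<lambda>x. inverse (F x :: real))"
proof (rule C1_on_compose_real[OF assms(1), where T = "- {0}"])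
  show "(inverse has_real_derivative - (inverse y * inverse y)) (at y)" if "y \<in> - {0}" for y :: real
    using DERIV_inverse[of y UNIV] that by (simp add: power2_eq_square)
  show "continuous_on (- {0}) (\<lambda>y::real. - (inverse y * inverse y))"
    by (intro continuous_intros) auto
qed (use assms(2) in auto)

lemma C1_on_sqrt:
  assumes "C1_on S F" "\<And>x. x \<in> S \<Longrightarrow> F x > 0"
  shows "C1_on S (\<lambda>x. sqrt (F x))"
proof (rule C1_on_compose_real[OF assms(1), where T = "{0<..}"])
  show "(sqrt has_real_derivative inverse (sqrt y) / 2) (at y)" if "y \<in> {0<..}" for y
    using DERIV_real_sqrt[of y] that by simp
  show "continuous_on {0<..} (\<lambda>y. inverse (sqrt y) / 2)"
    by (intro continuous_intros) auto
qed (use assms(2) in auto)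

section \<open>The Levi-Civita connection of a conformal metric\<close>

lemma pd_eqI: "(F has_derivative F') (at y) \<Longrightarrow> pd i F y = F' (axis i 1)"
  unfolding pd_def by (rule dpartial_eqI)

lemma pd_has_derivative:
  fixes F :: "real^2 \<Rightarrow> 'b::real_normed_vector"
  assumes "F differentiable at y"
  shows "(F has_derivative (\<lambda>v. \<Sum>i\<in>UNIV. v$i *\<^sub>R pd i F y)) (at y)"
proof -
  note d = differentiable_has_derivative[OF assms]
  have "frechet_derivative F (at y) v = (\<Sum>i\<in>UNIV. v$i *\<^sub>R pd i F y)" for v
  proof -
    have "v = (\<Sum>i\<in>UNIV. v$i *\<^sub>R axis i 1)" by (simp add: vec_eq_iff axis_def if_distrib cong: if_cong)
    hence "frechet_derivative F (at y) v = frechet_derivative F (at y) (\<Sum>i\<in>UNIV. v$i *\<^sub>R axis i 1)" by simp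
    also have "\<dots> = (\<Sum>i\<in>UNIV. v$i *\<^sub>R frechet_derivative F (at y) (axis i 1))"
      by (simp add: linear_sum[OF has_derivative_linear[OF d]] linear_cmul[OF has_derivative_linear[OF d]])
    finally show ?thesis by (simp add: pd_def dpartial_def)
  qed
  thus ?thesis using d by (metis (no_types, lifting) ext)
qed

lemma pd_cong_open:
  assumes "open W" "y \<in> W" "\<And>z. z \<in> W \<Longrightarrow> F z = G z"
  shows "pd i F y = pd i G y"
  unfolding pd_def by (rule dpartial_cong_open[OF assms])

lemma pd_const: "pd i (\<lambda>z. k) y = 0"
  by (rule pd_eqI[OF has_derivative_const])

lemma pd_add: "F differentiable at y \<Longrightarrow> G differentiable at y \<Longrightarrow> pd i (\<lambda>z. F z + G z) y = pd i F y + pd i G y"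
  using pd_eqI[OF has_derivative_add[OF differentiable_has_derivative differentiable_has_derivative], of F y G i]
  by (simp add: pd_def dpartial_def)

lemma pd_bounded_linear:
  assumes "bounded_linear L" "F differentiable at y"
  shows "pd i (\<lambda>z. L (F z)) y = L (pd i F y)"
  using pd_eqI[OF bounded_linear.has_derivative[OF assms(1) differentiable_has_derivative[OF assms(2)]], of i]
  by (simp add: pd_def dpartial_def)

lemma pd_bounded_bilinear:
  assumes "bounded_bilinear B" "F differentiable at y" "G differentiable at y"
  shows "pd i (\<lambda>z. B (F z) (G z)) y = B (F y) (pd i G y) + B (pd i F y) (G y)"
  using pd_eqI[OF bounded_bilinear.FDERIV[OF assms(1) differentiable_has_derivative[OF assms(2)]
        differentiable_has_derivative[OF assms(3)]], of i]
  by (simp add: pd_def dpartial_def)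

lemma differentiable_bounded_linear:
  "bounded_linear L \<Longrightarrow> F differentiable at y \<Longrightarrow> (\<lambda>z. L (F z)) differentiable at y"
  using bounded_linear.has_derivative unfolding differentiable_def by blast

lemma differentiable_bounded_bilinear:
  "bounded_bilinear B \<Longrightarrow> F differentiable at y \<Longrightarrow> G differentiable at y \<Longrightarrow> (\<lambda>z. B (F z) (G z)) differentiable at y"
  using bounded_bilinear.FDERIV unfolding differentiable_def by blast

lemmas pd_matrix_mult = pd_bounded_bilinear[OF bounded_bilinear_matrix_mult]
lemmas pd_scaleR = pd_bounded_bilinear[OF bounded_bilinear_scaleR]
lemmas differentiable_matrix_mult = differentiable_bounded_bilinear[OF bounded_bilinear_matrix_mult]

lemma bounded_linear_transpose: "bounded_linear (transpose :: mat2 \<Rightarrow> mat2)"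
  by (rule linear_conv_bounded_linear[THEN iffD1]) (simp add: linear_iff transpose_add transpose_scaleR)

lemma bounded_linear_mult_left: "bounded_linear (\<lambda>X :: mat2. C ** X)" for C :: mat2
  by (rule linear_conv_bounded_linear[THEN iffD1]) (simp add: linear_iff mult_add_right scaleR_mult_right)

lemma bounded_linear_trace: "bounded_linear (trace :: mat2 \<Rightarrow> real)"
  by (rule linear_conv_bounded_linear[THEN iffD1]) (simp add: linear_iff trace_linear)

lemma two_cases: "(i::2) = 1 \<or> i = 2"
  using exhaust_2 .

text \<open>The matrix E i below is the Christoffel symbol with its upper index lowered. In the sum
  of E i and its transpose two of the three partial derivatives cancel and the derivative of the
  metric remains.\<close>

lemma christoffel_metric:
  assumes "open W" "y \<in> W" "\<And>z. z \<in> W \<Longrightarrow> transpose (G z) = G z" "G differentiable at y" "det (G y) \<noteq> 0"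
  shows "christoffel G y i $ k $ j = christoffel G y j $ k $ i"
    "pd i G y = transpose (christoffel G y i) ** G y + G y ** christoffel G y i"
proof -
  have "pd l (\<lambda>z. transpose (G z)) y = pd l G y" for l
    by (rule pd_cong_open[OF assms(1,2)]) (rule assms(3))
  hence "transpose (pd l G y) = pd l G y" for l
    by (simp add: pd_bounded_linear[OF bounded_linear_transpose assms(4)])
  hence sym: "pd l G y $ a $ b = pd l G y $ b $ a" for l a b
    by (metis (no_types, lifting) transpose_def vec_lambda_beta)
  show "christoffel G y i $ k $ j = christoffel G y j $ k $ i"
    by (simp add: christoffel_def sym[of _ i j] algebra_simps)
  define E where "E i = (\<chi> l j. (pd i G y $ j $ l + pd j G y $ i $ l - pd l G y $ i $ j) / 2)" for i
  have "christoffel G y i = matrix_inv (G y) ** E i" for i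
    by (simp add: christoffel_def E_def vec_eq_iff matrix_matrix_mult_def sum_divide_distrib)
  hence GE: "G y ** christoffel G y i = E i" for i
    by (simp add: matrix_mul_assoc matrix_inv_inverse[OF assms(5)])
  have "transpose (christoffel G y i) ** G y = transpose (G y ** christoffel G y i)"
    by (simp add: matrix_transpose_mul assms(2,3))
  thus "pd i G y = transpose (christoffel G y i) ** G y + G y ** christoffel G y i"
    by (simp add: GE vec_eq_iff transpose_def E_def) (simp add: sym[of i] sym field_simps)
qed

text \<open>The derivative at the identity of the statement that pullback multiplies the area form
  by the determinant.\<close>

lemma transpose_area_mat_trace: "transpose X ** area_mat = trace X *\<^sub>R area_mat - area_mat ** X"
  by (simp add: mat2_simps)

lemma area_mat_cancel: "area_mat ** X = area_mat ** Y \<longleftrightarrow> X = Y" for X Y :: mat2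
  by (auto simp: mat2_eq_iff mat2_mult)

text \<open>For a metric \<kappa> times \<open>area_mat ** J\<close>, compatibility of the
  connection mixes the derivatives of \<kappa> and J; the constraint J^2 = -1 separates them and
  shows that both J and the area form are parallel. It is applied to g with \<kappa> = r and to h
  with \<kappa> = (1 + f) r.\<close>

lemma christoffel_conformal:
  fixes J :: "real^2 \<Rightarrow> mat2" and \<kappa> :: "real^2 \<Rightarrow> real"
  assumes W: "open W" "y \<in> W"
    and G: "\<And>z. z \<in> W \<Longrightarrow> G z = \<kappa> z *\<^sub>R (area_mat ** J z)" and sq: "\<And>z. z \<in> W \<Longrightarrow> J z ** J z = - mat 1"
    and d: "J differentiable at y" "\<kappa> differentiable at y" and nz: "\<kappa> y \<noteq> 0"
  defines "\<Gamma> \<equiv> christoffel G y"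
  shows "\<Gamma> i $ k $ j = \<Gamma> j $ k $ i"
    "pd i J y = J y ** \<Gamma> i - \<Gamma> i ** J y"
    "pd i \<kappa> y = \<kappa> y * trace (\<Gamma> i)"
    "pd i G y = transpose (\<Gamma> i) ** G y + G y ** \<Gamma> i"
    "G differentiable at y"
proof -
  have d2: "(\<lambda>z. \<kappa> z *\<^sub>R (area_mat ** J z)) differentiable at y"
    by (intro differentiable_bounded_bilinear[OF bounded_bilinear_scaleR] differentiable_bounded_linear[OF bounded_linear_mult_left] d)
  show dG: "G differentiable at y"
    by (rule differentiable_cong_open[OF W _ d2]) (simp add: G)
  have Gg: "G z = gJ (\<kappa> z) (J z)" if "z \<in> W" for z using G[OF that] by (simp add: gJ_eq)
  have symG: "transpose (G z) = G z" if "z \<in> W" for z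
    unfolding Gg[OF that] by (rule transpose_gJ[OF sq[OF that]])
  have det: "det (G y) \<noteq> 0" unfolding Gg[OF W(2)] det_gJ[OF sq[OF W(2)]] using nz by simp
  note cm = christoffel_metric[OF W symG dG det, folded \<Gamma>_def]
  show "\<Gamma> i $ k $ j = \<Gamma> j $ k $ i" by (rule cm)
  show dGi: "pd i G y = transpose (\<Gamma> i) ** G y + G y ** \<Gamma> i" by (rule cm)
  have "pd i (\<lambda>z. J z ** J z) y = pd i (\<lambda>z. - mat 1) y"
    by (rule pd_cong_open[OF W]) (rule sq)
  hence JdJ: "J y ** pd i J y + pd i J y ** J y = 0"
    by (simp add: pd_matrix_mult[OF d(1) d(1)] pd_const)
  have "pd i G y = pd i (\<lambda>z. \<kappa> z *\<^sub>R (area_mat ** J z)) y"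
    by (rule pd_cong_open[OF W]) (rule G)
  also have "\<dots> = \<kappa> y *\<^sub>R (area_mat ** pd i J y) + pd i \<kappa> y *\<^sub>R (area_mat ** J y)"
    by (simp add: pd_scaleR[OF d(2) differentiable_bounded_linear[OF bounded_linear_mult_left d(1)]]
        pd_bounded_linear[OF bounded_linear_mult_left d(1)])
  finally have "area_mat ** (\<kappa> y *\<^sub>R pd i J y)
      = area_mat ** ((\<kappa> y * trace (\<Gamma> i) - pd i \<kappa> y) *\<^sub>R J y + \<kappa> y *\<^sub>R (J y ** \<Gamma> i - \<Gamma> i ** J y))"
    unfolding dGi G[OF W(2)]
    by (simp add: scaleR_mult_right scaleR_mult_left matrix_mul_assoc transpose_area_mat_trace)
       (simp add: mat2_algebra algebra_simps)
  hence *: "\<kappa> y *\<^sub>R pd i J y = (\<kappa> y * trace (\<Gamma> i) - pd i \<kappa> y) *\<^sub>R J y + \<kappa> y *\<^sub>R (J y ** \<Gamma> i - \<Gamma> i ** J y)"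
    by (simp only: area_mat_cancel)
  \<comment> \<open>Take the anticommutator with J: the commutator of J and \<Gamma> contributes
    nothing, the multiple of J contributes -2 times its coefficient, and the left side vanishes by
    differentiating J^2 = -1.\<close>
  have "\<kappa> y *\<^sub>R (J y ** pd i J y + pd i J y ** J y) = J y ** (\<kappa> y *\<^sub>R pd i J y) + (\<kappa> y *\<^sub>R pd i J y) ** J y"
    by (simp add: mat2_algebra algebra_simps)
  also have "\<dots> = - (2 * (\<kappa> y * trace (\<Gamma> i) - pd i \<kappa> y)) *\<^sub>R mat 1"
    unfolding * by (simp add: mat2_algebra sq[OF W(2)] mult_complex_structure_twice[OF sq[OF W(2)]])
      (simp add: mat2_eq_iff mat_def algebra_simps)
  finally have "(2 * (\<kappa> y * trace (\<Gamma> i) - pd i \<kappa> y)) *\<^sub>R (mat 1 :: mat2) = 0"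
    unfolding JdJ by auto
  hence "((2 * (\<kappa> y * trace (\<Gamma> i) - pd i \<kappa> y)) *\<^sub>R (mat 1 :: mat2)) $ 1 $ 1 = 0" by (simp only: zero_index)
  hence e: "\<kappa> y * trace (\<Gamma> i) - pd i \<kappa> y = 0"
    by (simp add: mat_def)
  thus "pd i \<kappa> y = \<kappa> y * trace (\<Gamma> i)" by simp
  show "pd i J y = J y ** \<Gamma> i - \<Gamma> i ** J y" using * nz unfolding e by simp
qed

text \<open>Covariant derivative of an endomorphism field along a coordinate direction. The
  connection enters only through its matrices at the point, so the calculus rules serve the
  connections of g and h alike.\<close>

definition nab :: "(2 \<Rightarrow> mat2) \<Rightarrow> 2 \<Rightarrow> (real^2 \<Rightarrow> mat2) \<Rightarrow> real^2 \<Rightarrow> mat2" where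
  "nab \<Gamma> i E y = pd i E y + \<Gamma> i ** E y - E y ** \<Gamma> i"

lemma nabla_end_nab: "nabla_end G E y X = (\<Sum>i\<in>UNIV. X $ i *\<^sub>R nab (christoffel G y) i E y)"
  by (simp add: nabla_end_def nab_def)

lemma divergence_nab: "divergence G E y X = (\<Sum>i\<in>UNIV. (nab (christoffel G y) i E y *v X) $ i)"
proof -
  have "nabla_end G E y (axis i 1) = nab (christoffel G y) i E y" for i :: 2
    using two_cases[of i] by (auto simp: nabla_end_nab sum_2 axis_def)
  thus ?thesis by (simp add: divergence_def)
qed

lemma nab_mult:
  assumes "E differentiable at y" "F differentiable at y"
  shows "nab \<Gamma> i (\<lambda>z. E z ** F z) y = nab \<Gamma> i E y ** F y + E y ** nab \<Gamma> i F y"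
  by (simp add: nab_def pd_matrix_mult[OF assms] mat2_algebra)

lemma nab_scaleR:
  assumes "k differentiable at y" "E differentiable at y"
  shows "nab \<Gamma> i (\<lambda>z. k z *\<^sub>R E z) y = pd i k y *\<^sub>R E y + k y *\<^sub>R nab \<Gamma> i E y"
  by (simp add: nab_def pd_scaleR[OF assms] mat2_algebra algebra_simps)

lemma nab_add:
  assumes "E differentiable at y" "F differentiable at y"
  shows "nab \<Gamma> i (\<lambda>z. E z + F z) y = nab \<Gamma> i E y + nab \<Gamma> i F y"
  by (simp add: nab_def pd_add[OF assms] mat2_algebra)

lemma nab_cong_open:
  assumes "open W" "y \<in> W" "\<And>z. z \<in> W \<Longrightarrow> E z = F z"
  shows "nab \<Gamma> i E y = nab \<Gamma> i F y"
  using pd_cong_open[OF assms] assms(2,3) by (simp add: nab_def)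

text \<open>The commutator with \<Gamma> has no trace, so the derivative of a trace may be computed
  with any connection.\<close>

lemma pd_trace: "E differentiable at y \<Longrightarrow> pd i (\<lambda>z. trace (E z)) y = trace (nab \<Gamma> i E y)"
  by (simp add: pd_bounded_linear[OF bounded_linear_trace] nab_def trace_linear trace_mult_commute[of "\<Gamma> i"])

text \<open>Lowering an index with a parallel metric commutes with covariant
  differentiation.\<close>

lemma nabla_form_nabla_end:
  assumes "open W" "y \<in> W" "\<And>z. z \<in> W \<Longrightarrow> S z = G z ** E z"
    and "\<And>i. pd i G y = transpose (christoffel G y i) ** G y + G y ** christoffel G y i"
    and "G differentiable at y" "E differentiable at y"
  shows "nabla_form G S y X = G y ** nabla_end G E y X"
proof -
  have "pd i S y - transpose (christoffel G y i) ** S y - S y ** christoffel G y i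
    = G y ** nab (christoffel G y) i E y" for i
  proof -
    have "pd i S y = pd i (\<lambda>z. G z ** E z) y" by (rule pd_cong_open[OF assms(1,2)]) (rule assms(3))
    thus ?thesis
      by (simp add: pd_matrix_mult[OF assms(5,6)] assms(4) assms(3)[OF assms(2)] nab_def mat2_algebra)
  qed
  thus ?thesis by (simp add: nabla_form_def nabla_end_nab sum_2 mat2_algebra)
qed

section \<open>Codazzi tensors in dimension two\<close>

definition along :: "(2 \<Rightarrow> mat2) \<Rightarrow> real^2 \<Rightarrow> mat2" where
  "along N X = (\<Sum>i\<in>UNIV. X $ i *\<^sub>R N i)"

lemma along_axis: "along N (axis i 1) = N i"
  using two_cases[of i] by (auto simp: along_def sum_2 axis_def)

lemma along_comps: "along N X $ a $ b = X $ 1 * N 1 $ a $ b + X $ 2 * N 2 $ a $ b"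
  by (simp add: along_def sum_2)

lemma mv_comps: "(C *v X) $ i = C$i$1 * X$1 + C$i$2 * X$2" for C :: mat2
  by (simp add: matrix_vector_mult_def sum_2)

lemma codazzi_iff: "(\<forall>X Y. along N X *v Y = along N Y *v X) \<longleftrightarrow> (\<forall>k. N 1 $ k $ 2 = N 2 $ k $ 1)"
proof
  assume "\<forall>X Y. along N X *v Y = along N Y *v X"
  hence "(along N (axis 1 1) *v axis 2 1) $ k = (along N (axis 2 1) *v axis 1 1) $ k" for k by simp
  thus "\<forall>k. N 1 $ k $ 2 = N 2 $ k $ 1" unfolding along_axis by (simp add: mv_comps axis_def)
next
  assume "\<forall>k. N 1 $ k $ 2 = N 2 $ k $ 1"
  thus "\<forall>X Y. along N X *v Y = along N Y *v X"
    by (simp add: vec_eq_iff mv_comps along_comps algebra_simps)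
qed

lemma along_TJ:
  assumes "\<And>i. N i \<in> TJ J"
  shows "along N X \<in> TJ J"
  unfolding along_def by (simp add: sum_2 TJ_add TJ_scaleR assms)

text \<open>This is the holomorphicity of the quadratic differential with real part \<open>\<sigma>\<close>.\<close>

lemma codazzi_holomorphic:
  assumes sq: "J ** J = - mat 1" and N: "\<And>i. N i \<in> TJ J" and cod: "\<And>X Y. along N X *v Y = along N Y *v X"
  shows "along N (J *v X) = along N X ** J"
proof -
  have "along N (J *v X) *v Y = (along N X ** J) *v Y" for Y
  proof -
    have "along N (J *v X) *v Y = (along N Y ** J) *v X" by (simp add: cod[of "J *v X"] matrix_vector_mul_assoc)
    also have "along N Y ** J = - (J ** along N Y)" using TJ_D[OF along_TJ[OF N]] by simp
    also have "\<dots> *v X = - (J *v (along N Y *v X))"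
      by (simp add: vec_eq_iff mv_comps mat2_mult algebra_simps)
    also have "\<dots> = - (J ** along N X) *v Y"
      by (subst cod[of Y]) (simp add: vec_eq_iff mv_comps mat2_mult algebra_simps)
    also have "- (J ** along N X) = along N X ** J" using TJ_D[OF along_TJ[OF N]] by simp
    finally show ?thesis .
  qed
  thus ?thesis by (simp add: matrix_eq)
qed

text \<open>Notation: J has entries a, b, c, -a; the element s has p, q, q', -p; the two derivatives
  N have k, l, l', -k and i, j, j', -i; the vector is (x, y). The constraints determine c, q', l',
  j', and what remains is an identity of rational functions.\<close>

lemma real_divergence_identity:
  fixes a b c :: real
  assumes J: "a * a + b * c = - 1" "b \<noteq> 0"
    and s: "2 * a * p + b * q' + c * q = 0" and n: "2 * a * k + b * l' + c * l = 0" and m: "2 * a * i + b * j' + c * j = 0"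
  shows "(2 * p * ((a * x + b * y) * k + (c * x - a * y) * i) + q * ((a * x + b * y) * l' + (c * x - a * y) * j')
       + q' * ((a * x + b * y) * l + (c * x - a * y) * j))
     + ((p * a + q * c) * (x * k + y * i) + (p * b - q * a) * (x * l' + y * j')
       + (q' * a - p * c) * (x * l + y * j) - (q' * b + p * a) * (x * k + y * i))
     = 2 * (k * (p * (a * x + b * y) + q * (c * x - a * y)) + l * (q' * (a * x + b * y) - p * (c * x - a * y))
        + j' * (p * (a * x + b * y) + q * (c * x - a * y)) - i * (q' * (a * x + b * y) - p * (c * x - a * y)))"
proof -
  have c: "c = - (1 + a * a) / b" using J by (simp add: field_simps)
  have q': "q' = - (2 * a * p + c * q) / b" and l': "l' = - (2 * a * k + c * l) / b" and j': "j' = - (2 * a * i + c * j) / b"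
    using s n m J(2) by (simp_all add: field_simps)
  show ?thesis unfolding q' l' j' unfolding c using J(2) by (simp add: field_simps)
qed

text \<open>As J and N_X anticommute, the left side is the trace of s (N_{JX} - N_X J). It sees only
  the failure of N to be holomorphic, and in dimension two this failure is the divergence.\<close>

lemma divergence_identity:
  assumes sq: "J ** J = - mat 1" and s: "s \<in> TJ J" and N: "\<And>i. N i \<in> TJ J"
  shows "trace (s ** along N (J *v X)) + trace ((s ** J) ** along N X) = 2 * (\<Sum>i\<in>UNIV. (N i *v (s *v (J *v X))) $ i)"
proof -
  note J = complex_structure_trace_det[OF sq]
  note c = TJ_components[OF sq s] TJ_components[OF sq N]
  show ?thesis
    using real_divergence_identity[OF J(2,3) c(2) c(4)[of 1] c(4)[of 2], of "X$1" "X$2"]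
    by (simp add: mat2_trace mat2_mult along_comps mv_comps sum_2 c J(1) algebra_simps)
qed

text \<open>Notation as before, with u, v, v', -u for A. The Codazzi equation identifies the entries
  of the second derivative with l, j, -k, -l, so l and -k occur in both derivatives.\<close>

lemma real_symmetry_identity:
  fixes a b c :: real
  assumes J: "a * a + b * c = - 1" "b \<noteq> 0"
    and s: "2 * a * p + b * q' + c * q = 0" and A: "2 * a * u + b * v' + c * v = 0"
    and n: "2 * a * k + b * l' + c * l = 0" and m: "2 * a * l - b * k + c * j = 0"
  shows "2 * p * ((u * x + v * y) * k + (v' * x - u * y) * l) + q' * ((u * x + v * y) * l + (v' * x - u * y) * j)
      + q * ((u * x + v * y) * l' - (v' * x - u * y) * k)
    = 2 * u * ((p * x + q * y) * k + (q' * x - p * y) * l) + v' * ((p * x + q * y) * l + (q' * x - p * y) * j)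
      + v * ((p * x + q * y) * l' - (q' * x - p * y) * k)"
proof -
  have c: "c = - (1 + a * a) / b" using J by (simp add: field_simps)
  have q': "q' = - (2 * a * p + c * q) / b" and l': "l' = - (2 * a * k + c * l) / b" and v': "v' = - (2 * a * u + c * v) / b"
    and k: "k = (2 * a * l + c * j) / b"
    using s A n m J(2) by (simp_all add: field_simps)
  show ?thesis unfolding q' l' v' unfolding k unfolding c using J(2) by (simp add: field_simps)
qed

text \<open>In a complex coordinate with J = i one has N_X Y = n conj(x y), A X = \<alpha> conj(x)
  and s X = \<beta> conj(x). Then N_{AX} s is multiplication by n conj(\<alpha> \<beta>) x, which is
  symmetric in A and s.\<close>

lemma codazzi_trace_symmetric:
  assumes sq: "J ** J = - mat 1" and s: "s \<in> TJ J" and A: "A \<in> TJ J" and N: "\<And>i. N i \<in> TJ J"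
    and cod: "\<And>X Y. along N X *v Y = along N Y *v X"
  shows "trace (along N (A *v X) ** s) = trace (along N (s *v X) ** A)"
proof -
  note J = complex_structure_trace_det[OF sq]
  note c = TJ_components[OF sq s] TJ_components[OF sq A] TJ_components[OF sq N]
  have n: "N 1 $ k $ 2 = N 2 $ k $ 1" for k using cod codazzi_iff by blast
  have i: "N 2 $ 1 $ 1 = N 1 $ 1 $ 2" "N 2 $ 2 $ 1 = - N 1 $ 1 $ 1" using n c(5)[of 1] by simp_all
  have m: "2 * J$1$1 * N 1 $ 1 $ 2 - J$1$2 * N 1 $ 1 $ 1 + J$2$1 * N 2 $ 1 $ 2 = 0"
    using c(6)[of 2] by (simp add: i)
  show ?thesis
    using real_symmetry_identity[OF J(2,3) c(2) c(4) c(6)[of 1] m, of "X$1" "X$2"]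
    by (simp add: mat2_trace mat2_mult along_comps mv_comps c i algebra_simps)
qed

text \<open>Conformal invariance of the Codazzi equation for quadratic differentials. Two
  torsion-free connections for which J is parallel differ by matrices D i = \<alpha> + \<beta> J,
  and these are self-adjoint for \<sigma>. Hence the covariant derivatives of \<sigma> differ by
  twice S D i, and antisymmetrization removes this because D is symmetric in its lower
  indices.\<close>

lemma codazzi_change_of_connection:
  fixes \<Gamma> \<Gamma>' :: "2 \<Rightarrow> mat2"
  assumes sq: "J ** J = - mat 1" and S: "S = gJ r J ** s" and s: "s \<in> TJ J"
    and comm: "\<And>i. J ** (\<Gamma>' i - \<Gamma> i) = (\<Gamma>' i - \<Gamma> i) ** J"
    and sym: "\<And>i j k. \<Gamma> i $ k $ j = \<Gamma> j $ k $ i" "\<And>i j k. \<Gamma>' i $ k $ j = \<Gamma>' j $ k $ i"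
    and P: "\<And>i. P i = dS i - transpose (\<Gamma> i) ** S - S ** \<Gamma> i" "\<And>i. P' i = dS i - transpose (\<Gamma>' i) ** S - S ** \<Gamma>' i"
  shows "P 1 $ k $ 2 - P 2 $ k $ 1 = P' 1 $ k $ 2 - P' 2 $ k $ 1"
proof -
  define D where "D i = \<Gamma>' i - \<Gamma> i" for i
  have TS: "transpose (D i) ** S = S ** D i" for i
  proof -
    obtain \<alpha> \<beta> where "D i = \<alpha> *\<^sub>R mat 1 + \<beta> *\<^sub>R J"
      using commuting_with_J[OF sq comm[of i]] unfolding D_def by blast
    moreover have "transpose J ** S = S ** J"
      using transpose_area_mat_mult[OF sq] TJ_D[OF s]
      by (simp add: S gJ_eq scaleR_mult_left scaleR_mult_right matrix_mul_assoc matrix_neg_left)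
         (simp add: mat2_algebra mult_complex_structure_twice[OF sq] sq)
    ultimately show ?thesis
      by (simp add: transpose_add transpose_scaleR mat2_algebra)
  qed
  have Dsym: "D i $ l $ j = D j $ l $ i" for i j l using sym by (simp add: D_def)
  have "P i = P' i + 2 *\<^sub>R (S ** D i)" for i
  proof -
    have "P i - P' i = transpose (D i) ** S + S ** D i"
      by (simp add: P D_def mat2_algebra) (simp add: mat2_simps algebra_simps)
    thus ?thesis by (simp add: TS scaleR_2 algebra_simps)
  qed
  thus ?thesis using Dsym[of 1 _ 2] by (simp add: mat2_mult)
qed

section \<open>Local geometry of a solution of the Gauss--Codazzi equations\<close>

lemma C1_on_differentiable: "C1_on S F \<Longrightarrow> x \<in> S \<Longrightarrow> F differentiable at x"
  by (simp add: C1_on_def)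

lemmas C1_on_fst = C1_on_bounded_linear[OF bounded_linear_fst]
lemmas C1_on_snd = C1_on_bounded_linear[OF bounded_linear_snd]
lemmas C1_on_matrix_mult = C1_on_bounded_bilinear[OF bounded_bilinear_matrix_mult]
lemmas C1_on_scaleR = C1_on_bounded_bilinear[OF bounded_bilinear_scaleR]
lemmas C1_on_mult = C1_on_bounded_bilinear[OF bounded_bilinear_mult]
lemmas C1_on_trace = C1_on_bounded_linear[OF bounded_linear_trace]

lemma bounded_bilinear_matrix_vector_mult: "bounded_bilinear ((*v) :: mat2 \<Rightarrow> real^2 \<Rightarrow> real^2)"
proof -
  have "bilinear ((*v) :: mat2 \<Rightarrow> real^2 \<Rightarrow> real^2)"
    by (simp add: bilinear_def linear_iff vec_eq_iff mv_comps algebra_simps)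
  thus ?thesis by (simp add: bilinear_conv_bounded_bilinear)
qed

lemma C1_on_sharp:
  fixes r :: "'e::euclidean_space \<Rightarrow> real"
  assumes U: "open U" and r: "C1_on U r" and x: "C1_on U x" and T: "C1_on U T"
    and pt: "\<And>z. z \<in> U \<Longrightarrow> fst (x z) ** fst (x z) = - mat 1" "\<And>z. z \<in> U \<Longrightarrow> r z \<noteq> 0"
  shows "C1_on U (\<lambda>z. sharp (r z) (fst (x z)) (T z))"
proof (rule C1_on_cong[OF U])
  show "inverse (r z) *\<^sub>R (fst (x z) ** (area_mat ** T z)) = sharp (r z) (fst (x z)) (T z)" if "z \<in> U" for z
    using sharp_eq[OF pt(1)[OF that] pt(2)[OF that]] by (simp add: inverse_eq_divide)
  show "C1_on U (\<lambda>z. inverse (r z) *\<^sub>R (fst (x z) ** (area_mat ** T z)))"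
    by (intro C1_on_scaleR C1_on_inverse r C1_on_matrix_mult C1_on_fst x C1_on_const T) (rule pt(2))
qed

text \<open>The domain is an arbitrary Euclidean space: besides a chart, the lemma is applied to
  time times a chart in \<open>area_derivative\<close>.\<close>

lemma C1_on_ff:
  fixes r :: "'e::euclidean_space \<Rightarrow> real"
  assumes U: "open U" and r: "C1_on U r" and x: "C1_on U x"
    and pt: "\<And>z. z \<in> U \<Longrightarrow> r z > 0" "\<And>z. z \<in> U \<Longrightarrow> x z \<in> cotangent_points (r z)"
  shows "C1_on U (\<lambda>z. ff (r z) (x z))"
proof (rule C1_on_cong[OF U])
  note D = cotangent_points_D[OF pt(2,1)]
  let ?s = "\<lambda>z. sharp (r z) (fst (x z)) (snd (x z))"
  have eq: "1 + trace (?s z ** ?s z) * (1/2) = (ff (r z) (x z))\<^sup>2" if "z \<in> U" for z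
    using D(5)[OF that that] by (simp only: times_divide_eq_right mult_1_right)
  have pos: "1 + trace (?s z ** ?s z) * (1/2) > 0" if "z \<in> U" for z
    unfolding eq[OF that] using D(4)[OF that that] by simp
  show "sqrt (1 + trace (?s z ** ?s z) * (1/2)) = ff (r z) (x z)" if "z \<in> U" for z
    unfolding eq[OF that] using D(4)[OF that that] by simp
  show "C1_on U (\<lambda>z. sqrt (1 + trace (?s z ** ?s z) * (1/2)))"
    by (intro C1_on_sqrt C1_on_add C1_on_const C1_on_mult C1_on_trace C1_on_matrix_mult C1_on_sharp[OF U r x] C1_on_snd x pos
        D(1,2))
qed

text \<open>The data of one chart, with r the density of the area form. Rotated data satisfy the
  same assumptions, so the locale can be interpreted a second time for them.\<close>

locale local_data =
  fixes W :: "(real^2) set" and r :: "real^2 \<Rightarrow> real" and x :: "real^2 \<Rightarrow> mat2 \<times> mat2"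
  assumes W: "open W" and smooth_r: "smooth_on W r" and smooth_x: "smooth_on W x"
    and r_pos: "\<And>z. z \<in> W \<Longrightarrow> r z > 0" and x_in: "\<And>z. z \<in> W \<Longrightarrow> x z \<in> cotangent_points (r z)"
begin

abbreviation J where "J z \<equiv> fst (x z)"
abbreviation S where "S z \<equiv> snd (x z)"
abbreviation s where "s z \<equiv> sharp (r z) (J z) (S z)"
abbreviation f where "f z \<equiv> ff (r z) (x z)"
abbreviation g where "g z \<equiv> gJ (r z) (J z)"

lemmas pt = cotangent_points_D[OF x_in r_pos]

lemma C1_r: "C1_on W r" and C1_x: "C1_on W x"
  by (rule C1_on_smooth[OF smooth_r], rule C1_on_smooth[OF smooth_x])

lemma C1_J: "C1_on W (\<lambda>z. J z)" and C1_S: "C1_on W (\<lambda>z. S z)"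
  by (rule C1_on_fst[OF C1_x], rule C1_on_snd[OF C1_x])

lemma C1_sharp: "C1_on W T \<Longrightarrow> C1_on W (\<lambda>z. sharp (r z) (J z) (T z))"
  by (rule C1_on_sharp[OF W C1_r C1_x _ pt(1,2)])

lemma C1_s: "C1_on W (\<lambda>z. s z)"
  by (rule C1_sharp[OF C1_S])

lemma f_sq: "z \<in> W \<Longrightarrow> (f z)\<^sup>2 = 1 + trace (s z ** s z) / 2" and f_ge: "z \<in> W \<Longrightarrow> f z \<ge> 1"
  by (rule pt(5), assumption+) (rule pt(4))

lemma C1_f: "C1_on W (\<lambda>z. f z)"
  by (rule C1_on_ff[OF W C1_r C1_x r_pos x_in])

lemma C1_inverse_f: "C1_on W (\<lambda>z. inverse (f z))"
proof (rule C1_on_inverse[OF C1_f])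
  show "f z \<noteq> 0" if "z \<in> W" for z using f_ge[OF that] by simp
qed

lemma C1_sdot:
  assumes "C1_on W v"
  shows "C1_on W (\<lambda>z. sdot (r z) (x z) (v z))"
proof (rule C1_on_cong[OF W])
  show "sharp (r z) (J z) (snd (v z)) + (trace (s z ** (J z ** fst (v z))) * (1/2)) *\<^sub>R mat 1
      = sdot (r z) (x z) (v z)" if "z \<in> W" for z
    using sharp_gJ[OF pt(1,2)[OF that that]] that
    by (simp add: sdot_def form0_def sharp_linear pairing_sharp)
  show "C1_on W (\<lambda>z. sharp (r z) (J z) (snd (v z)) + (trace (s z ** (J z ** fst (v z))) * (1/2)) *\<^sub>R mat 1)"
    by (intro C1_on_add C1_sharp C1_on_snd C1_on_fst C1_on_scaleR C1_on_mult C1_on_trace C1_on_matrix_mult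
        C1_s C1_J C1_on_const assms)
qed

context
  fixes y assumes y: "y \<in> W"
begin

abbreviation \<Gamma> where "\<Gamma> \<equiv> christoffel (\<lambda>z. g z) y"

lemmas at_y = pt[OF y y]

lemma differentiable_at_y: "r differentiable at y" "(\<lambda>z. J z) differentiable at y" "(\<lambda>z. S z) differentiable at y"
  "(\<lambda>z. s z) differentiable at y" "(\<lambda>z. f z) differentiable at y" "(\<lambda>z. inverse (f z)) differentiable at y"
  using C1_r C1_J C1_S C1_s C1_f C1_inverse_f C1_on_differentiable y by blast+

lemma levi_civita: 
  "\<Gamma> i $ k $ j = \<Gamma> j $ k $ i"
  "pd i (\<lambda>z. J z) y = J y ** \<Gamma> i - \<Gamma> i ** J y"
  "pd i r y = r y * trace (\<Gamma> i)"
  "pd i (\<lambda>z. g z) y = transpose (\<Gamma> i) ** g y + g y ** \<Gamma> i"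
  "(\<lambda>z. g z) differentiable at y"
proof -
  have sq: "J z ** J z = - mat 1" if "z \<in> W" for z using pt(1)[OF that that] .
  note lc = christoffel_conformal[OF W y gJ_eq sq differentiable_at_y(2,1) at_y(2)]
  show "\<Gamma> i $ k $ j = \<Gamma> j $ k $ i"
    "pd i (\<lambda>z. J z) y = J y ** \<Gamma> i - \<Gamma> i ** J y"
    "pd i r y = r y * trace (\<Gamma> i)"
    "pd i (\<lambda>z. g z) y = transpose (\<Gamma> i) ** g y + g y ** \<Gamma> i"
    "(\<lambda>z. g z) differentiable at y"
    by (rule lc, assumption)+
qed

lemma nab_J: "nab \<Gamma> i (\<lambda>z. J z) y = 0"
  by (simp add: nab_def levi_civita(2))

text \<open>Differentiate E J + J E = 0, using that J is parallel.\<close>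

lemma nab_TJ:
  assumes "E differentiable at y" "\<And>z. z \<in> W \<Longrightarrow> E z \<in> TJ (J z)"
  shows "nab \<Gamma> i E y \<in> TJ (J y)"
proof -
  have "nab \<Gamma> i (\<lambda>z. E z ** J z + J z ** E z) y = nab \<Gamma> i (\<lambda>z. 0) y"
    by (rule nab_cong_open[OF W y]) (use assms(2) in \<open>simp add: TJ_def\<close>)
  thus ?thesis
    by (simp add: nab_add differentiable_matrix_mult nab_mult assms(1) differentiable_at_y nab_J mat2_algebra TJ_def)
       (simp add: nab_def pd_const mat2_algebra)
qed

lemma nab_mult_J: "E differentiable at y \<Longrightarrow> nab \<Gamma> i (\<lambda>z. E z ** J z) y = nab \<Gamma> i E y ** J y"
  by (simp add: nab_mult differentiable_at_y nab_J mat2_algebra)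

lemma divergence_mult_J:
  assumes "E differentiable at y"
  shows "divergence (\<lambda>z. g z) (\<lambda>z. E z ** J z) y X = divergence (\<lambda>z. g z) E y (J y *v X)"
  by (simp add: divergence_nab nab_mult_J[OF assms] matrix_vector_mul_assoc)

definition ds :: "2 \<Rightarrow> mat2" where "ds i = nab \<Gamma> i (\<lambda>z. s z) y"

lemma ds_TJ: "ds i \<in> TJ (J y)"
  unfolding ds_def by (rule nab_TJ[OF differentiable_at_y(4)]) (use pt(3) in auto)

lemma nabla_form_S: "nabla_form (\<lambda>z. g z) (\<lambda>z. S z) y X = g y ** along ds X"
proof -
  have S: "S z = g z ** s z" if "z \<in> W" for z using gJ_sharp(1)[OF pt(1,2)[OF that that]] that by simp
  show ?thesis
    using nabla_form_nabla_end[OF W y S levi_civita(4,5) differentiable_at_y(4)]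
    by (simp add: nabla_end_nab along_def ds_def)
qed

lemma pd_f: "pd i (\<lambda>z. f z) y = inverse (f y) * trace (ds i ** s y) / 2"
proof -
  have d: "(\<lambda>z. s z ** s z) differentiable at y" by (intro differentiable_matrix_mult differentiable_at_y)
  have "pd i (\<lambda>z. f z * f z) y = pd i (\<lambda>z. 1 + trace (s z ** s z) / 2) y"
    by (rule pd_cong_open[OF W y]) (use f_sq in \<open>simp add: power2_eq_square\<close>)
  also have "\<dots> = trace (nab \<Gamma> i (\<lambda>z. s z ** s z) y) / 2"
  proof -
    have "(\<lambda>z. trace (s z ** s z) / 2) differentiable at y"
      using differentiable_bounded_linear[OF bounded_linear_trace d] by (simp add: differentiable_divide)
    moreover have "pd i (\<lambda>z. trace (s z ** s z) / 2) y = pd i (\<lambda>z. trace (s z ** s z)) y / 2"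
      using pd_bounded_linear[OF bounded_linear_divide differentiable_bounded_linear[OF bounded_linear_trace d]] .
    ultimately show ?thesis
      using pd_add[of "\<lambda>z. 1" y "\<lambda>z. trace (s z ** s z) / 2" i] by (simp add: pd_const pd_trace[OF d])
  qed
  also have "\<dots> = trace (ds i ** s y)"
    by (simp add: nab_mult differentiable_at_y ds_def[symmetric] trace_linear trace_mult_commute[of "s y"])
  finally have "2 * f y * pd i (\<lambda>z. f z) y = trace (ds i ** s y)"
    using pd_bounded_bilinear[OF bounded_bilinear_mult differentiable_at_y(5,5)] by simp
  thus ?thesis using at_y(4) by (simp add: field_simps)
qed

end

section \<open>The Codazzi equation for the metric h and for g\<close>

definition codazzi_at :: "real^2 \<Rightarrow> bool" where
  "codazzi_at y \<longleftrightarrow> (let h = \<lambda>z. (1 + f z) *\<^sub>R g z; B = \<lambda>z. matrix_inv (h z) ** S z in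
     \<forall>X Y. nabla_end h B y X *v Y - nabla_end h B y Y *v X = 0)"

abbreviation h where "h z \<equiv> (1 + f z) *\<^sub>R g z"
abbreviation Bh where "Bh z \<equiv> matrix_inv (h z) ** S z"

lemma Bh_eq: "z \<in> W \<Longrightarrow> Bh z = inverse (1 + f z) *\<^sub>R s z"
proof -
  assume z: "z \<in> W"
  note p = pt[OF z z]
  have "h z ** (inverse (1 + f z) *\<^sub>R matrix_inv (g z)) = mat 1"
    using p(4) matrix_inv_inverse(1)[of "g z"] p(1,2) by (simp add: mat2_algebra det_gJ)
  hence "matrix_inv (h z) = inverse (1 + f z) *\<^sub>R matrix_inv (g z)"
    by (rule matrix_inv_unique)
  thus ?thesis by (simp add: sharp_def mat2_algebra)
qed

context
  fixes y assumes y: "y \<in> W"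
begin

lemma differentiable_Bh: "(\<lambda>z. Bh z) differentiable at y"
proof -
  have nz: "1 + f z \<noteq> 0" if "z \<in> W" for z using f_ge[OF that] by simp
  have "C1_on W (\<lambda>z. inverse (1 + f z) *\<^sub>R s z)"
    by (intro C1_on_scaleR C1_on_inverse C1_on_add C1_on_const C1_f C1_s) (rule nz)
  hence "C1_on W (\<lambda>z. Bh z)" by (rule C1_on_cong[OF W, rotated]) (simp add: Bh_eq)
  thus ?thesis using C1_on_differentiable y by blast
qed

lemma levi_civita_h:
  "christoffel (\<lambda>z. h z) y i $ k $ j = christoffel (\<lambda>z. h z) y j $ k $ i"
  "pd i (\<lambda>z. J z) y = J y ** christoffel (\<lambda>z. h z) y i - christoffel (\<lambda>z. h z) y i ** J y"
  "pd i (\<lambda>z. h z) y = transpose (christoffel (\<lambda>z. h z) y i) ** h y + h y ** christoffel (\<lambda>z. h z) y i"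
  "(\<lambda>z. h z) differentiable at y"
proof -
  have sq: "J z ** J z = - mat 1" if "z \<in> W" for z using pt(1)[OF that that] .
  have h: "h z = ((1 + f z) * r z) *\<^sub>R (area_mat ** J z)" for z by (simp add: gJ_eq)
  have d: "(\<lambda>z. (1 + f z) * r z) differentiable at y"
    using differentiable_at_y[OF y] by (intro differentiable_bounded_bilinear[OF bounded_bilinear_mult] differentiable_add) auto
  have nz: "(1 + f y) * r y \<noteq> 0" using pt(2,4)[OF y y] by simp
  note lc = christoffel_conformal[OF W y h sq differentiable_at_y(2)[OF y] d nz]
  show "christoffel (\<lambda>z. h z) y i $ k $ j = christoffel (\<lambda>z. h z) y j $ k $ i"
    "pd i (\<lambda>z. J z) y = J y ** christoffel (\<lambda>z. h z) y i - christoffel (\<lambda>z. h z) y i ** J y"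
    "pd i (\<lambda>z. h z) y = transpose (christoffel (\<lambda>z. h z) y i) ** h y + h y ** christoffel (\<lambda>z. h z) y i"
    "(\<lambda>z. h z) differentiable at y"
    by (rule lc, assumption)+
qed

text \<open>J is parallel for h as well, since h is conformal to g, and B anticommutes with
  J.\<close>

lemma nabla_end_Bh_J: "nabla_end (\<lambda>z. h z) (\<lambda>z. Bh z ** J z) y X = - (J y ** nabla_end (\<lambda>z. h z) (\<lambda>z. Bh z) y X)"
proof -
  let ?\<Gamma> = "christoffel (\<lambda>z. h z) y"
  have dJ: "(\<lambda>z. J z) differentiable at y" using differentiable_at_y[OF y] by blast
  have nJ: "nab ?\<Gamma> i (\<lambda>z. J z) y = 0" for i by (simp add: nab_def levi_civita_h(2))
  have BJ: "Bh z ** J z = (- 1) *\<^sub>R (J z ** Bh z)" if "z \<in> W" for z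
    using TJ_D[OF pt(3)[OF that that]] that by (simp add: Bh_eq mat2_algebra)
  have d2: "(\<lambda>z. J z ** Bh z) differentiable at y" by (intro differentiable_matrix_mult dJ differentiable_Bh)
  have "nab ?\<Gamma> i (\<lambda>z. Bh z ** J z) y = nab ?\<Gamma> i (\<lambda>z. (- 1) *\<^sub>R (J z ** Bh z)) y" for i
    by (rule nab_cong_open[OF W y BJ])
  also have "nab ?\<Gamma> i (\<lambda>z. (- 1) *\<^sub>R (J z ** Bh z)) y = - (J y ** nab ?\<Gamma> i (\<lambda>z. Bh z) y)" for i
    using nab_scaleR[OF differentiable_const d2, of ?\<Gamma> i "- 1"]
    by (simp add: nab_mult dJ differentiable_Bh nJ pd_const mat2_algebra)
  finally show ?thesis by (simp add: nabla_end_nab sum_2 mat2_algebra)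
qed

text \<open>The same form S is obtained by lowering B with h and s with g. The Codazzi equation for
  B is a symmetry of the h-derivative of S; \<open>codazzi_change_of_connection\<close> carries it
  to the g-derivative, and raising the index with g yields the claim for s.\<close>

lemma codazzi_ds:
  assumes "codazzi_at y"
  shows "along (ds y) X *v Y = along (ds y) Y *v X"
proof -
  let ?\<Gamma>' = "christoffel (\<lambda>z. h z) y" and ?\<Gamma> = "christoffel (\<lambda>z. g z) y"
  let ?P = "\<lambda>i. pd i (\<lambda>z. S z) y - transpose (?\<Gamma> i) ** S y - S y ** ?\<Gamma> i"
  let ?P' = "\<lambda>i. pd i (\<lambda>z. S z) y - transpose (?\<Gamma>' i) ** S y - S y ** ?\<Gamma>' i"
  note p = pt[OF y y]
  have nz: "det (h z) \<noteq> 0" if "z \<in> W" for z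
  proof -
    have "det (h z) = (1 + f z)\<^sup>2 * det (g z)" by (simp add: det_2 power2_eq_square algebra_simps)
    thus ?thesis using pt(1,2,4)[OF that that] by (simp add: det_gJ)
  qed
  have Sh: "S z = h z ** Bh z" if "z \<in> W" for z
    using matrix_inv_inverse(1)[OF nz[OF that]] by (simp add: matrix_mul_assoc)
  have Sg: "S z = g z ** s z" if "z \<in> W" for z using gJ_sharp(1)[OF pt(1,2)[OF that that]] that by simp
  have 1: "?P i = g y ** ds y i" for i
  proof -
    have "nabla_form (\<lambda>z. g z) (\<lambda>z. S z) y (axis i 1) = ?P i"
      using two_cases[of i] by (auto simp: nabla_form_def sum_2 axis_def)
    thus ?thesis by (simp add: nabla_form_S[OF y] along_axis)
  qed
  have 2: "?P' i = h y ** nab ?\<Gamma>' i (\<lambda>z. Bh z) y" for i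
  proof -
    have "nabla_form (\<lambda>z. h z) (\<lambda>z. S z) y (axis i 1) = ?P' i"
      using two_cases[of i] by (auto simp: nabla_form_def sum_2 axis_def)
    moreover have "nabla_end (\<lambda>z. h z) (\<lambda>z. Bh z) y (axis i 1) = nab ?\<Gamma>' i (\<lambda>z. Bh z) y"
      using two_cases[of i] by (auto simp: nabla_end_nab sum_2 axis_def)
    ultimately show ?thesis
      using nabla_form_nabla_end[OF W y Sh levi_civita_h(3,4) differentiable_Bh, of "axis i 1"] by simp
  qed
  have "along (\<lambda>i. nab ?\<Gamma>' i (\<lambda>z. Bh z) y) X *v Y = along (\<lambda>i. nab ?\<Gamma>' i (\<lambda>z. Bh z) y) Y *v X" for X Y
    using assms by (simp add: codazzi_at_def Let_def nabla_end_nab along_def)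
  hence B: "nab ?\<Gamma>' 1 (\<lambda>z. Bh z) y $ k $ 2 = nab ?\<Gamma>' 2 (\<lambda>z. Bh z) y $ k $ 1" for k
    using codazzi_iff[of "\<lambda>i. nab ?\<Gamma>' i (\<lambda>z. Bh z) y"] by blast
  have comm: "J y ** (?\<Gamma>' i - ?\<Gamma> i) = (?\<Gamma>' i - ?\<Gamma> i) ** J y" for i
    using levi_civita(2)[OF y, of i] levi_civita_h(2)[of i] by (simp add: mat2_algebra algebra_simps)
  have "?P 1 $ k $ 2 - ?P 2 $ k $ 1 = ?P' 1 $ k $ 2 - ?P' 2 $ k $ 1" for k
    using codazzi_change_of_connection[OF p(1) Sg[OF y] p(3) comm levi_civita(1)[OF y] levi_civita_h(1) refl refl] .
  hence "(g y ** ds y 1) $ k $ 2 = (g y ** ds y 2) $ k $ 1" for k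
    unfolding 1 2 using B by (simp add: mat2_mult)
  hence e: "(sharp (r y) (J y) (g y ** ds y 1)) $ k $ 2 = (sharp (r y) (J y) (g y ** ds y 2)) $ k $ 1" for k
    by (simp add: sharp_def mat2_mult[of "matrix_inv (g y)"])
  hence "ds y 1 $ k $ 2 = ds y 2 $ k $ 1" for k
    by (simp add: gJ_sharp(2)[OF p(1,2)])
  thus ?thesis using codazzi_iff[of "ds y"] by blast
qed

lemma ds_holomorphic: "codazzi_at y \<Longrightarrow> along (ds y) (J y *v X) = along (ds y) X ** J y"
  by (rule codazzi_holomorphic[OF pt(1)[OF y y] ds_TJ[OF y]]) (rule codazzi_ds)

end

section \<open>The equations of V and the flux\<close>

definition V_at :: "(real^2 \<Rightarrow> mat2 \<times> mat2) \<Rightarrow> real^2 \<Rightarrow> bool" where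
  "V_at v y \<longleftrightarrow> (\<forall>X.
     divergence (\<lambda>z. g z) (\<lambda>z. inverse (f z) *\<^sub>R sharp (r z) (J z) (form0 (r z) (x z) (v z))) y X
       = - inverse (f y) * pairing (r y) (J y) (nabla_form (\<lambda>z. g z) (\<lambda>z. S z) y (J y *v X)) (fst (v y)) \<and>
     divergence (\<lambda>z. g z) (\<lambda>z. fst (v z)) y X
       = - inverse ((f y)\<^sup>2) * inner_form (r y) (J y) (nabla_form (\<lambda>z. g z) (\<lambda>z. S z) y (J y *v X)) (form0 (r y) (x y) (v y)))"

lemma V_at_iff:
  assumes y: "y \<in> W"
  shows "V_at v y \<longleftrightarrow> (\<forall>X.
     divergence (\<lambda>z. g z) (\<lambda>z. inverse (f z) *\<^sub>R sdot (r z) (x z) (v z)) y X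
       = - inverse (f y) * trace (along (ds y) (J y *v X) ** fst (v y)) / 2 \<and>
     divergence (\<lambda>z. g z) (\<lambda>z. fst (v z)) y X
       = - inverse ((f y)\<^sup>2) * trace (along (ds y) (J y *v X) ** sdot (r y) (x y) (v y)) / 2)"
  by (simp add: V_at_def nabla_form_S[OF y] pairing_sharp inner_form_sharp gJ_sharp(2)[OF pt(1,2)[OF y y]] sdot_def)

text \<open>On a solution, the 1-form representing \<open>\<omega>\<^sub>I(L\<^sub>X(J, \<sigma>), \<cdot>)\<close> on \<open>V\<close> is, up to a divergence, minus the
  differential of \<open>\<langle>\<sigma>(\<cdot>, J\<cdot>), f\<^sup>-\<^sup>1 \<sigma>\<^sub>0\<rangle>\<close>: this is what the two equations of \<open>V\<close> amount to.\<close>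

definition flux :: "(real^2 \<Rightarrow> mat2 \<times> mat2) \<Rightarrow> real^2 \<Rightarrow> mat2" where
  "flux w z = f z *\<^sub>R fst (w z)
     + (inverse (f z) * trace (s z ** sdot (r z) (x z) (w z)) / 2) *\<^sub>R J z
     + (inverse (f z) * trace ((s z ** J z) ** sdot (r z) (x z) (w z)) / 2) *\<^sub>R mat 1"

lemma C1_flux:
  assumes "C1_on W w"
  shows "C1_on W (flux w)"
proof -
  have *: "flux w = (\<lambda>z. f z *\<^sub>R fst (w z)
     + ((inverse (f z) * trace (s z ** sdot (r z) (x z) (w z))) * (1/2)) *\<^sub>R J z
     + ((inverse (f z) * trace ((s z ** J z) ** sdot (r z) (x z) (w z))) * (1/2)) *\<^sub>R mat 1)"
    by (simp add: fun_eq_iff flux_def)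
  show ?thesis unfolding *
    by (intro C1_on_add C1_on_scaleR C1_f C1_on_fst C1_on_mult C1_inverse_f C1_on_trace C1_on_matrix_mult
        C1_s C1_sdot C1_J C1_on_const assms)
qed

text \<open>By symmetry of the Christoffel symbols M is \<nabla>X, and the derivative of r is r
  times the trace of \<Gamma>. The coordinate divergence of r E X is thus r times (div E)(X) + tr(E
  \<nabla>X).\<close>

lemma divergence_vector:
  assumes y: "y \<in> W" and E: "E differentiable at y" and X: "X differentiable at y"
  defines "M \<equiv> matrix (frechet_derivative X (at y)) + along (christoffel (\<lambda>z. g z) y) (X y)"
  shows "(\<Sum>i\<in>UNIV. pd i (\<lambda>z. r z * (E z *v X z) $ i) y)
    = r y * (divergence (\<lambda>z. g z) E y (X y) + trace (E y ** M))"
proof -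
  let ?\<Gamma> = "christoffel (\<lambda>z. g z) y"
  note lc = levi_civita[OF y]
  have D: "matrix (frechet_derivative X (at y)) $ k $ i = pd i X y $ k" for k i
    by (simp add: matrix_def pd_def dpartial_def)
  have d: "(\<lambda>z. E z *v X z) differentiable at y"
    by (rule differentiable_bounded_bilinear[OF bounded_bilinear_matrix_vector_mult E X])
  have "pd i (\<lambda>z. r z * (E z *v X z) $ i) y
    = r y * (E y *v pd i X y + pd i E y *v X y) $ i + r y * trace (?\<Gamma> i) * (E y *v X y) $ i" for i
    using pd_bounded_bilinear[OF bounded_bilinear_mult differentiable_at_y(1)[OF y]
        differentiable_bounded_linear[OF bounded_linear_vec_nth d], of i i]
    by (simp add: pd_bounded_linear[OF bounded_linear_vec_nth d] lc(3)
        pd_bounded_bilinear[OF bounded_bilinear_matrix_vector_mult E X])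
  moreover have "pd i E y = nab ?\<Gamma> i E y - ?\<Gamma> i ** E y + E y ** ?\<Gamma> i" for i
    by (simp add: nab_def)
  ultimately show ?thesis
    by (simp add: divergence_nab sum_2 M_def mat2_trace mat2_mult mv_comps along_comps D lc(1)[of 2 _ 1])
       (simp add: algebra_simps)
qed

text \<open>Because J is parallel and the connection has no torsion, the Lie derivative can be
  written with M = \<nabla>X: it sends J to [J, M] and \<sigma> to \<nabla>_X \<sigma> + M^T
  \<sigma> + \<sigma> M. The terms with M match the trace of the flux against M; the term with
  \<nabla>_X \<sigma> is matched with the divergence of the flux through the equations of V.\<close>

lemma omega_lie_derivative:
  assumes y: "y \<in> W" and w: "C1_on W w" "\<And>z. z \<in> W \<Longrightarrow> w z \<in> tangent_vectors (r z) (x z)"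
    and V: "V_at w y" and cod: "codazzi_at y"
    and X: "X differentiable at y" "(\<Sum>i\<in>UNIV. pd i (\<lambda>z. r z * X z $ i) y) = 0"
  defines "D \<equiv> matrix (frechet_derivative X (at y))" and "dx \<equiv> frechet_derivative x (at y) (X y)"
  shows "r y * pmetric (r y) (x y) (fst dx + J y ** D - D ** J y, snd dx + transpose D ** S y + S y ** D)
      (pI (r y) (x y) (w y)) = - (\<Sum>i\<in>UNIV. pd i (\<lambda>z. r z * (flux w z *v X z) $ i) y)"
proof -
  let ?\<Gamma> = "christoffel (\<lambda>z. g z) y" and ?J = "J y" and ?s = "s y" and ?f = "f y"
  define t where "t z = sdot (r z) (x z) (w z)" for z
  define \<tau> where "\<tau> z = inverse (f z) *\<^sub>R t z" for z
  let ?A = "fst (w y)" and ?t = "t y" and ?N = "along (ds y)" and ?X = "X y"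
  define M where "M = D + along ?\<Gamma> ?X"
  note p = pt[OF y y] and lc = levi_civita[OF y] and d = differentiable_at_y[OF y]
  have tan: "fst (w z) \<in> TJ (J z)" "t z \<in> TJ (J z)" if "z \<in> W" for z
    using w(2)[OF that] tangent_vectors_iff[OF pt(1,2)[OF that that]] by (auto simp: t_def)
  note A = tan(1)[OF y] and t = tan(2)[OF y]
  have f: "?f \<noteq> 0" using p(4) by simp
  have dA: "(\<lambda>z. fst (w z)) differentiable at y" and dt: "t differentiable at y"
    using C1_on_differentiable[OF C1_on_fst[OF w(1)] y] C1_on_differentiable[OF C1_sdot[OF w(1)] y]
    by (simp_all add: t_def[abs_def])
  have d\<tau>: "\<tau> differentiable at y"
    unfolding \<tau>_def[abs_def] by (rule differentiable_bounded_bilinear[OF bounded_bilinear_scaleR d(6) dt])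
  have \<tau>TJ: "\<tau> z \<in> TJ (J z)" if "z \<in> W" for z using tan(2)[OF that] by (simp add: \<tau>_def TJ_scaleR)
  define d\<tau>' where "d\<tau>' i = nab ?\<Gamma> i \<tau> y" for i
  have d\<tau>'TJ: "d\<tau>' i \<in> TJ ?J" for i unfolding d\<tau>'_def by (rule nab_TJ[OF y d\<tau> \<tau>TJ])
  have dsTJ: "ds y i \<in> TJ ?J" for i by (rule ds_TJ[OF y])
  have hol: "?N (?J *v Y) = ?N Y ** ?J" for Y by (rule ds_holomorphic[OF y cod])
  \<comment> \<open>X preserves the area form, so the divergence formula for the identity
    endomorphism leaves just the trace of \<nabla>X.\<close>
  have trM: "trace M = 0"
  proof -
    have "(\<Sum>i\<in>UNIV. pd i (\<lambda>z. r z * (mat 1 *v X z) $ i) y) = r y * (divergence (\<lambda>z. g z) (\<lambda>z. mat 1) y ?X + trace (mat 1 ** M))"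
      using divergence_vector[OF y differentiable_const[of "mat 1"] X(1)] unfolding M_def D_def by simp
    moreover have "divergence (\<lambda>z. g z) (\<lambda>z. mat 1) y ?X = 0"
      by (simp add: divergence_nab nab_def pd_const)
    ultimately show ?thesis using X(2) p(2) by simp
  qed
  let ?U = "(fst dx + ?J ** D - D ** ?J, snd dx + transpose D ** S y + S y ** D)"
  have dx: "dx = (\<Sum>i\<in>UNIV. ?X $ i *\<^sub>R pd i x y)"
    using fun_cong[OF frechet_derivative_at[OF pd_has_derivative[OF C1_on_differentiable[OF C1_x y]]], of ?X]
    by (simp add: dx_def)
  have pdJ: "fst (pd i x y) = ?J ** ?\<Gamma> i - ?\<Gamma> i ** ?J" for i
    using pd_bounded_linear[OF bounded_linear_fst C1_on_differentiable[OF C1_x y], of i] lc(2)[of i] by simp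
  have pdS: "snd (pd i x y) = transpose (?\<Gamma> i) ** S y + S y ** ?\<Gamma> i + g y ** ds y i" for i
  proof -
    have "nabla_form (\<lambda>z. g z) (\<lambda>z. S z) y (axis i 1) = pd i (\<lambda>z. S z) y - transpose (?\<Gamma> i) ** S y - S y ** ?\<Gamma> i"
      using two_cases[of i] by (auto simp: nabla_form_def sum_2 axis_def)
    thus ?thesis
      using pd_bounded_linear[OF bounded_linear_snd C1_on_differentiable[OF C1_x y], of i]
      by (simp add: nabla_form_S[OF y] along_axis algebra_simps)
  qed
  have U1: "fst ?U = ?J ** M - M ** ?J"
    by (simp add: dx sum_2 pdJ M_def along_def mat2_algebra algebra_simps)
  have U2: "snd ?U = transpose M ** S y + S y ** M + g y ** ?N ?X"
    by (simp add: dx sum_2 pdS M_def along_def mat2_algebra transpose_add transpose_scaleR algebra_simps)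
  have Sg: "S y = g y ** ?s" using gJ_sharp(1)[OF p(1,2)] by simp
  \<comment> \<open>For trace-free M transposition satisfies M^T \<omega> = -\<omega> M with
    \<omega> the area matrix, so the transpose disappears when the index is raised.\<close>
  have sMS: "sharp (r y) ?J (transpose M ** S y) = ?J ** (M ** (?J ** ?s))"
  proof -
    have "area_mat ** (transpose M ** (area_mat ** Y)) = M ** Y" for Y :: mat2
    proof -
      have "area_mat ** (transpose M ** (area_mat ** Y)) = area_mat ** ((transpose M ** area_mat) ** Y)"
        by (simp add: matrix_mul_assoc)
      also have "transpose M ** area_mat = - (area_mat ** M)"
        unfolding transpose_area_mat_trace trM by simp
      also have "area_mat ** (- (area_mat ** M) ** Y) = - ((area_mat ** area_mat) ** (M ** Y))"
        by (simp add: matrix_neg_left matrix_neg_right matrix_mul_assoc)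
      also have "\<dots> = M ** Y"
        unfolding area_mat_sq by (simp add: matrix_neg_left)
      finally show ?thesis .
    qed
    thus ?thesis
      using p(2) by (subst Sg, subst sharp_eq[OF p(1,2)]) (simp add: gJ_eq mat2_algebra)
  qed
  have sU: "sdot (r y) (x y) ?U = ?J ** (M ** (?J ** ?s)) + ?s ** M + ?N ?X
      + (trace (?s ** (?J ** (?J ** M - M ** ?J))) / 2) *\<^sub>R mat 1"
    unfolding sdot_def form0_def U1 U2
    by (simp add: sharp_linear(1-4) sharp_linear(5)[of "r y" ?J "S y"] sMS gJ_sharp(2)[OF p(1,2)]
        sharp_gJ[OF p(1,2)] pairing_sharp)
  have tJ: "trace (?t ** ?J) = 0" using TJ_trace[OF p(1) TJ_mult_J[OF p(1) t]] .
  \<comment> \<open>The anticommutator of two elements of \<open>TJ\<close> is scalar; this is why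
    only the trace of J M survives in T2.\<close>
  have sym: "?s ** ?t + ?t ** ?s = trace (?s ** ?t) *\<^sub>R mat 1"
  proof -
    have 1: "trace (?t ** (?s ** ?J)) = - trace (?s ** (?t ** ?J))"
      using trace_mult_commute[of ?t "?s ** ?J"] by (simp add: mat2_algebra TJ_push[OF t] trace_neg)
    have 2: "?t ** ?s = (trace (?s ** ?t) / 2) *\<^sub>R mat 1 + (trace (?s ** (?t ** ?J)) / 2) *\<^sub>R ?J"
      using TJ_mult[OF p(1) t p(3)] unfolding 1 trace_mult_commute[of ?t ?s] by simp
    have "?s ** ?t + ?t ** ?s = (trace (?s ** ?t) / 2 + trace (?s ** ?t) / 2) *\<^sub>R mat 1"
      by (subst 2, subst TJ_mult[OF p(1,3) t]) (simp only: scaleR_add_left, simp)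
    thus ?thesis by simp
  qed
  have T1: "trace ((?J ** M - M ** ?J) ** (?J ** ?A)) = 2 * trace (?A ** M)"
  proof -
    have "trace (?J ** (M ** (?J ** ?A))) = trace (M ** ?A)"
      using trace_mult_commute[of ?J "M ** (?J ** ?A)"] TJ_push[OF A]
      by (simp add: mat2_algebra p(1))
    thus ?thesis
      by (simp add: mat2_algebra mult_complex_structure_twice[OF p(1)] trace_linear trace_mult_commute[of M])
  qed
  have T2: "trace ((?J ** (M ** (?J ** ?s)) + ?s ** M) ** (?t ** ?J)) = - trace (?s ** ?t) * trace (?J ** M)"
  proof -
    have "trace (?J ** (M ** (?J ** (?s ** (?t ** ?J))))) = - trace (M ** (?J ** (?s ** ?t)))"
      using trace_mult_commute[of ?J "M ** (?J ** (?s ** (?t ** ?J)))"]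
      by (simp add: mat2_algebra p(1) trace_neg)
    moreover have "trace (?s ** (M ** (?t ** ?J))) = - trace (M ** (?J ** (?t ** ?s)))"
      using trace_mult_commute[of ?s "M ** (?t ** ?J)"] 
      by (simp add: mat2_algebra TJ_push[OF t] TJ_push[OF p(3)] trace_neg)
    ultimately have "trace ((?J ** (M ** (?J ** ?s)) + ?s ** M) ** (?t ** ?J)) = - trace (M ** (?J ** (?s ** ?t + ?t ** ?s)))"
      by (simp add: mult_add_left mult_add_right trace_linear matrix_mul_assoc[symmetric])
    thus ?thesis unfolding sym by (simp add: mat2_algebra trace_linear trace_mult_commute[of M])
  qed
  have T3: "trace (?N ?X ** (?t ** ?J)) = - trace (?N (?J *v ?X) ** ?t)"
    by (simp add: hol mat2_algebra TJ_push[OF t] trace_neg)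
  have div1: "divergence (\<lambda>z. g z) \<tau> y Y = - inverse ?f * trace (?N (?J *v Y) ** ?A) / 2" for Y
    using V[unfolded V_at_iff[OF y]] by (simp add: \<tau>_def[abs_def] t_def)
  have div2: "divergence (\<lambda>z. g z) (\<lambda>z. fst (w z)) y Y = - inverse (?f\<^sup>2) * trace (?N (?J *v Y) ** ?t) / 2" for Y
    using V[unfolded V_at_iff[OF y]] by (simp add: t_def)
  \<comment> \<open>T1 and T2 supply the terms with M; in T3 the second equation of V replaces the
    trace of N_{JX} t by a multiple of the divergence of A.\<close>
  have lhs: "pmetric (r y) (x y) ?U (pI (r y) (x y) (w y))
    = - ?f * trace (?A ** M) - inverse ?f * trace (?s ** ?t) / 2 * trace (?J ** M)
      + ?f * divergence (\<lambda>z. g z) (\<lambda>z. fst (w z)) y ?X"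
  proof -
    have "pmetric (r y) (x y) ?U (pI (r y) (x y) (w y))
      = - ?f * trace ((?J ** M - M ** ?J) ** (?J ** ?A)) / 2
        + inverse ?f * trace (sdot (r y) (x y) ?U ** (?t ** ?J)) / 2"
      unfolding pmetric_sdot pI_components[OF p(1)] U1 t_def by (simp add: matrix_neg_right trace_neg)
    also have "trace (sdot (r y) (x y) ?U ** (?t ** ?J))
      = trace ((?J ** (M ** (?J ** ?s)) + ?s ** M) ** (?t ** ?J)) + trace (?N ?X ** (?t ** ?J))"
      unfolding sU by (simp add: mult_add_left scaleR_mult_left trace_linear tJ)
    finally have P: "pmetric (r y) (x y) ?U (pI (r y) (x y) (w y))
      = - ?f * (2 * trace (?A ** M)) / 2
        + inverse ?f * (- trace (?s ** ?t) * trace (?J ** M) + - trace (?N (?J *v ?X) ** ?t)) / 2"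
      unfolding T1 T2 T3 .
    have "?f * inverse (?f\<^sup>2) = inverse ?f" using f by (simp add: power2_eq_square)
    hence "?f * (- inverse (?f\<^sup>2) * k / 2) = - inverse ?f * k / 2" for k
      by (metis (no_types, opaque_lifting) mult.assoc mult_minus_left mult_minus_right times_divide_eq_right)
    thus ?thesis unfolding P div2 by (simp add: algebra_simps add_divide_distrib diff_divide_distrib)
  qed
  \<comment> \<open>With \<tau> = t / f the coefficients of the flux contain no explicit 1 / f, so
    the derivatives appearing are those of s and of \<tau>, whose divergence is prescribed by
    V.\<close>
  define fd where "fd z = trace (s z ** \<tau> z) / 2" for z
  define ph where "ph z = trace ((s z ** J z) ** \<tau> z) / 2" for z
  have fl: "flux w = (\<lambda>z. (f z *\<^sub>R fst (w z) + fd z *\<^sub>R J z) + ph z *\<^sub>R mat 1)"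
    by (simp add: fun_eq_iff flux_def fd_def ph_def \<tau>_def t_def scaleR_mult_right trace_linear)
  have dsJ: "(\<lambda>z. s z ** J z) differentiable at y" by (intro differentiable_matrix_mult d)
  have d1: "(\<lambda>z. s z ** \<tau> z) differentiable at y" "(\<lambda>z. (s z ** J z) ** \<tau> z) differentiable at y"
    by (intro differentiable_matrix_mult d d\<tau>)+
  have dfd: "fd differentiable at y" and dph: "ph differentiable at y"
    unfolding fd_def[abs_def] ph_def[abs_def]
    by (intro differentiable_bounded_linear[OF bounded_linear_divide] differentiable_bounded_linear[OF bounded_linear_trace] d1)+
  have pfd: "pd i fd y = (trace (ds y i ** \<tau> y) + trace (?s ** d\<tau>' i)) / 2" for i
    unfolding fd_def[abs_def]
    by (subst pd_bounded_linear[OF bounded_linear_divide differentiable_bounded_linear[OF bounded_linear_trace d1(1)]])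
       (simp add: pd_trace[OF d1(1), where \<Gamma> = ?\<Gamma>] nab_mult d d\<tau> trace_linear ds_def[OF y] d\<tau>'_def)
  have pph: "pd i ph y = (trace ((ds y i ** ?J) ** \<tau> y) + trace ((?s ** ?J) ** d\<tau>' i)) / 2" for i
    unfolding ph_def[abs_def]
    by (subst pd_bounded_linear[OF bounded_linear_divide differentiable_bounded_linear[OF bounded_linear_trace d1(2)]])
       (simp add: pd_trace[OF d1(2), where \<Gamma> = ?\<Gamma>] nab_mult[OF dsJ d\<tau>] nab_mult_J[OF y d(4)] trace_linear ds_def[OF y] d\<tau>'_def)
  have lin: "(\<Sum>i\<in>UNIV. Y $ i * trace (N i ** E)) = trace (along N Y ** E)"
    "(\<Sum>i\<in>UNIV. Y $ i * trace (E ** N i)) = trace (E ** along N Y)" for N :: "2 \<Rightarrow> mat2" and E Y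
    by (simp_all add: along_def sum_2 mat2_algebra trace_linear)
  have nfl: "nab ?\<Gamma> i (flux w) y = pd i (\<lambda>z. f z) y *\<^sub>R ?A + ?f *\<^sub>R nab ?\<Gamma> i (\<lambda>z. fst (w z)) y
      + pd i fd y *\<^sub>R ?J + pd i ph y *\<^sub>R mat 1" for i
  proof -
    have 1: "(\<lambda>z. f z *\<^sub>R fst (w z)) differentiable at y" "(\<lambda>z. fd z *\<^sub>R J z) differentiable at y"
      "(\<lambda>z. ph z *\<^sub>R (mat 1 :: mat2)) differentiable at y"
      by (intro differentiable_bounded_bilinear[OF bounded_bilinear_scaleR] d dA dfd dph differentiable_const)+
    have 2: "nab ?\<Gamma> i (\<lambda>z. mat 1) y = 0" by (simp add: nab_def pd_const)
    show ?thesis unfolding fl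
      by (simp add: nab_add 1 differentiable_add nab_scaleR d dA dfd dph nab_J[OF y] 2)
  qed
  have "divergence (\<lambda>z. g z) (flux w) y ?X
    = (\<Sum>i\<in>UNIV. (?A *v ?X) $ i * pd i (\<lambda>z. f z) y) + ?f * divergence (\<lambda>z. g z) (\<lambda>z. fst (w z)) y ?X
      + (\<Sum>i\<in>UNIV. (?J *v ?X) $ i * pd i fd y) + (\<Sum>i\<in>UNIV. ?X $ i * pd i ph y)"
    by (simp add: divergence_nab nfl sum_2 mv_comps mat_def algebra_simps)
  also have "(\<Sum>i\<in>UNIV. (?A *v ?X) $ i * pd i (\<lambda>z. f z) y) = inverse ?f * trace (?N (?A *v ?X) ** ?s) / 2"
    by (simp add: pd_f[OF y] lin(1)[symmetric] sum_2 algebra_simps add_divide_distrib)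
  also have "(\<Sum>i\<in>UNIV. (?J *v ?X) $ i * pd i fd y)
    = (trace (?N (?J *v ?X) ** \<tau> y) + trace (?s ** along d\<tau>' (?J *v ?X))) / 2"
    by (simp add: pfd lin[symmetric] sum_2 algebra_simps add_divide_distrib)
  also have "(\<Sum>i\<in>UNIV. ?X $ i * pd i ph y)
    = (trace (?N ?X ** ?J ** \<tau> y) + trace ((?s ** ?J) ** along d\<tau>' ?X)) / 2"
    by (simp add: pph along_def sum_2 mat2_algebra trace_linear algebra_simps add_divide_distrib)
  also have "?N ?X ** ?J = ?N (?J *v ?X)" by (simp add: hol)
  finally have div: "divergence (\<lambda>z. g z) (flux w) y ?X = inverse ?f * trace (?N (?A *v ?X) ** ?s) / 2
      + ?f * divergence (\<lambda>z. g z) (\<lambda>z. fst (w z)) y ?X + trace (?N (?J *v ?X) ** \<tau> y)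
      + (trace (?s ** along d\<tau>' (?J *v ?X)) + trace ((?s ** ?J) ** along d\<tau>' ?X)) / 2"
    by (simp add: field_simps)
  \<comment> \<open>The derivatives of \<tau> enter only in this combination. It is the divergence
    of \<tau> evaluated on s J X, and so is known from the first equation of V.\<close>
  have "(trace (?s ** along d\<tau>' (?J *v ?X)) + trace ((?s ** ?J) ** along d\<tau>' ?X)) / 2
    = divergence (\<lambda>z. g z) \<tau> y (?s *v (?J *v ?X))"
    using divergence_identity[where N = d\<tau>' and X = ?X, OF p(1,3) d\<tau>'TJ] by (simp add: divergence_nab d\<tau>'_def)
  also have "\<dots> = - inverse ?f * trace (?N (?s *v ?X) ** ?A) / 2"
  proof -
    have "?J ** (?s ** ?J) = ?s" using TJ_push[OF p(3)] by (simp add: p(1) mat2_algebra)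
    hence "?J *v (?s *v (?J *v ?X)) = ?s *v ?X" by (simp add: matrix_vector_mul_assoc)
    thus ?thesis by (simp add: div1)
  qed
  \<comment> \<open>The symmetry given by Codazzi identifies this with minus the term of
    \<open>div\<close> that stems from the differential of f, so the two cancel.\<close>
  also have "trace (?N (?s *v ?X) ** ?A) = trace (?N (?A *v ?X) ** ?s)"
    by (rule codazzi_trace_symmetric[where N = "ds y", OF p(1,3) A dsTJ codazzi_ds[OF y cod], symmetric])
  finally have e: "(trace (?s ** along d\<tau>' (?J *v ?X)) + trace ((?s ** ?J) ** along d\<tau>' ?X)) / 2
    = - inverse ?f * trace (?N (?A *v ?X) ** ?s) / 2" .
  \<comment> \<open>The second equation of V gives -2 f times the divergence of A; together with the
    summand f times that divergence in \<open>div\<close>, -f times it remains.\<close>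
  have "trace (?N (?J *v ?X) ** \<tau> y) = - 2 * ?f * divergence (\<lambda>z. g z) (\<lambda>z. fst (w z)) y ?X"
    unfolding div2 using f by (simp add: \<tau>_def scaleR_mult_right trace_linear field_simps power2_eq_square)
  hence div': "divergence (\<lambda>z. g z) (flux w) y ?X = - ?f * divergence (\<lambda>z. g z) (\<lambda>z. fst (w z)) y ?X"
    unfolding div e by simp
  have trfl: "trace (flux w y ** M) = ?f * trace (?A ** M) + inverse ?f * trace (?s ** ?t) / 2 * trace (?J ** M)"
    by (simp add: flux_def t_def mult_add_left scaleR_mult_left trace_linear trM)
  have "(\<Sum>i\<in>UNIV. pd i (\<lambda>z. r z * (flux w z *v X z) $ i) y)
      = r y * (divergence (\<lambda>z. g z) (flux w) y ?X + trace (flux w y ** M))"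
    using divergence_vector[OF y C1_on_differentiable[OF C1_flux[OF w(1)] y] X(1)]
    unfolding M_def D_def by simp
  thus ?thesis unfolding div' trfl lhs by (simp add: algebra_simps)
qed

end

section \<open>Rotations preserve the equations\<close>

lemma smooth_on_rotated:
  fixes x :: "'e::euclidean_space \<Rightarrow> mat2 \<times> mat2"
  assumes "open U" "smooth_on U a" "smooth_on U b" "smooth_on U x"
  shows "smooth_on U (\<lambda>z. (fst (x z), a z *\<^sub>R snd (x z) + b z *\<^sub>R (snd (x z) ** fst (x z))))"
proof -
  have 1: "smooth_on U (\<lambda>z. fst (x z))" "smooth_on U (\<lambda>z. snd (x z))"
    by (rule smooth_on_bounded_linear[OF bounded_linear_fst assms(1,4)],
        rule smooth_on_bounded_linear[OF bounded_linear_snd assms(1,4)])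
  show ?thesis
    by (intro smooth_on_Pair smooth_on_add smooth_on_bounded_bilinear[OF bounded_bilinear_scaleR]
        smooth_on_bounded_bilinear[OF bounded_bilinear_matrix_mult] assms 1)
qed

lemma rot_pair: "rot \<theta> x = (fst x, cos \<theta> *\<^sub>R snd x + sin \<theta> *\<^sub>R (snd x ** fst x))"
  by (simp add: prod_eq_iff rot_components)

lemma smooth_on_rot:
  assumes "open U" "smooth_on U x"
  shows "smooth_on U (\<lambda>z. rot \<theta> (x z))"
  unfolding rot_pair by (intro smooth_on_rotated smooth_on_const assms)

lemma smooth_on_rot_deriv:
  fixes x v :: "'e::euclidean_space \<Rightarrow> mat2 \<times> mat2"
  assumes "open U" "smooth_on U x" "smooth_on U v"
  shows "smooth_on U (\<lambda>z. rot_deriv \<theta> (x z) (v z))"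
proof -
  have 1: "smooth_on U (\<lambda>z. fst (x z))" "smooth_on U (\<lambda>z. snd (x z))" "smooth_on U (\<lambda>z. fst (v z))" "smooth_on U (\<lambda>z. snd (v z))"
    by (rule smooth_on_bounded_linear[OF bounded_linear_fst assms(1)] smooth_on_bounded_linear[OF bounded_linear_snd assms(1)], rule assms)+
  show ?thesis unfolding rot_deriv_def
    by (intro smooth_on_Pair smooth_on_add smooth_on_bounded_linear[OF bounded_linear_scaleR_right]
        smooth_on_bounded_bilinear[OF bounded_bilinear_matrix_mult] assms(1) 1)
qed

lemma smooth_on_rot_joint:
  fixes x :: "'e::euclidean_space \<Rightarrow> mat2 \<times> mat2"
  assumes "open U" "smooth_on U x"
  shows "smooth_on ((UNIV :: real set) \<times> U) (\<lambda>z. rot (fst z) (x (snd z)))"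
  unfolding rot_pair
  using smooth_on_compose_fst_cos_sin[OF assms(1), of 1 0] smooth_on_compose_fst_cos_sin[OF assms(1), of 0 1]
  by (intro smooth_on_rotated smooth_on_compose_snd assms) (auto simp: open_Times assms)

lemma divergence_cong_open:
  assumes "open W" "y \<in> W" "\<And>z. z \<in> W \<Longrightarrow> E z = F z"
  shows "divergence G E y X = divergence G F y X"
  unfolding divergence_nab using nab_cong_open[OF assms] by simp

lemma nab_combination:
  assumes "E differentiable at y" "F differentiable at y"
  shows "nab \<Gamma> i (\<lambda>z. a *\<^sub>R E z + b *\<^sub>R F z) y = a *\<^sub>R nab \<Gamma> i E y + b *\<^sub>R nab \<Gamma> i F y"
proof -
  have 1: "nab \<Gamma> i (\<lambda>z. k *\<^sub>R E z) y = k *\<^sub>R nab \<Gamma> i E y" if "E differentiable at y" for k E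
    using nab_scaleR[OF differentiable_const that, of \<Gamma> i k] by (simp add: pd_const)
  show ?thesis
    using assms by (simp add: nab_add differentiable_bounded_linear[OF bounded_linear_scaleR_right] 1)
qed

lemma nabla_end_combination:
  assumes "E differentiable at y" "F differentiable at y"
  shows "nabla_end G (\<lambda>z. a *\<^sub>R E z + b *\<^sub>R F z) y X = a *\<^sub>R nabla_end G E y X + b *\<^sub>R nabla_end G F y X"
  by (simp add: nabla_end_nab nab_combination[OF assms] sum_2 algebra_simps)

lemma divergence_combination:
  assumes "E differentiable at y" "F differentiable at y"
  shows "divergence G (\<lambda>z. a *\<^sub>R E z + b *\<^sub>R F z) y X = a * divergence G E y X + b * divergence G F y X"
  by (simp add: divergence_nab nab_combination[OF assms] sum_2 mv_comps algebra_simps)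

lemma det_scaleR_rot:
  fixes J B :: mat2
  assumes "J ** J = - mat 1"
  shows "det (B ** (cos \<theta> *\<^sub>R mat 1 + sin \<theta> *\<^sub>R J)) = det B"
proof -
  note J = complex_structure_trace_det[OF assms]
  have "det (cos \<theta> *\<^sub>R mat 1 + sin \<theta> *\<^sub>R J) = (cos \<theta>)\<^sup>2 - (sin \<theta>)\<^sup>2 * (J$1$1 * J$1$1 + J$1$2 * J$2$1)"
    by (simp add: det_2 mat_def J(1) power2_eq_square algebra_simps)
  also have "\<dots> = 1" unfolding J(2) by simp
  finally show ?thesis by (simp add: det_mul)
qed

section \<open>Rotated data in a chart\<close>

context local_data
begin

lemma rotated: "local_data W r (\<lambda>z. rot \<theta> (x z))"
  by unfold_locales (auto intro: W smooth_r smooth_x r_pos x_in rot_cotangent_points(1) smooth_on_rot)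

context
  fixes \<theta> :: real and y assumes y: "y \<in> W"
begin

interpretation R: local_data W r "\<lambda>z. rot \<theta> (x z)"
  by (rule rotated)

text \<open>The rotation changes neither J nor r, hence neither g nor its connection, and the
  parallel J passes through the covariant derivative.\<close>

lemma rotated_ds: "R.ds y i = cos \<theta> *\<^sub>R ds y i + sin \<theta> *\<^sub>R (ds y i ** J y)"
proof -
  let ?\<Gamma> = "christoffel (\<lambda>z. g z) y"
  have d: "(\<lambda>z. s z ** J z) differentiable at y"
    by (intro differentiable_matrix_mult differentiable_at_y[OF y])
  have "R.ds y i = nab ?\<Gamma> i (\<lambda>z. cos \<theta> *\<^sub>R s z + sin \<theta> *\<^sub>R (s z ** J z)) y"
    unfolding R.ds_def[OF y] rot_components(1)[of \<theta>]
    by (rule nab_cong_open[OF W y]) (simp add: sharp_rot)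
  thus ?thesis
    by (simp add: nab_combination d differentiable_at_y[OF y] nab_mult_J[OF y] ds_def[OF y])
qed

lemma rotated_along_ds: "along (R.ds y) X = cos \<theta> *\<^sub>R along (ds y) X + sin \<theta> *\<^sub>R (along (ds y) X ** J y)"
  by (simp add: along_def sum_2 rotated_ds mat2_algebra algebra_simps)

text \<open>By \<open>nabla_end_Bh_J\<close> the covariant derivative of the rotated B is (cos
  \<theta> - sin \<theta> J) times that of B. Left multiplication acts on values only and preserves
  the symmetry in X and Y. The hypothesis on f ranges over all z because h is rewritten as a
  function on the whole plane.\<close>

lemma rotated_codazzi:
  assumes inv: "\<And>z. ff (r z) (rot \<theta> (x z)) = f z" and cod: "codazzi_at y"
  shows "R.codazzi_at y"
proof -
  let ?B = "\<lambda>z. cos \<theta> *\<^sub>R Bh z + sin \<theta> *\<^sub>R (Bh z ** J z)"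
  have B: "matrix_inv ((1 + f z) *\<^sub>R gJ (r z) (J z)) ** snd (rot \<theta> (x z)) = ?B z" for z
    by (simp add: rot_components mat2_algebra)
  have d: "(\<lambda>z. Bh z ** J z) differentiable at y"
    by (intro differentiable_matrix_mult differentiable_Bh[OF y] differentiable_at_y[OF y])
  have N: "nabla_end (\<lambda>z. h z) ?B y X = (cos \<theta> *\<^sub>R mat 1 - sin \<theta> *\<^sub>R J y) ** nabla_end (\<lambda>z. h z) (\<lambda>z. Bh z) y X" for X
    unfolding nabla_end_combination[OF differentiable_Bh[OF y] d] nabla_end_Bh_J[OF y]
    by (simp add: mult_diff_left scaleR_mult_left)
  have "nabla_end (\<lambda>z. h z) ?B y X *v Y = nabla_end (\<lambda>z. h z) ?B y Y *v X" for X Y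
    using cod unfolding N matrix_vector_mul_assoc[symmetric] by (simp add: codazzi_at_def Let_def)
  thus ?thesis unfolding R.codazzi_at_def Let_def inv rot_components(1) B by simp
qed

lemma rotated_det_Bh:
  "det (matrix_inv ((1 + f y) *\<^sub>R gJ (r y) (J y)) ** snd (rot \<theta> (x y))) = det (Bh y)"
  using det_scaleR_rot[OF pt(1)[OF y y], of "Bh y" \<theta>] by (simp add: rot_components mat2_algebra)

text \<open>By holomorphicity N_{JX} J is N at J(JX), so the first rotated equation at X is the
  combination with weights cos \<theta> and sin \<theta> of the original ones at X and at JX. In the
  second equation N and t turn together and their pairing is unchanged.\<close>

lemma rotated_V:
  assumes cod: "codazzi_at y" and v: "C1_on W v" "\<And>z. z \<in> W \<Longrightarrow> v z \<in> tangent_vectors (r z) (x z)"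
    and V: "V_at v y"
  shows "R.V_at (\<lambda>z. rot_deriv \<theta> (x z) (v z)) y"
proof -
  note p = pt[OF y y]
  have tan: "fst (v z) \<in> TJ (J z)" "sdot (r z) (x z) (v z) \<in> TJ (J z)" if "z \<in> W" for z
    using v(2)[OF that] tangent_vectors_iff[OF pt(1,2)[OF that that]] by auto
  have sd: "sdot (r z) (rot \<theta> (x z)) (rot_deriv \<theta> (x z) (v z))
      = cos \<theta> *\<^sub>R sdot (r z) (x z) (v z) + sin \<theta> *\<^sub>R (sdot (r z) (x z) (v z) ** J z)" if "z \<in> W" for z
    by (rule sdot_rot_deriv[OF pt(1-3)[OF that that] tan(1)[OF that]])
  have ff: "ff (r z) (rot \<theta> (x z)) = f z" if "z \<in> W" for z
    by (rule rot_cotangent_points(2)[OF x_in r_pos, OF that that])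
  let ?C = "\<lambda>z. inverse (f z) *\<^sub>R sdot (r z) (x z) (v z)"
  have dC: "?C differentiable at y"
    by (rule C1_on_differentiable[OF _ y]) (intro C1_on_scaleR C1_inverse_f C1_sdot v)
  have d: "(\<lambda>z. ?C z ** J z) differentiable at y"
    by (intro differentiable_matrix_mult dC differentiable_at_y[OF y])
  have divC: "divergence (\<lambda>z. g z) (\<lambda>z. inverse (ff (r z) (rot \<theta> (x z))) *\<^sub>R sdot (r z) (rot \<theta> (x z)) (rot_deriv \<theta> (x z) (v z))) y X
    = cos \<theta> * divergence (\<lambda>z. g z) ?C y X + sin \<theta> * divergence (\<lambda>z. g z) ?C y (J y *v X)" for X
  proof -
    have "divergence (\<lambda>z. g z) (\<lambda>z. inverse (ff (r z) (rot \<theta> (x z))) *\<^sub>R sdot (r z) (rot \<theta> (x z)) (rot_deriv \<theta> (x z) (v z))) y X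
      = divergence (\<lambda>z. g z) (\<lambda>z. cos \<theta> *\<^sub>R ?C z + sin \<theta> *\<^sub>R (?C z ** J z)) y X"
      by (rule divergence_cong_open[OF W y]) (simp add: sd ff mat2_algebra algebra_simps)
    also have "\<dots> = cos \<theta> * divergence (\<lambda>z. g z) ?C y X + sin \<theta> * divergence (\<lambda>z. g z) (\<lambda>z. ?C z ** J z) y X"
      by (rule divergence_combination[OF dC d])
    finally show ?thesis by (simp only: divergence_mult_J[OF y dC])
  qed
  have hol: "along (ds y) X ** J y = along (ds y) (J y *v X)" for X by (rule ds_holomorphic[OF y cod, symmetric])
  have tr: "trace (along (R.ds y) X ** sdot (r y) (rot \<theta> (x y)) (rot_deriv \<theta> (x y) (v y)))
      = trace (along (ds y) X ** sdot (r y) (x y) (v y))" for X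
    unfolding rotated_along_ds sd[OF y]
    by (rule trace_rot[OF p(1) along_TJ[OF ds_TJ[OF y]] tan(2)[OF y]])
  have f1: "fst (rot_deriv \<theta> (x z) (v z)) = fst (v z)" for z by (simp add: rot_deriv_def)
  show ?thesis
    unfolding R.V_at_iff[OF y] rot_components(1) divC tr f1 ff[OF y]
  proof (intro allI conjI)
    fix X
    show "cos \<theta> * divergence (\<lambda>z. g z) ?C y X + sin \<theta> * divergence (\<lambda>z. g z) ?C y (J y *v X)
      = - inverse (f y) * trace (along (R.ds y) (J y *v X) ** fst (v y)) / 2"
      using V unfolding V_at_iff[OF y] rotated_along_ds hol
      by (simp add: mult_add_left scaleR_mult_left trace_linear algebra_simps add_divide_distrib)
    show "divergence (\<lambda>z. g z) (\<lambda>z. fst (v z)) y X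
      = - inverse ((f y)\<^sup>2) * trace (along (ds y) (J y *v X) ** sdot (r y) (x y) (v y)) / 2"
      using V unfolding V_at_iff[OF y] by blast
  qed
qed

end

end

section \<open>The area measure\<close>

text \<open>The change of variables theorem is phrased with absolute integrability; this translates
  it to integrals of nonnegative functions, including the value infinity.\<close>

lemma nn_integral_absolutely_integrable:
  fixes F :: "real^2 \<Rightarrow> real"
  assumes S: "S \<in> sets borel" and m: "(\<lambda>x. indicator S x *\<^sub>R F x) \<in> borel_measurable borel"
    and nn: "\<And>x. x \<in> S \<Longrightarrow> F x \<ge> 0"
  shows "(\<integral>\<^sup>+x. ennreal (F x) * indicator S x \<partial>lborel)
    = (if F absolutely_integrable_on S then ennreal (integral S F) else \<infinity>)"
proof -
  let ?G = "\<lambda>x. indicator S x *\<^sub>R F x"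
  have m': "?G \<in> borel_measurable lborel" using m by simp
  have nn': "?G x \<ge> 0" for x using nn by (auto simp: indicator_def)
  have eq: "(\<integral>\<^sup>+x. ennreal (F x) * indicator S x \<partial>lborel) = (\<integral>\<^sup>+x. ennreal (?G x) \<partial>lborel)"
    by (rule nn_integral_cong) (auto simp: indicator_def)
  have ai: "F absolutely_integrable_on S \<longleftrightarrow> integrable lborel ?G"
    unfolding set_integrable_def using integrable_completion[OF m'] by simp
  show ?thesis
  proof (cases "F absolutely_integrable_on S")
    case True
    have "integral S F = integral\<^sup>L lborel ?G"
      using set_lebesgue_integral_eq_integral(2)[OF True] integral_completion[OF m']
      by (simp add: set_lebesgue_integral_def)
    thus ?thesis using True nn_integral_eq_integral[OF True[unfolded ai]] nn' by (simp add: eq)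
  next
    case False
    have "(\<integral>\<^sup>+x. ennreal (norm (?G x)) \<partial>lborel) = (\<integral>\<^sup>+x. ennreal (?G x) \<partial>lborel)"
      by (rule nn_integral_cong) (use nn' in auto)
    hence "\<not> (\<integral>\<^sup>+x. ennreal (?G x) \<partial>lborel) < \<infinity>"
      using False m' unfolding ai integrable_iff_bounded by simp
    hence "(\<integral>\<^sup>+x. ennreal (?G x) \<partial>lborel) = \<infinity>"
      unfolding infinity_ennreal_def top.not_eq_extremum[symmetric] by simp
    thus ?thesis unfolding eq using False by simp
  qed
qed

text \<open>The substitution rule transfers absolute integrability as well as the value, so the two
  sides are infinite together or finite and equal.\<close>

lemma nn_integral_change_of_variables:
  fixes \<tau> \<upsilon> :: "real^2 \<Rightarrow> real^2"
  assumes S: "S \<in> sets borel" "T \<in> sets borel"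
    and der: "\<And>x. x \<in> S \<Longrightarrow> (\<tau> has_derivative \<tau>' x) (at x)" "\<And>y. y \<in> T \<Longrightarrow> (\<upsilon> has_derivative \<upsilon>' y) (at y)"
    and inv: "\<And>x. x \<in> S \<Longrightarrow> \<tau> x \<in> T \<and> \<upsilon> (\<tau> x) = x" "\<And>y. y \<in> T \<Longrightarrow> \<upsilon> y \<in> S \<and> \<tau> (\<upsilon> y) = y"
    and id: "\<And>y. y \<in> T \<Longrightarrow> \<upsilon>' y \<circ> \<tau>' (\<upsilon> y) = id"
    and F: "\<And>x. x \<in> S \<Longrightarrow> F x = \<bar>det (matrix (\<tau>' x))\<bar> * G (\<tau> x)" "\<And>y. y \<in> T \<Longrightarrow> G y \<ge> 0"
    and m: "(\<lambda>x. indicator S x *\<^sub>R F x) \<in> borel_measurable borel" "(\<lambda>x. indicator T x *\<^sub>R G x) \<in> borel_measurable borel"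
  shows "(\<integral>\<^sup>+x. ennreal (F x) * indicator S x \<partial>lborel) = (\<integral>\<^sup>+y. ennreal (G y) * indicator T y \<partial>lborel)"
proof -
  have cov: "((\<lambda>x. \<bar>det (matrix (\<tau>' x))\<bar> * G (\<tau> x)) absolutely_integrable_on S \<and>
      integral S (\<lambda>x. \<bar>det (matrix (\<tau>' x))\<bar> * G (\<tau> x)) = b) \<longleftrightarrow> G absolutely_integrable_on T \<and> integral T G = b" for b
    by (rule cov_invertible_real[where h = \<upsilon> and h' = \<upsilon>'])
       (use der inv id in \<open>auto intro: has_derivative_at_withinI\<close>)
  have "integral S F = integral S (\<lambda>x. \<bar>det (matrix (\<tau>' x))\<bar> * G (\<tau> x))"
    by (rule integral_cong) (rule F(1))
  moreover have "F absolutely_integrable_on S \<longleftrightarrow> (\<lambda>x. \<bar>det (matrix (\<tau>' x))\<bar> * G (\<tau> x)) absolutely_integrable_on S"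
  proof -
    have "(\<lambda>x. indicator S x *\<^sub>R F x) = (\<lambda>x. indicator S x *\<^sub>R (\<bar>det (matrix (\<tau>' x))\<bar> * G (\<tau> x)))"
      by (auto simp: F(1) indicator_def)
    thus ?thesis unfolding set_integrable_def by simp
  qed
  ultimately have eqs: "F absolutely_integrable_on S \<longleftrightarrow> G absolutely_integrable_on T"
      "G absolutely_integrable_on T \<Longrightarrow> integral S F = integral T G"
    using cov[of "integral T G"] cov[of "integral S (\<lambda>x. \<bar>det (matrix (\<tau>' x))\<bar> * G (\<tau> x))"] by auto
  have nn: "F x \<ge> 0" if "x \<in> S" for x unfolding F(1)[OF that] using F(2) inv(1)[OF that] by simp
  note L = nn_integral_absolutely_integrable[OF S(1) m(1) nn] and R = nn_integral_absolutely_integrable[OF S(2) m(2) F(2)]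
  show ?thesis
  proof (cases "G absolutely_integrable_on T")
    case True
    thus ?thesis using L R eqs by simp
  next
    case False
    thus ?thesis using L R eqs by simp
  qed
qed

section \<open>Charts and area-preserving maps\<close>

lemma chart_inv_chart: "is_chart c \<Longrightarrow> p \<in> fst c \<Longrightarrow> chart_inv c (snd c p) = p"
  and chart_chart_inv: "is_chart c \<Longrightarrow> y \<in> snd c ` fst c \<Longrightarrow> snd c (chart_inv c y) = y"
  and chart_inv_in: "y \<in> snd c ` fst c \<Longrightarrow> chart_inv c y \<in> fst c"
  unfolding is_chart_def homeomorphism_def by (auto simp: chart_inv_def inv_into_into)

text \<open>Genus at least two enters through the sign of the total area, from which finiteness of
  the area measure is deduced.\<close>

locale surface =
  fixes A :: "'a::t2_space chart set" and \<rho> :: "('a, real) field"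
  assumes closed: "closed_oriented_surface A" and area: "area_form_field A \<rho>"
    and total_area: "measure (area_measure A \<rho>) UNIV > 0"
begin

lemma chart: "c \<in> A \<Longrightarrow> is_chart c"
  using closed by (simp add: closed_oriented_surface_def oriented_atlas_def)

lemma open_chart: "c \<in> A \<Longrightarrow> open (fst c)" "c \<in> A \<Longrightarrow> open (snd c ` fst c)"
  by (drule chart, simp add: is_chart_def)+

lemma continuous_on_chart: "c \<in> A \<Longrightarrow> continuous_on (fst c) (snd c)"
  "c \<in> A \<Longrightarrow> continuous_on (snd c ` fst c) (chart_inv c)"
  by (drule chart, simp add: is_chart_def homeomorphism_def)+

lemma covering: "\<exists>c. valid_at A c p"
proof -
  have "p \<in> (\<Union>c \<in> A. fst c)" using closed by (simp add: closed_oriented_surface_def oriented_atlas_def)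
  thus ?thesis unfolding valid_at_def by blast
qed

lemma valid_at_SOME: "valid_at A (SOME c. valid_at A c p) p"
  using covering by (rule someI_ex)

lemma compact_surface: "compact (UNIV :: 'a set)"
  using closed by (simp add: closed_oriented_surface_def)

lemma rho_pos: "valid_at A c p \<Longrightarrow> \<rho> c p > 0" and smooth_rho: "c \<in> A \<Longrightarrow> smooth_on (snd c ` fst c) (loc c \<rho>)"
  using area unfolding area_form_field_def smooth_field_def by blast+

lemma loc_chart: "c \<in> A \<Longrightarrow> p \<in> fst c \<Longrightarrow> loc c F (snd c p) = F c p"
  by (simp add: loc_def chart_inv_chart chart)

text \<open>Regarding the identity as an area-preserving diffeomorphism lets statements on \<phi> in
  a pair of charts cover transition maps too.\<close>

lemma id_symp: "id \<in> symp A \<rho>"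
proof -
  have "smooth_map A id" using closed by (simp add: closed_oriented_surface_def oriented_atlas_def)
  hence D: "id \<in> diffeos A" using inv_id[where 'a = 'a] by (simp add: diffeos_def)
  have e: "\<forall>c \<in> A. \<forall>d \<in> A. \<forall>p \<in> fst c \<inter> fst d. \<rho> c p = det (jacobian c d id p) * \<rho> d p"
    using area unfolding area_form_field_def by blast
  show ?thesis
    unfolding symp_def
  proof (intro CollectI conjI ballI D)
    fix c d p assume "c \<in> A" "d \<in> A" "p \<in> fst c \<inter> id -` fst d"
    thus "\<rho> c p = det (jacobian c d id p) * \<rho> d (id p)"
      using e[rule_format, of c d p] by auto
  qed
qed

lemma symp_D:
  assumes "\<phi> \<in> symp A \<rho>"
  shows "bij \<phi>" "smooth_map A \<phi>" "smooth_map A (inv_into UNIV \<phi>)" "continuous_on UNIV \<phi>" "continuous_on UNIV (inv_into UNIV \<phi>)"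
    "\<And>c d p. c \<in> A \<Longrightarrow> d \<in> A \<Longrightarrow> p \<in> fst c \<Longrightarrow> \<phi> p \<in> fst d \<Longrightarrow> \<rho> c p = det (jacobian c d \<phi> p) * \<rho> d (\<phi> p)"
proof -
  show *: "bij \<phi>" "smooth_map A \<phi>" "smooth_map A (inv_into UNIV \<phi>)"
    using assms by (simp_all add: symp_def diffeos_def)
  show "continuous_on UNIV \<phi>" "continuous_on UNIV (inv_into UNIV \<phi>)"
    using *(2,3) unfolding smooth_map_def by blast+
  show "\<rho> c p = det (jacobian c d \<phi> p) * \<rho> d (\<phi> p)"
    if "c \<in> A" "d \<in> A" "p \<in> fst c" "\<phi> p \<in> fst d" for c d p
    using assms that unfolding symp_def by blast
qed

lemma in_charts_apply: "c \<in> A \<Longrightarrow> p \<in> fst c \<Longrightarrow> in_charts c d \<phi> (snd c p) = snd d (\<phi> p)"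
  by (simp add: in_charts_def chart_inv_chart chart)

lemma in_charts_derivative:
  assumes "smooth_map A \<phi>" "c \<in> A" "d \<in> A" "p \<in> fst c" "\<phi> p \<in> fst d"
  shows "(in_charts c d \<phi> has_derivative (\<lambda>v. jacobian c d \<phi> p *v v)) (at (snd c p))"
proof -
  have "in_charts c d \<phi> differentiable at (snd c p)"
    using assms by (auto simp: smooth_map_def intro: smooth_on_differentiable)
  note * = differentiable_has_derivative[OF this]
  have "jacobian c d \<phi> p *v v = frechet_derivative (in_charts c d \<phi>) (at (snd c p)) v" for v
    unfolding jacobian_def using matrix_vector_mul(2)[OF has_derivative_linear[OF *]] by metis
  thus ?thesis using * by (metis (no_types, lifting) ext)
qed

lemma open_chart_image: "c \<in> A \<Longrightarrow> open U \<Longrightarrow> open (snd c ` (fst c \<inter> U))"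
proof -
  assume c: "c \<in> A" and U: "open U"
  have "snd c ` (fst c \<inter> U) = snd c ` fst c \<inter> chart_inv c -` U"
    by (auto simp: chart_inv_chart[OF chart[OF c]])
  thus ?thesis
    using continuous_on_open_vimage[OF open_chart(2)[OF c]] continuous_on_chart(2)[OF c] U by (metis Int_commute)
qed

lemma borel_chart_image:
  assumes "c \<in> A" "B \<in> sets borel" "B \<subseteq> fst c"
  shows "snd c ` B \<in> sets borel"
proof -
  have "snd c ` B = chart_inv c -` B \<inter> space (restrict_space borel (snd c ` fst c))"
  proof (intro equalityI subsetI)
    fix x assume "x \<in> chart_inv c -` B \<inter> space (restrict_space borel (snd c ` fst c))"
    thus "x \<in> snd c ` B"
      using chart_chart_inv[OF chart[OF assms(1)], of x] by (auto simp: space_restrict_space intro!: image_eqI[of _ _ "chart_inv c x"])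
  qed (use assms(3) in \<open>auto simp: space_restrict_space chart_inv_chart[OF chart[OF assms(1)]]\<close>)
  also have "\<dots> \<in> sets (restrict_space borel (snd c ` fst c))"
    using borel_measurable_continuous_on_restrict[OF continuous_on_chart(2)[OF assms(1)]] assms(2) by (rule measurable_sets)
  finally show ?thesis
    using open_chart(2)[OF assms(1)] by (auto simp: sets_restrict_space)
qed

definition chart_area :: "'a chart \<Rightarrow> 'a set \<Rightarrow> ennreal" where
  "chart_area c B = (\<integral>\<^sup>+ x. ennreal (loc c \<rho> x) * indicator (snd c ` B) x \<partial>lborel)"

lemma rho_measurable:
  assumes "c \<in> A" "S \<in> sets borel" "S \<subseteq> snd c ` fst c"
  shows "(\<lambda>x. indicator S x *\<^sub>R loc c \<rho> x) \<in> borel_measurable borel"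
proof -
  have "continuous_on (snd c ` fst c) (loc c \<rho>)"
    using C1_on_D(3)[OF C1_on_smooth[OF smooth_rho[OF assms(1)]]] .
  hence "continuous_on S (loc c \<rho>)" using assms(3) continuous_on_subset by blast
  thus ?thesis by (rule borel_measurable_continuous_on_indicator[OF assms(2)])
qed

text \<open>The densities are related by the Jacobian determinant of \<phi>, as the substitution
  rule demands. For the identity this is independence of the chart.\<close>

lemma chart_area_symp:
  assumes \<phi>: "\<phi> \<in> symp A \<rho>" and c: "c \<in> A" "d \<in> A" and B: "B \<in> sets borel" "B \<subseteq> fst c" "\<phi> ` B \<subseteq> fst d"
  shows "chart_area c B = chart_area d (\<phi> ` B)"
proof -
  note s = symp_D[OF \<phi>]
  have \<phi>B: "\<phi> ` B \<in> sets borel"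
  proof -
    have "\<phi> ` B = inv_into UNIV \<phi> -` B" using s(1) by (simp add: bij_vimage_eq_inv_image bij_imp_bij_inv inv_inv_eq)
    thus ?thesis using measurable_sets_borel[OF borel_measurable_continuous_onI[OF s(5)] B(1)] by simp
  qed
  let ?\<tau> = "in_charts c d \<phi>" and ?\<upsilon> = "in_charts d c (inv_into UNIV \<phi>)"
  let ?\<tau>' = "\<lambda>x v. jacobian c d \<phi> (chart_inv c x) *v v" and ?\<upsilon>' = "\<lambda>y v. jacobian d c (inv_into UNIV \<phi>) (chart_inv d y) *v v"
  have inv: "inv_into UNIV \<phi> (\<phi> p) = p" "\<phi> (inv_into UNIV \<phi> p) = p" for p
    using s(1) by (simp_all add: bij_is_inj bij_is_surj surj_f_inv_f)
  note ci = chart_inv_chart[OF chart]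
  show ?thesis unfolding chart_area_def
  proof (rule nn_integral_change_of_variables[where \<tau> = ?\<tau> and \<upsilon> = ?\<upsilon> and \<tau>' = ?\<tau>' and \<upsilon>' = ?\<upsilon>'])
    show "snd c ` B \<in> sets borel" "snd d ` \<phi> ` B \<in> sets borel"
      using borel_chart_image[OF c(1) B(1,2)] borel_chart_image[OF c(2) \<phi>B B(3)] .
    show "(\<lambda>x. indicator (snd c ` B) x *\<^sub>R loc c \<rho> x) \<in> borel_measurable borel"
      "(\<lambda>x. indicator (snd d ` \<phi> ` B) x *\<^sub>R loc d \<rho> x) \<in> borel_measurable borel"
      by (rule rho_measurable[OF c(1) borel_chart_image[OF c(1) B(1,2)] image_mono[OF B(2)]],
          rule rho_measurable[OF c(2) borel_chart_image[OF c(2) \<phi>B B(3)] image_mono[OF B(3)]])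
    fix x assume "x \<in> snd c ` B"
    then obtain p where p: "p \<in> B" "x = snd c p" by blast
    have pc: "p \<in> fst c" "\<phi> p \<in> fst d" using p B by auto
    show "(?\<tau> has_derivative ?\<tau>' x) (at x)"
      unfolding p(2) using in_charts_derivative[OF s(2) c pc] by (simp add: ci c pc)
    show "?\<tau> x \<in> snd d ` \<phi> ` B \<and> ?\<upsilon> (?\<tau> x) = x"
      using p pc by (auto simp: in_charts_apply c inv)
    \<comment> \<open>Both densities are positive, so the determinant is as well, which justifies
      the absolute value in the substitution rule.\<close>
    show "loc c \<rho> x = \<bar>det (matrix (?\<tau>' x))\<bar> * loc d \<rho> (?\<tau> x)"
    proof -
      have "\<rho> c p = det (jacobian c d \<phi> p) * \<rho> d (\<phi> p)" by (rule s(6)[OF c pc])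
      moreover have "\<rho> c p > 0" "\<rho> d (\<phi> p) > 0" using rho_pos c pc by (auto simp: valid_at_def)
      ultimately have "\<rho> c p = \<bar>det (jacobian c d \<phi> p)\<bar> * \<rho> d (\<phi> p)"
        by (metis abs_of_pos zero_less_mult_pos2)
      thus ?thesis using p pc by (simp add: in_charts_apply loc_chart c ci)
    qed
  next
    fix y assume "y \<in> snd d ` \<phi> ` B"
    then obtain p where p: "p \<in> B" "y = snd d (\<phi> p)" by blast
    have pc: "p \<in> fst c" "\<phi> p \<in> fst d" using p B by auto
    have pc': "inv_into UNIV \<phi> (\<phi> p) \<in> fst c" using pc by (simp add: inv)
    show "0 \<le> loc d \<rho> y" using rho_pos[of d "\<phi> p"] c pc by (simp add: p loc_chart valid_at_def)
    have d: "(?\<upsilon> has_derivative ?\<upsilon>' y) (at y)"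
      unfolding p(2) using in_charts_derivative[OF s(3) c(2,1) pc(2) pc'] by (simp add: ci c pc)
    thus "(?\<upsilon> has_derivative ?\<upsilon>' y) (at y)" .
    show "?\<upsilon> y \<in> snd c ` B \<and> ?\<tau> (?\<upsilon> y) = y"
      using p pc by (auto simp: in_charts_apply c inv)
    have y: "?\<upsilon> y = snd c p" "y = ?\<tau> (snd c p)" using p pc by (auto simp: in_charts_apply c inv)
    have d2: "(?\<tau> has_derivative ?\<tau>' (snd c p)) (at (snd c p))"
      using in_charts_derivative[OF s(2) c pc] by (simp add: ci c pc)
    \<comment> \<open>The composition of the two coordinate expressions is known to be the identity
      only on this open set, which is enough to differentiate it at the point.\<close>
    let ?U = "snd c ` (fst c \<inter> \<phi> -` fst d)"
    have "open (\<phi> -` fst d)" using s(4) open_chart(1)[OF c(2)] by (rule open_vimage[OF _, rotated])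
    hence U: "open ?U" by (rule open_chart_image[OF c(1)])
    have "((?\<upsilon> \<circ> ?\<tau>) has_derivative ?\<upsilon>' y \<circ> ?\<tau>' (snd c p)) (at (snd c p))"
      using diff_chain_at[OF d2] d y(2) by simp
    hence "(id has_derivative ?\<upsilon>' y \<circ> ?\<tau>' (snd c p)) (at (snd c p))"
      by (rule has_derivative_transform_within_open[OF _ U]) (use pc in \<open>auto simp: in_charts_apply c inv\<close>)
    thus "?\<upsilon>' y \<circ> ?\<tau>' (?\<upsilon> y) = id"
      unfolding y(1) using has_derivative_unique[OF _ has_derivative_id] by (simp add: id_def)
  qed
qed

end

lemma sum_measure_exists:
  assumes "finite I" "\<And>i. i \<in> I \<Longrightarrow> sets (M i) = sets borel"
  shows "\<exists>\<mu> :: 'b::topological_space measure. sets \<mu> = sets borel \<and>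
    (\<forall>B\<in>sets borel. emeasure \<mu> B = (\<Sum>i\<in>I. emeasure (M i) B))"
proof (intro exI conjI ballI)
  let ?\<mu> = "measure_of UNIV (sets borel) (\<lambda>B. \<Sum>i\<in>I. emeasure (M i) B) :: 'b measure"
  have sa: "sigma_algebra UNIV (sets (borel :: 'b measure))"
    using sets.sigma_algebra_axioms[of "borel :: 'b measure"] by simp
  show "sets ?\<mu> = sets borel"
    using sigma_algebra.sets_measure_of_eq[OF sa] .
  fix B :: "'b set" assume B: "B \<in> sets borel"
  show "emeasure ?\<mu> B = (\<Sum>i\<in>I. emeasure (M i) B)"
  proof (rule emeasure_measure_of_sigma[OF sa _ _ B])
    show "positive (sets borel) (\<lambda>B. \<Sum>i\<in>I. emeasure (M i) B)"
      by (simp add: positive_def)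
    show "countably_additive (sets borel) (\<lambda>B. \<Sum>i\<in>I. emeasure (M i) B)"
    proof (rule countably_additiveI)
      fix F :: "nat \<Rightarrow> 'b set" assume F: "range F \<subseteq> sets borel" "disjoint_family F"
      have "suminf (\<lambda>n. \<Sum>i\<in>I. emeasure (M i) (F n)) = (\<Sum>i\<in>I. suminf (\<lambda>n. emeasure (M i) (F n)))"
        by (rule suminf_sum) (rule summableI)
      also have "\<dots> = (\<Sum>i\<in>I. emeasure (M i) (\<Union>n. F n))"
        by (rule sum.cong[OF refl]) (use F assms(2) in \<open>auto intro!: suminf_emeasure\<close>)
      finally show "suminf (\<lambda>n. \<Sum>i\<in>I. emeasure (M i) (F n)) = (\<Sum>i\<in>I. emeasure (M i) (\<Union>n. F n))" .
    qed
  qed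
qed

text \<open>The mean value inequality bounds the difference quotients by g for steps of size at most
  1, so dominated convergence applies along every sequence of steps tending to 0.\<close>

lemma has_derivative_under_integral:
  fixes F F' :: "real \<Rightarrow> 'b \<Rightarrow> real"
  assumes int: "\<And>t. integrable M (F t)" and m: "F' 0 \<in> borel_measurable M" and g: "integrable M g"
    and d: "\<And>t p. p \<in> space M \<Longrightarrow> \<bar>t\<bar> \<le> 1 \<Longrightarrow> ((\<lambda>t. F t p) has_real_derivative F' t p) (at t)"
    and b: "\<And>t p. p \<in> space M \<Longrightarrow> \<bar>t\<bar> \<le> 1 \<Longrightarrow> \<bar>F' t p\<bar> \<le> g p"
  shows "((\<lambda>t. \<integral>p. F t p \<partial>M) has_real_derivative (\<integral>p. F' 0 p \<partial>M)) (at 0)"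
proof -
  let ?Q = "\<lambda>h p. (F h p - F 0 p) / h"
  have bound: "\<bar>?Q h p\<bar> \<le> g p" if p: "p \<in> space M" and h: "h \<noteq> 0" "\<bar>h\<bar> \<le> 1" for h p
  proof -
    have "norm (F h p - F 0 p) \<le> g p * norm (h - 0)"
    proof (rule field_differentiable_bound[where S = "{-1..1}" and f' = "\<lambda>t. F' t p"])
      show "((\<lambda>t. F t p) has_field_derivative F' z p) (at z within {-1..1})" if "z \<in> {-1..1}" for z
        by (rule has_field_derivative_at_within[OF d[OF p]]) (use that in auto)
      show "norm (F' z p) \<le> g p" if "z \<in> {-1..1}" for z
        using b[OF p, of z] that by (simp add: abs_le_iff)
    qed (use h in auto)
    thus ?thesis using h by (simp add: abs_divide divide_le_eq)
  qed
  have "((\<lambda>h. ((\<integral>p. F (0 + h) p \<partial>M) - (\<integral>p. F 0 p \<partial>M)) / h) \<longlongrightarrow> (\<integral>p. F' 0 p \<partial>M)) (at 0)"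
    unfolding tendsto_at_iff_sequentially
  proof (intro allI impI)
    fix X :: "nat \<Rightarrow> real" assume X0: "\<forall>i. X i \<in> UNIV - {0}" and X: "X \<longlonglongrightarrow> 0"
    \<comment> \<open>The bound is available for steps of size at most 1, so an initial segment of
      the sequence is dropped.\<close>
    obtain N where N: "\<And>n. n \<ge> N \<Longrightarrow> \<bar>X n\<bar> < 1"
      using LIMSEQ_D[OF X, of 1] by auto
    define Y where "Y n = X (n + N)" for n
    have Y: "Y n \<noteq> 0" "\<bar>Y n\<bar> \<le> 1" for n using X0 N[of "n + N"] by (auto simp: Y_def less_imp_le)
    have Ylim: "Y \<longlonglongrightarrow> 0" unfolding Y_def using X by (rule LIMSEQ_ignore_initial_segment)
    have "(\<lambda>n. \<integral>p. ?Q (Y n) p \<partial>M) \<longlonglongrightarrow> (\<integral>p. F' 0 p \<partial>M)"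
    proof (rule integral_dominated_convergence[OF m _ g])
      show "(\<lambda>p. ?Q (Y n) p) \<in> borel_measurable M" for n
        using int by (intro borel_measurable_divide borel_measurable_diff borel_measurable_integrable) auto
      show "AE p in M. (\<lambda>n. ?Q (Y n) p) \<longlonglongrightarrow> F' 0 p"
      proof (rule AE_I2)
        fix p assume "p \<in> space M"
        hence "((\<lambda>h. (F (0 + h) p - F 0 p) / h) \<longlongrightarrow> F' 0 p) (at 0)"
          using d[of p 0] by (simp add: DERIV_def)
        thus "(\<lambda>n. ?Q (Y n) p) \<longlonglongrightarrow> F' 0 p"
          using Y(1) Ylim unfolding tendsto_at_iff_sequentially by (auto simp: o_def)
      qed
      show "AE p in M. norm (?Q (Y n) p) \<le> g p" for n
        using bound Y by (intro AE_I2) (simp del: abs_divide)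
    qed
    moreover have "(\<integral>p. ?Q (Y n) p \<partial>M) = ((\<integral>p. F (Y n) p \<partial>M) - (\<integral>p. F 0 p \<partial>M)) / Y n" for n
      by (simp add: Bochner_Integration.integral_diff[OF int int])
    ultimately have "(\<lambda>n. ((\<integral>p. F (Y n) p \<partial>M) - (\<integral>p. F 0 p \<partial>M)) / Y n) \<longlonglongrightarrow> (\<integral>p. F' 0 p \<partial>M)"
      by (simp only:)
    hence "(\<lambda>n. ((\<integral>p. F (X (n + N)) p \<partial>M) - (\<integral>p. F 0 p \<partial>M)) / X (n + N)) \<longlonglongrightarrow> (\<integral>p. F' 0 p \<partial>M)"
      unfolding Y_def .
    hence "(\<lambda>n. ((\<integral>p. F (X n) p \<partial>M) - (\<integral>p. F 0 p \<partial>M)) / X n) \<longlonglongrightarrow> (\<integral>p. F' 0 p \<partial>M)"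
      by (rule LIMSEQ_offset[where k = N])
    thus "((\<lambda>h. ((\<integral>p. F (0 + h) p \<partial>M) - (\<integral>p. F 0 p \<partial>M)) / h) \<circ> X) \<longlonglongrightarrow> (\<integral>p. F' 0 p \<partial>M)"
      by (simp add: o_def)
  qed
  thus ?thesis by (simp add: DERIV_def)
qed

section \<open>Existence and uniqueness of the area measure\<close>

context surface
begin

text \<open>The inverse chart made total by a constant, hence Borel on the whole plane; the density
  in \<open>chart_measure\<close> vanishes where the value is arbitrary.\<close>

definition param :: "'a chart \<Rightarrow> real^2 \<Rightarrow> 'a" where
  "param c = (\<lambda>x. if x \<in> snd c ` fst c then chart_inv c x else undefined)"

definition chart_measure :: "'a chart \<Rightarrow> 'a measure" where
  "chart_measure c = distr (density lborel (\<lambda>x. ennreal (indicator (snd c ` fst c) x * loc c \<rho> x))) borel (param c)"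

lemma param_measurable: "c \<in> A \<Longrightarrow> param c \<in> borel_measurable borel"
  unfolding param_def
  using borel_measurable_continuous_on_restrict[OF continuous_on_chart(2)] open_chart(2)[of c]
  by (subst measurable_If_restrict_space_iff) (auto simp: image_iff[symmetric])

lemma density_measurable:
  "c \<in> A \<Longrightarrow> (\<lambda>x. indicator (snd c ` fst c) x * loc c \<rho> x) \<in> borel_measurable lborel"
  using rho_measurable[of c "snd c ` fst c"] open_chart(2)[of c] by simp

lemma loc_rho_pos: "c \<in> A \<Longrightarrow> x \<in> snd c ` fst c \<Longrightarrow> loc c \<rho> x > 0"
proof -
  assume c: "c \<in> A" and "x \<in> snd c ` fst c"
  then obtain p where "x = snd c p" "p \<in> fst c" by blast
  thus "loc c \<rho> x > 0" using c rho_pos[of c p] by (simp add: loc_chart valid_at_def)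
qed

lemma emeasure_chart_measure:
  assumes "c \<in> A" "B \<in> sets borel"
  shows "emeasure (chart_measure c) B = chart_area c (B \<inter> fst c)"
proof -
  have p: "param c \<in> measurable (density lborel (\<lambda>x. ennreal (indicator (snd c ` fst c) x * loc c \<rho> x))) borel"
    using param_measurable[OF assms(1)] by simp
  have s: "param c -` B \<in> sets lborel"
    using measurable_sets[OF param_measurable[OF assms(1)] assms(2)] by simp
  have "emeasure (chart_measure c) B
    = (\<integral>\<^sup>+x. ennreal (indicator (snd c ` fst c) x * loc c \<rho> x) * indicator (param c -` B) x \<partial>lborel)"
    unfolding chart_measure_def emeasure_distr[OF p assms(2)]
    using emeasure_density[OF _ s, of "\<lambda>x. ennreal (indicator (snd c ` fst c) x * loc c \<rho> x)"] density_measurable[OF assms(1)]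
    by simp
  also have "\<dots> = chart_area c (B \<inter> fst c)"
    unfolding chart_area_def
  proof (rule nn_integral_cong)
    fix x
    have "x \<in> snd c ` (B \<inter> fst c) \<longleftrightarrow> x \<in> snd c ` fst c \<and> param c x \<in> B"
      by (auto simp: param_def chart_inv_chart[OF chart[OF assms(1)]])
    thus "ennreal (indicator (snd c ` fst c) x * loc c \<rho> x) * indicator (param c -` B) x
        = ennreal (loc c \<rho> x) * indicator (snd c ` (B \<inter> fst c)) x"
      by (auto simp: indicator_def)
  qed
  finally show ?thesis .
qed

definition area_spec :: "'a measure \<Rightarrow> bool" where
  "area_spec \<mu> \<longleftrightarrow> sets \<mu> = sets borel \<and> (\<forall>c\<in>A. \<forall>B\<in>sets borel. B \<subseteq> fst c \<longrightarrow> emeasure \<mu> B = chart_area c B)"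

text \<open>Compactness leaves finitely many charts. Each point is assigned to the first chart
  containing it, so the pieces are differences of open sets.\<close>

lemma partition_into_charts:
  "\<exists>(cs :: nat \<Rightarrow> 'a chart) P n. (\<forall>i<n. cs i \<in> A \<and> P i \<in> sets borel \<and> P i \<subseteq> fst (cs i))
    \<and> disjoint_family_on P {..<n} \<and> (\<Union>i<n. P i) = UNIV"
proof -
  obtain C where C: "C \<subseteq> A" "finite C" "UNIV \<subseteq> (\<Union>c\<in>C. fst c)"
  proof (rule compactE_image[OF compact_surface, of A fst])
    show "UNIV \<subseteq> (\<Union>c\<in>A. fst c)" using covering by (force simp: valid_at_def)
  qed (use open_chart(1) in auto)
  obtain xs where xs: "set xs = C" using finite_list[OF C(2)] by blast
  define cs where "cs i = xs ! i" for i
  define n where "n = length xs"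
  define P where "P i = fst (cs i) - (\<Union>j<i. fst (cs j))" for i
  have cs: "cs i \<in> A" if "i < n" for i using that xs C(1) by (auto simp: cs_def n_def)
  have "disjoint_family_on P {..<n}"
    unfolding disjoint_family_on_def
  proof (intro ballI impI)
    fix i j :: nat assume "i \<noteq> j"
    thus "P i \<inter> P j = {}" by (cases "i < j") (force simp: P_def)+
  qed
  moreover have "(\<Union>i<n. P i) = UNIV"
  proof (rule UNIV_eq_I[symmetric])
    fix p
    obtain c where "c \<in> set xs" "p \<in> fst c" using C(3) xs by blast
    then obtain i where i: "i < n" "p \<in> fst (cs i)" unfolding cs_def n_def by (metis in_set_conv_nth)
    define k where "k = (LEAST i. p \<in> fst (cs i))"
    have "p \<in> fst (cs k)" "k \<le> i"
      unfolding k_def by (rule LeastI[of "\<lambda>i. p \<in> fst (cs i)", OF i(2)], rule Least_le[of "\<lambda>i. p \<in> fst (cs i)", OF i(2)])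
    moreover have "p \<notin> fst (cs j)" if "j < k" for j using not_less_Least that unfolding k_def by blast
    ultimately have "p \<in> P k" "k < n" using i(1) by (auto simp: P_def)
    thus "p \<in> (\<Union>i<n. P i)" by blast
  qed
  moreover have "P i \<in> sets borel" if "i < n" for i
    unfolding P_def using open_chart(1)[OF cs] that by (intro sets.Diff sets.finite_UN borel_open) auto
  ultimately show ?thesis using cs by (intro exI[of _ cs] exI[of _ P] exI[of _ n]) (auto simp: P_def)
qed

lemma area_spec_decompose:
  fixes n :: nat
  assumes "sets \<mu> = sets borel" "B \<in> sets borel" "\<forall>i<n. P i \<in> sets borel" "disjoint_family_on P {..<n}" "(\<Union>i<n. P i) = UNIV"
  shows "emeasure \<mu> B = (\<Sum>i<n. emeasure \<mu> (B \<inter> P i))"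
  by (rule sum_emeasure_cover) (use assms in auto)

lemma area_spec_unique:
  assumes "area_spec \<mu>" "area_spec \<nu>"
  shows "\<mu> = \<nu>"
proof (rule measure_eqI)
  show s: "sets \<mu> = sets \<nu>" using assms by (simp add: area_spec_def)
  fix B assume "B \<in> sets \<mu>"
  hence B: "B \<in> sets borel" using assms by (simp add: area_spec_def)
  obtain cs P and n :: nat where P: "\<And>i. i < n \<Longrightarrow> (cs i :: 'a chart) \<in> A \<and> P i \<in> sets borel \<and> P i \<subseteq> fst (cs i)"
    and d: "disjoint_family_on P {..<n}" "(\<Union>i<n. P i) = UNIV"
    using partition_into_charts by metis
  have "emeasure \<mu> (B \<inter> P i) = emeasure \<nu> (B \<inter> P i)" if "i < n" for i
  proof -
    have "B \<inter> P i \<in> sets borel" "B \<inter> P i \<subseteq> fst (cs i)" using B P[OF that] by auto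
    thus ?thesis using assms P[OF that] by (auto simp: area_spec_def)
  qed
  thus "emeasure \<mu> B = emeasure \<nu> B"
    using area_spec_decompose[of \<mu> B n P] area_spec_decompose[of \<nu> B n P] B P d assms
    by (simp add: area_spec_def)
qed

text \<open>Each piece of the partition receives the measure of its own chart. For a set inside
  another chart, \<open>chart_area_symp\<close> applied to the identity shows that both charts give
  the same mass to its part in each piece.\<close>

lemma area_spec_exists: "\<exists>\<mu>. area_spec \<mu>"
proof -
  obtain cs P and n :: nat where P: "\<And>i. i < n \<Longrightarrow> (cs i :: 'a chart) \<in> A \<and> P i \<in> sets borel \<and> P i \<subseteq> fst (cs i)"
    and d: "disjoint_family_on P {..<n}" "(\<Union>i<n. P i) = UNIV"
    using partition_into_charts by metis
  have sc: "sets (chart_measure c) = sets borel" for c by (simp add: chart_measure_def)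
  obtain \<mu> where \<mu>: "sets \<mu> = sets borel"
    "\<And>B. B \<in> sets borel \<Longrightarrow> emeasure \<mu> B = (\<Sum>i<n. emeasure (density (chart_measure (cs i)) (indicator (P i))) B)"
    using sum_measure_exists[of "{..<n}" "\<lambda>i. density (chart_measure (cs i)) (indicator (P i))"] sc by auto
  have "emeasure \<mu> B = chart_area c B" if c: "c \<in> A" and B: "B \<in> sets borel" "B \<subseteq> fst c" for c B
  proof -
    have "emeasure (density (chart_measure (cs i)) (indicator (P i))) B = emeasure (chart_measure c) (B \<inter> P i)" if i: "i < n" for i
    proof -
      note p = P[OF i]
      have BP: "B \<inter> P i \<in> sets borel" using p B by auto
      have "emeasure (density (chart_measure (cs i)) (indicator (P i))) B = (\<integral>\<^sup>+x. indicator (P i) x * indicator B x \<partial>chart_measure (cs i))"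
        using p B by (intro emeasure_density) (auto simp: sc measurable_cong_sets[OF sc refl])
      also have "\<dots> = (\<integral>\<^sup>+x. indicator (B \<inter> P i) x \<partial>chart_measure (cs i))"
        by (rule nn_integral_cong) (auto simp: indicator_def)
      also have "\<dots> = emeasure (chart_measure (cs i)) (B \<inter> P i)"
        using BP by (simp add: sc)
      also have "\<dots> = chart_area (cs i) (B \<inter> P i)"
        using emeasure_chart_measure[OF conjunct1[OF p] BP] p by (metis Int_absorb2 Int_assoc)
      also have "\<dots> = chart_area c (B \<inter> P i)"
        using chart_area_symp[OF id_symp conjunct1[OF p] c BP] p B by auto
      also have "\<dots> = emeasure (chart_measure c) (B \<inter> P i)"
        using emeasure_chart_measure[OF c BP] B(2) by (metis Int_absorb2 Int_assoc Int_commute)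
      finally show ?thesis .
    qed
    hence "emeasure \<mu> B = (\<Sum>i<n. emeasure (chart_measure c) (B \<inter> P i))" by (simp add: \<mu>(2)[OF B(1)])
    also have "\<dots> = emeasure (chart_measure c) B"
      using area_spec_decompose[of "chart_measure c" B n P] sc B P d by simp
    also have "\<dots> = chart_area c B" using emeasure_chart_measure[OF c B(1)] B(2) by (simp add: Int_absorb2)
    finally show ?thesis .
  qed
  thus ?thesis using \<mu>(1) by (auto simp: area_spec_def)
qed

abbreviation \<mu> where "\<mu> \<equiv> area_measure A \<rho>"

lemma area_spec_area_measure: "area_spec \<mu>"
proof -
  have "area_measure A \<rho> = (THE \<mu>. area_spec \<mu>)"
    unfolding area_measure_def area_spec_def chart_area_def ..
  thus ?thesis using area_spec_exists area_spec_unique by (metis the_equality)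
qed

lemma sets_area_measure: "sets \<mu> = sets borel"
  using area_spec_area_measure by (simp add: area_spec_def)

lemma space_area_measure: "space \<mu> = UNIV"
  using sets_eq_imp_space_eq[OF sets_area_measure] by simp

lemma area_measurable: "u \<in> borel_measurable borel \<Longrightarrow> u \<in> borel_measurable \<mu>"
  by (simp add: measurable_cong_sets[OF sets_area_measure refl])

text \<open>\<open>measure\<close> is 0 by convention where \<open>emeasure\<close> is infinite, so
  a positive total area certifies finiteness.\<close>

lemma finite_area_measure: "finite_measure \<mu>"
proof
  show "emeasure \<mu> (space \<mu>) \<noteq> \<infinity>"
    using total_area by (auto simp: space_area_measure measure_def)
qed

lemma area_measure_chart:
  assumes "c \<in> A"
  shows "density \<mu> (indicator (fst c)) = chart_measure c"
proof (rule measure_eqI)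
  show "sets (density \<mu> (indicator (fst c))) = sets (chart_measure c)"
    by (simp add: chart_measure_def sets_area_measure)
  fix B assume "B \<in> sets (density \<mu> (indicator (fst c)))"
  hence B: "B \<in> sets borel" by (simp add: sets_area_measure)
  have Bc: "B \<inter> fst c \<in> sets borel" using B open_chart(1)[OF assms] by auto
  have "emeasure (density \<mu> (indicator (fst c))) B = (\<integral>\<^sup>+x. indicator (fst c) x * indicator B x \<partial>\<mu>)"
    using B open_chart(1)[OF assms]
    by (intro emeasure_density borel_measurable_indicator) (auto simp: sets_area_measure)
  also have "\<dots> = (\<integral>\<^sup>+x. indicator (B \<inter> fst c) x \<partial>\<mu>)"
    by (rule nn_integral_cong) (auto simp: indicator_def)
  also have "\<dots> = emeasure \<mu> (B \<inter> fst c)" using Bc by (simp add: sets_area_measure)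
  also have "\<dots> = emeasure (chart_measure c) B"
    using area_spec_area_measure assms Bc emeasure_chart_measure[OF assms B] by (simp add: area_spec_def)
  finally show "emeasure (density \<mu> (indicator (fst c))) B = emeasure (chart_measure c) B" .
qed

lemma integral_in_chart:
  fixes u :: "'a \<Rightarrow> real"
  assumes c: "c \<in> A" and u: "u \<in> borel_measurable borel" "\<And>p. p \<notin> fst c \<Longrightarrow> u p = 0"
  shows "(\<integral>p. u p \<partial>\<mu>) = (\<integral>x. indicator (snd c ` fst c) x * loc c \<rho> x * u (chart_inv c x) \<partial>lborel)"
proof -
  have "(\<integral>p. u p \<partial>\<mu>) = (\<integral>p. indicator (fst c) p *\<^sub>R u p \<partial>\<mu>)"
    by (rule Bochner_Integration.integral_cong[OF refl]) (use u(2) in \<open>auto simp: indicator_def\<close>)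
  also have "\<dots> = (\<integral>p. u p \<partial>density \<mu> (\<lambda>p. ennreal (indicator (fst c) p)))"
    using open_chart(1)[OF c] by (intro integral_density[symmetric] area_measurable u(1)) (auto simp: sets_area_measure)
  also have "density \<mu> (\<lambda>p. ennreal (indicator (fst c) p)) = chart_measure c"
    using area_measure_chart[OF c] by (simp add: ennreal_indicator)
  also have "(\<integral>p. u p \<partial>chart_measure c) = (\<integral>x. u (param c x) \<partial>density lborel (\<lambda>x. ennreal (indicator (snd c ` fst c) x * loc c \<rho> x)))"
    unfolding chart_measure_def using param_measurable[OF c] u(1) by (intro integral_distr) auto
  also have "\<dots> = (\<integral>x. (indicator (snd c ` fst c) x * loc c \<rho> x) *\<^sub>R u (param c x) \<partial>lborel)"
  proof (rule integral_density[OF _ density_measurable[OF c]])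
    show "(\<lambda>x. u (param c x)) \<in> borel_measurable lborel"
      using measurable_compose[OF param_measurable[OF c] u(1)] by simp
    show "AE x in lborel. 0 \<le> indicator (snd c ` fst c) x * loc c \<rho> x"
      using loc_rho_pos[OF c] by (intro AE_I2) (auto simp: indicator_def less_imp_le)
  qed
  also have "\<dots> = (\<integral>x. indicator (snd c ` fst c) x * loc c \<rho> x * u (chart_inv c x) \<partial>lborel)"
    by (rule Bochner_Integration.integral_cong[OF refl]) (auto simp: indicator_def param_def)
  finally show ?thesis .
qed

text \<open>The push-forward fulfils the description of the area measure, which has a single
  solution. To check it, a set in a chart is cut along the images of the partition, so that each
  part and its preimage both lie in one chart.\<close>

lemma distr_symp:
  assumes \<phi>: "\<phi> \<in> symp A \<rho>"
  shows "distr \<mu> borel \<phi> = \<mu>"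
proof (rule area_spec_unique[OF _ area_spec_area_measure])
  note s = symp_D[OF \<phi>]
  have m: "\<phi> \<in> measurable \<mu> borel"
    by (rule area_measurable[OF borel_measurable_continuous_onI[OF s(4)]])
  have "emeasure (distr \<mu> borel \<phi>) B = chart_area c B" if c: "c \<in> A" and B: "B \<in> sets borel" "B \<subseteq> fst c" for c B
  proof -
    obtain cs P and n :: nat where P: "\<And>i. i < n \<Longrightarrow> (cs i :: 'a chart) \<in> A \<and> P i \<in> sets borel \<and> P i \<subseteq> fst (cs i)"
      and d: "disjoint_family_on P {..<n}" "(\<Union>i<n. P i) = UNIV"
      using partition_into_charts by metis
    let ?B = "\<phi> -` B"
    have vB: "?B \<in> sets borel"
      using measurable_sets_borel[OF borel_measurable_continuous_onI[OF s(4)] B(1)] .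
    have Q: "\<phi> ` P i = inv_into UNIV \<phi> -` P i" for i
      using s(1) by (simp add: bij_vimage_eq_inv_image bij_imp_bij_inv inv_inv_eq)
    have QB: "\<phi> ` P i \<in> sets borel" if "i < n" for i
      unfolding Q using measurable_sets_borel[OF borel_measurable_continuous_onI[OF s(5)]] P[OF that] by blast
    have eq: "\<phi> ` (?B \<inter> P i) = B \<inter> \<phi> ` P i" for i by auto
    have "emeasure (distr \<mu> borel \<phi>) B = emeasure \<mu> ?B"
      using emeasure_distr[OF m B(1)] by (simp add: space_area_measure)
    also have "\<dots> = (\<Sum>i<n. emeasure \<mu> (?B \<inter> P i))"
      by (rule area_spec_decompose[OF sets_area_measure vB _ d]) (use P in auto)
    also have "\<dots> = (\<Sum>i<n. emeasure \<mu> (B \<inter> \<phi> ` P i))"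
    proof (rule sum.cong[OF refl])
      fix i assume "i \<in> {..<n}"
      hence i: "i < n" by simp
      note p = P[OF i]
      have 1: "?B \<inter> P i \<in> sets borel" "?B \<inter> P i \<subseteq> fst (cs i)" "\<phi> ` (?B \<inter> P i) \<subseteq> fst c"
        using p vB B by auto
      have 2: "B \<inter> \<phi> ` P i \<in> sets borel" "B \<inter> \<phi> ` P i \<subseteq> fst c" using QB[OF i] B by auto
      have "emeasure \<mu> (?B \<inter> P i) = chart_area (cs i) (?B \<inter> P i)"
        using area_spec_area_measure 1 p unfolding area_spec_def by blast
      also have "\<dots> = chart_area c (B \<inter> \<phi> ` P i)"
        using chart_area_symp[OF \<phi> conjunct1[OF p] c 1] unfolding eq .
      also have "\<dots> = emeasure \<mu> (B \<inter> \<phi> ` P i)"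
        using area_spec_area_measure 2 c unfolding area_spec_def by metis
      finally show "emeasure \<mu> (?B \<inter> P i) = emeasure \<mu> (B \<inter> \<phi> ` P i)" .
    qed
    also have "\<dots> = emeasure \<mu> B"
    proof (rule area_spec_decompose[OF sets_area_measure B(1), symmetric])
      show "\<forall>i<n. \<phi> ` P i \<in> sets borel" using QB by blast
      show "disjoint_family_on (\<lambda>i. \<phi> ` P i) {..<n}"
        using d(1) unfolding disjoint_family_on_def by (simp add: image_Int[OF bij_is_inj[OF s(1)], symmetric])
      have "(\<Union>i<n. \<phi> ` P i) = range \<phi>" using d(2) by blast
      thus "(\<Union>i<n. \<phi> ` P i) = UNIV" using s(1) by (simp add: bij_is_surj)
    qed
    also have "\<dots> = chart_area c B" using area_spec_area_measure c B by (simp add: area_spec_def)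
    finally show ?thesis .
  qed
  thus "area_spec (distr \<mu> borel \<phi>)" by (auto simp: area_spec_def)
qed

end

section \<open>The divergence theorem\<close>

lemma C1_on_Un_open:
  assumes "open U" "open V" "C1_on U F" "C1_on V F"
  shows "C1_on (U \<union> V) F"
  using assms unfolding C1_on_def by (auto intro: continuous_on_open_Un)

lemma frechet_derivative_zero:
  assumes "open U" "x \<in> U" "\<And>y. y \<in> U \<Longrightarrow> F y = 0"
  shows "frechet_derivative F (at x) v = 0"
  using frechet_derivative_cong_open[OF assms(1,2), of F "\<lambda>_. 0"] assms(3)
    frechet_derivative_at[OF has_derivative_const[of 0 "at x"]] by metis

text \<open>No iterated integrals are used: the integral of G is invariant under translation in
  direction k, and differentiating the translated integral at 0 under the integral sign gives the
  integral of the partial derivative.\<close>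

lemma integral_pd_compact_support:
  fixes G :: "real^2 \<Rightarrow> real"
  assumes G: "C1_on UNIV G" and R: "\<And>x. norm x > R \<Longrightarrow> G x = 0"
  shows "integrable lborel (\<lambda>x. pd k G x)" "(\<integral>x. pd k G x \<partial>lborel) = 0"
proof -
  let ?e = "axis k 1 :: real^2"
  have fin: "emeasure lborel (cball 0 b :: (real^2) set) < \<infinity>" for b
    by (rule emeasure_bounded_finite[OF bounded_cball])
  define G' where "G' x = pd k G x" for x
  have G': "continuous_on UNIV G'"
    using C1_on_D(2)[OF G, of ?e] by (simp add: G'_def[abs_def] pd_def dpartial_def)
  have G'0: "G' x = 0" if "norm x > R" for x
  proof -
    have "open {x :: real^2. norm x > R}" by (intro open_Collect_less continuous_intros)
    thus ?thesis using that frechet_derivative_zero[of "{x. norm x > R}" x G ?e] R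
      by (simp add: G'_def pd_def dpartial_def)
  qed
  have bounded: "\<exists>B\<ge>0. \<forall>x. \<bar>H x\<bar> \<le> B" if H: "continuous_on UNIV H" "\<And>x. norm x > R \<Longrightarrow> H x = 0" for H :: "real^2 \<Rightarrow> real"
  proof -
    have "compact (H ` cball 0 R)"
      by (intro compact_continuous_image continuous_on_subset[OF H(1)]) auto
    then obtain B where B: "\<And>x. x \<in> cball 0 R \<Longrightarrow> \<bar>H x\<bar> \<le> B"
      using compact_imp_bounded bounded_iff by (metis image_eqI real_norm_def)
    have "\<bar>H x\<bar> \<le> max B 0" for x
      using B[of x] H(2)[of x] by (cases "norm x > R") auto
    thus ?thesis by (intro exI[of _ "max B 0"]) auto
  qed
  have intH: "integrable lborel (\<lambda>x. H (t *\<^sub>R ?e + x))" if H: "continuous_on UNIV H" "\<And>x. norm x > R \<Longrightarrow> H x = 0"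
    for H :: "real^2 \<Rightarrow> real" and t
  proof -
    obtain B where B: "B \<ge> 0" "\<And>x. \<bar>H x\<bar> \<le> B" using bounded[OF H] by blast
    have i: "integrable lborel (\<lambda>x :: real^2. B * indicator (cball 0 (R + \<bar>t\<bar>)) x)"
      by (intro integrable_mult_right integrable_real_indicator) (simp_all add: fin[unfolded infinity_ennreal_def])
    have m: "(\<lambda>x. H (t *\<^sub>R ?e + x)) \<in> borel_measurable lborel"
    proof -
      have "continuous_on UNIV (\<lambda>x. t *\<^sub>R ?e + x)" by (intro continuous_intros)
      from continuous_on_compose2[OF H(1) this] show ?thesis
        by (auto dest: borel_measurable_continuous_onI)
    qed
    show ?thesis
    proof (rule Bochner_Integration.integrable_bound[OF i m], rule AE_I2)
      fix x :: "real^2"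
      have "norm x \<le> norm (t *\<^sub>R ?e + x) + \<bar>t\<bar>"
        using norm_triangle_ineq4[of "t *\<^sub>R ?e + x" "t *\<^sub>R ?e"] by (simp add: norm_axis_1)
      hence "norm (t *\<^sub>R ?e + x) > R" if "norm x > R + \<bar>t\<bar>" using that by linarith
      thus "norm (H (t *\<^sub>R ?e + x)) \<le> norm (B * indicator (cball 0 (R + \<bar>t\<bar>)) x)"
        using B H(2) by (cases "norm x > R + \<bar>t\<bar>") (auto simp: indicator_def)
    qed
  qed
  show "integrable lborel (\<lambda>x. pd k G x)"
    using intH[OF G' G'0, of 0] by (simp add: G'_def)
  obtain B where B: "B \<ge> 0" "\<And>x. \<bar>G' x\<bar> \<le> B" using bounded[OF G' G'0] by blast
  have "((\<lambda>t. \<integral>x. G (t *\<^sub>R ?e + x) \<partial>lborel) has_real_derivative (\<integral>x. G' (0 *\<^sub>R ?e + x) \<partial>lborel)) (at 0)"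
  proof (rule has_derivative_under_integral[where g = "\<lambda>x. B * indicator (cball 0 (R + 1)) x"])
    show "integrable lborel (\<lambda>x. G (t *\<^sub>R ?e + x))" for t by (rule intH[OF C1_on_D(3)[OF G] R])
    show "(\<lambda>x. G' (0 *\<^sub>R ?e + x)) \<in> borel_measurable lborel"
      using borel_measurable_continuous_onI[OF G'] by simp
    show "integrable lborel (\<lambda>x :: real^2. B * indicator (cball 0 (R + 1)) x)"
      by (intro integrable_mult_right integrable_real_indicator) (simp_all add: fin[unfolded infinity_ennreal_def])
    fix t :: real and x :: "real^2" assume t: "\<bar>t\<bar> \<le> 1"
    have "((\<lambda>t. G (t *\<^sub>R ?e + x)) has_derivative (\<lambda>s. frechet_derivative G (at (t *\<^sub>R ?e + x)) (s *\<^sub>R ?e))) (at t)"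
      by (rule has_derivative_compose[OF _ C1_on_D(1)[OF G]]) (auto intro!: derivative_eq_intros)
    moreover have "frechet_derivative G (at (t *\<^sub>R ?e + x)) (s *\<^sub>R ?e) = G' (t *\<^sub>R ?e + x) * s" for s
      using linear_cmul[OF has_derivative_linear[OF C1_on_D(1)[OF G]]] by (simp add: G'_def pd_def dpartial_def)
    ultimately show "((\<lambda>t. G (t *\<^sub>R ?e + x)) has_real_derivative G' (t *\<^sub>R ?e + x)) (at t)"
      by (simp add: has_field_derivative_def)
    have "norm x \<le> norm (t *\<^sub>R ?e + x) + \<bar>t\<bar>"
      using norm_triangle_ineq4[of "t *\<^sub>R ?e + x" "t *\<^sub>R ?e"] by (simp add: norm_axis_1)
    hence "norm (t *\<^sub>R ?e + x) > R" if "norm x > R + 1" using that t by linarith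
    thus "\<bar>G' (t *\<^sub>R ?e + x)\<bar> \<le> B * indicator (cball 0 (R + 1)) x"
      using B G'0 by (cases "norm x > R + 1") (auto simp: indicator_def)
  qed
  moreover have "(\<integral>x. G (t *\<^sub>R ?e + x) \<partial>lborel) = (\<integral>x. G x \<partial>lborel)" for t
  proof -
    have "(\<integral>x. G x \<partial>lborel) = (\<integral>x. G x \<partial>distr lborel borel ((+) (t *\<^sub>R ?e)))"
      by (simp only: lborel_distr_plus)
    also have "\<dots> = (\<integral>x. G (t *\<^sub>R ?e + x) \<partial>lborel)"
      by (rule integral_distr) (auto intro: borel_measurable_continuous_onI[OF C1_on_D(3)[OF G]])
    finally show ?thesis ..
  qed
  ultimately have "((\<lambda>t. \<integral>x. G x \<partial>lborel) has_real_derivative (\<integral>x. G' x \<partial>lborel)) (at (0 :: real))"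
    by simp
  from DERIV_unique[OF this DERIV_const] show "(\<integral>x. pd k G x \<partial>lborel) = 0" by (simp add: G'_def)
qed

text \<open>Bumps that are merely continuously differentiable suffice, so polynomials can be used.\<close>

lemma max_sq_has_derivative: "((\<lambda>s :: real. (max 0 s)\<^sup>2) has_real_derivative 2 * max 0 s) (at s)"
proof -
  consider "s > 0" | "s < 0" | "s = 0" by linarith
  thus ?thesis
  proof cases
    case 1
    have d: "((\<lambda>s :: real. s\<^sup>2) has_real_derivative 2 * max 0 s) (at s)"
      using 1 DERIV_power[OF DERIV_ident, of 2 s UNIV] by simp
    show ?thesis
      by (rule has_field_derivative_transform_within_open[OF d, of "{0<..}"]) (use 1 in auto)
  next
    case 2
    have d: "((\<lambda>s :: real. 0) has_real_derivative 2 * max 0 s) (at s)" using 2 by simp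
    show ?thesis
      by (rule has_field_derivative_transform_within_open[OF d, of "{..<0}"]) (use 2 in auto)
  next
    case 3
    have "((\<lambda>h :: real. (max 0 h)\<^sup>2 / h) \<longlongrightarrow> 0) (at 0)"
    proof (rule Lim_null_comparison)
      have "norm ((max 0 h)\<^sup>2 / h) \<le> \<bar>h\<bar>" for h :: real
        by (cases "h > 0") (auto simp: max_def power2_eq_square)
      thus "\<forall>\<^sub>F h in at 0. norm ((max 0 h)\<^sup>2 / h) \<le> \<bar>h :: real\<bar>" by simp
      show "((\<lambda>h :: real. \<bar>h\<bar>) \<longlongrightarrow> 0) (at 0)" using tendsto_rabs[OF tendsto_ident_at, of 0 UNIV] by simp
    qed
    thus ?thesis using 3 by (simp add: DERIV_def)
  qed
qed

definition bump :: "real^2 \<Rightarrow> real \<Rightarrow> real^2 \<Rightarrow> real" where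
  "bump y0 R y = (max 0 (R\<^sup>2 - (y - y0) \<bullet> (y - y0)))\<^sup>2"

lemma C1_on_bump: "C1_on UNIV (bump y0 R)"
  unfolding bump_def[abs_def]
proof (rule C1_on_compose_real[where T = UNIV and F = "\<lambda>y. R\<^sup>2 - (y - y0) \<bullet> (y - y0)"])
  show "C1_on UNIV (\<lambda>y. R\<^sup>2 - (y - y0) \<bullet> (y - y0))"
  proof (rule C1_on_I)
    show "((\<lambda>y. R\<^sup>2 - (y - y0) \<bullet> (y - y0)) has_derivative (\<lambda>v. - (2 * ((y - y0) \<bullet> v)))) (at y)" for y
      by (rule derivative_eq_intros refl)+ (simp add: fun_eq_iff inner_commute)
    show "continuous_on UNIV (\<lambda>y. - (2 * ((y - y0) \<bullet> v)))" for v
      by (intro continuous_intros)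
  qed
  show "((\<lambda>s. (max 0 s)\<^sup>2) has_real_derivative 2 * max 0 s) (at s)" for s by (rule max_sq_has_derivative)
qed (auto intro!: continuous_intros)

lemma bump_nonneg: "bump y0 R y \<ge> 0"
  by (simp add: bump_def)

lemma bump_pos_iff: "R > 0 \<Longrightarrow> bump y0 R y > 0 \<longleftrightarrow> dist y0 y < R"
proof -
  assume "R > 0"
  hence "dist y0 y < R \<longleftrightarrow> (y - y0) \<bullet> (y - y0) < R\<^sup>2"
    using power2_less_imp_less[of "dist y0 y" R] power_strict_mono[of "dist y0 y" R 2]
    by (auto simp: dist_norm norm_minus_commute power2_norm_eq_inner[symmetric])
  thus ?thesis by (auto simp: bump_def)
qed

section \<open>Partition of unity and the divergence theorem on the surface\<close>

context surface
begin

text \<open>Chart expressions that define one continuous function on the surface; compactness and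
  finite area then give integrability.\<close>

definition scalar :: "('a, real) field \<Rightarrow> bool" where
  "scalar u \<longleftrightarrow> (\<forall>c d p. valid_at A c p \<longrightarrow> valid_at A d p \<longrightarrow> u c p = u d p) \<and>
     (\<forall>c\<in>A. continuous_on (snd c ` fst c) (loc c u))"

text \<open>The chart is chosen as in \<open>surface_integral\<close>, so the integral of u is that
  of \<open>glue u\<close> by definition, even before u is known to be chart-independent.\<close>

definition glue :: "('a, real) field \<Rightarrow> 'a \<Rightarrow> real" where
  "glue u p = u (SOME c. valid_at A c p) p"

lemma surface_integral_glue: "surface_integral A \<rho> u = (\<integral>p. glue u p \<partial>\<mu>)"
  by (simp add: surface_integral_def glue_def)

lemma glue_eq: "scalar u \<Longrightarrow> valid_at A c p \<Longrightarrow> glue u p = u c p"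
  unfolding glue_def scalar_def using valid_at_SOME by blast

lemma continuous_on_glue:
  assumes "scalar u"
  shows "continuous_on UNIV (glue u)"
proof -
  have "continuous_on (fst c) (glue u)" if c: "c \<in> A" for c
  proof -
    have "continuous_on (fst c) (\<lambda>p. loc c u (snd c p))"
      by (rule continuous_on_compose2[OF _ continuous_on_chart(1)[OF c]])
         (use assms c in \<open>auto simp: scalar_def\<close>)
    thus ?thesis
      by (rule continuous_on_eq) (use c glue_eq[OF assms] in \<open>auto simp: loc_chart valid_at_def\<close>)
  qed
  hence "continuous_on (\<Union>c\<in>A. fst c) (glue u)"
    using open_chart(1) by (intro continuous_on_open_UN) auto
  moreover have "(\<Union>c\<in>A. fst c) = UNIV"
    using closed by (simp add: closed_oriented_surface_def oriented_atlas_def)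
  ultimately show ?thesis by simp
qed

lemma measurable_glue: "scalar u \<Longrightarrow> glue u \<in> borel_measurable borel"
  by (rule borel_measurable_continuous_onI) (rule continuous_on_glue)

lemma integrable_glue:
  assumes "scalar u"
  shows "integrable \<mu> (glue u)"
proof -
  have "bounded (range (glue u))"
    by (intro compact_imp_bounded compact_continuous_image continuous_on_glue assms compact_surface)
  then obtain B where "\<And>p. norm (glue u p) \<le> B" by (auto simp: bounded_iff)
  thus ?thesis
    by (intro finite_measure.integrable_const_bound[OF finite_area_measure] AE_I2 area_measurable measurable_glue assms)
qed

definition C1_fun :: "('a \<Rightarrow> real) \<Rightarrow> bool" where
  "C1_fun \<eta> \<longleftrightarrow> (\<forall>c\<in>A. C1_on (snd c ` fst c) (\<lambda>y. \<eta> (chart_inv c y)))"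

lemma transition_smooth: "c \<in> A \<Longrightarrow> d \<in> A \<Longrightarrow> smooth_on (snd c ` (fst c \<inter> fst d)) (in_charts c d id)"
proof -
  have "smooth_map A id" using id_symp symp_D(2) by blast
  thus "c \<in> A \<Longrightarrow> d \<in> A \<Longrightarrow> smooth_on (snd c ` (fst c \<inter> fst d)) (in_charts c d id)"
    by (simp add: smooth_map_def vimage_id)
qed

text \<open>In any chart d the extension by zero is a composition with a transition map on the part
  inside c, and vanishes on the part off the compact set K. Both parts are open and together they
  cover d.\<close>

lemma C1_fun_bump:
  assumes c: "c \<in> A" and p: "p \<in> fst c" and R: "R > 0" "cball (snd c p) R \<subseteq> snd c ` fst c"
  defines "b \<equiv> \<lambda>q. if q \<in> fst c then bump (snd c p) R (snd c q) else 0"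
    and "K \<equiv> chart_inv c ` cball (snd c p) R"
  shows "C1_fun b" "compact K" "K \<subseteq> fst c" "\<And>q. q \<notin> K \<Longrightarrow> b q = 0"
proof -
  show K: "compact K" unfolding K_def
    by (intro compact_continuous_image continuous_on_subset[OF continuous_on_chart(2)[OF c] R(2)]) auto
  show Kc: "K \<subseteq> fst c" unfolding K_def using R(2) chart_inv_in by blast
  show b0: "b q = 0" if "q \<notin> K" for q
  proof (cases "q \<in> fst c")
    case True
    hence "snd c q \<notin> cball (snd c p) R"
      using that chart_inv_chart[OF chart[OF c] True] unfolding K_def by force
    hence "\<not> bump (snd c p) R (snd c q) > 0" using bump_pos_iff[OF R(1)] by auto
    thus ?thesis using bump_nonneg[of "snd c p" R "snd c q"] by (auto simp: b_def)
  qed (simp add: b_def)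
  show "C1_fun b" unfolding C1_fun_def
  proof
    fix d assume d: "d \<in> A"
    let ?V1 = "snd d ` (fst d \<inter> fst c)" and ?V2 = "snd d ` (fst d \<inter> - K)"
    have o: "open ?V1" "open ?V2"
      using open_chart(1)[OF c] compact_imp_closed[OF K] by (auto intro!: open_chart_image[OF d])
    have "C1_on ?V1 (\<lambda>y. bump (snd c p) R (in_charts d c id y))"
      by (rule C1_on_compose[OF C1_on_smooth[OF transition_smooth[OF d c]] _ C1_on_bump]) auto
    hence 1: "C1_on ?V1 (\<lambda>y. b (chart_inv d y))"
      by (rule C1_on_cong[OF o(1), rotated])
         (auto simp: b_def in_charts_apply[OF d] chart_inv_chart[OF chart[OF d]])
    have 2: "C1_on ?V2 (\<lambda>y. b (chart_inv d y))"
      by (rule C1_on_cong[OF o(2) _ C1_on_const[of _ 0]])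
         (auto simp: b0 chart_inv_chart[OF chart[OF d]])
    have "?V1 \<union> ?V2 = snd d ` fst d" using Kc by blast
    thus "C1_on (snd d ` fst d) (\<lambda>y. b (chart_inv d y))"
      using C1_on_Un_open[OF o 1 2] by simp
  qed
qed

text \<open>Bumps around finitely many points are divided by their sum, and the points serve as
  indices. The compact supports inside single charts are what allows extension by zero in the
  divergence theorem.\<close>

lemma partition_of_unity:
  "\<exists>(I :: 'a set) \<eta> K cs. finite I \<and> (\<forall>i\<in>I. (cs i :: 'a chart) \<in> A \<and> C1_fun (\<eta> i) \<and> compact (K i) \<and> K i \<subseteq> fst (cs i) \<and>
      (\<forall>q. q \<notin> K i \<longrightarrow> \<eta> i q = 0)) \<and> (\<forall>q. (\<Sum>i\<in>I. \<eta> i q) = 1)"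
proof -
  have "\<forall>p. \<exists>z. fst z \<in> A \<and> p \<in> fst (fst z) \<and> snd z > 0 \<and> cball (snd (fst z) p) (snd z) \<subseteq> snd (fst z) ` fst (fst z)"
  proof
    fix p
    obtain c where c: "c \<in> A" "p \<in> fst c" using covering[of p] unfolding valid_at_def by blast
    have "snd c p \<in> snd c ` fst c" using c(2) by (rule imageI)
    from bspec[OF open_contains_cball[THEN iffD1, OF open_chart(2)[OF c(1)]] this]
    obtain R where "R > 0" "cball (snd c p) R \<subseteq> snd c ` fst c" by (elim exE conjE)
    thus "\<exists>z. fst z \<in> A \<and> p \<in> fst (fst z) \<and> snd z > 0 \<and> cball (snd (fst z) p) (snd z) \<subseteq> snd (fst z) ` fst (fst z)"
      using c by (intro exI[of _ "(c, R)"]) simp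
  qed
  from choice[OF this] obtain z where z: "\<forall>p. fst (z p) \<in> A \<and> p \<in> fst (fst (z p)) \<and> snd (z p) > 0
      \<and> cball (snd (fst (z p)) p) (snd (z p)) \<subseteq> snd (fst (z p)) ` fst (fst (z p))" ..
  define cs where "cs p = fst (z p)" for p
  define R where "R p = snd (z p)" for p
  have cR: "cs p \<in> A" "p \<in> fst (cs p)" "R p > 0" "cball (snd (cs p) p) (R p) \<subseteq> snd (cs p) ` fst (cs p)" for p
    using spec[OF z, of p] unfolding cs_def R_def by simp_all
  define b where "b p q = (if q \<in> fst (cs p) then bump (snd (cs p) p) (R p) (snd (cs p) q) else 0)" for p q
  define K where "K p = chart_inv (cs p) ` cball (snd (cs p) p) (R p)" for p
  note bump = C1_fun_bump[OF cR, folded b_def K_def]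
  define U where "U p = snd (cs p) -` ball (snd (cs p) p) (R p) \<inter> fst (cs p)" for p
  have oU: "open (U p)" for p
  proof -
    have "\<forall>B. open B \<longrightarrow> open (snd (cs p) -` B \<inter> fst (cs p))"
      using continuous_on_chart(1)[OF cR(1)] unfolding continuous_on_open_vimage[OF open_chart(1)[OF cR(1)]] .
    thus ?thesis unfolding U_def by blast
  qed
  obtain I where I: "finite I" "UNIV \<subseteq> (\<Union>p\<in>I. U p)"
  proof -
    have cover: "UNIV \<subseteq> (\<Union>p\<in>UNIV. U p)"
    proof
      fix p
      have "p \<in> U p" using cR(2,3) by (simp add: U_def)
      thus "p \<in> (\<Union>p\<in>UNIV. U p)" by blast
    qed
    show thesis by (rule compactE_image[OF compact_surface oU cover]) (rule that)
  qed
  define B where "B q = (\<Sum>p\<in>I. b p q)" for q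
  have b_nn: "b p q \<ge> 0" for p q by (simp add: b_def bump_nonneg)
  have Bpos: "B q > 0" for q
  proof -
    have "q \<in> (\<Union>p\<in>I. U p)" using I(2) by (rule subsetD) (rule UNIV_I)
    then obtain p where p: "p \<in> I" "q \<in> U p" by (rule UN_E)
    have q: "q \<in> fst (cs p)" "dist (snd (cs p) p) (snd (cs p) q) < R p"
      using p(2) unfolding U_def by simp_all
    have "b p q > 0" using q(1) bump_pos_iff[OF cR(3), THEN iffD2, OF q(2)] by (simp add: b_def)
    thus ?thesis unfolding B_def by (rule sum_pos2[OF I(1) p(1)]) (rule b_nn)
  qed
  have C1b: "C1_on (snd c ` fst c) (\<lambda>y. b p (chart_inv c y))" if "c \<in> A" for c p
    using bump(1)[of p] that unfolding C1_fun_def by blast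
  have C1B: "C1_on (snd c ` fst c) (\<lambda>y. B (chart_inv c y))" if "c \<in> A" for c
    unfolding B_def by (rule C1_on_sum) (rule C1b[OF that])
  have Bnz: "B q \<noteq> 0" for q using Bpos[of q] by simp
  define \<eta> where "\<eta> p q = b p q * inverse (B q)" for p q
  have "C1_fun (\<eta> p)" for p
    unfolding C1_fun_def \<eta>_def
  proof
    fix c assume c: "c \<in> A"
    show "C1_on (snd c ` fst c) (\<lambda>y. b p (chart_inv c y) * inverse (B (chart_inv c y)))"
      by (rule C1_on_mult[OF C1b[OF c] C1_on_inverse[OF C1B[OF c] Bnz]])
  qed
  moreover have "(\<Sum>p\<in>I. \<eta> p q) = 1" for q
  proof -
    have "(\<Sum>p\<in>I. \<eta> p q) = (\<Sum>p\<in>I. b p q) * inverse (B q)"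
      unfolding \<eta>_def by (rule sum_distrib_right[symmetric])
    thus ?thesis unfolding B_def[of q, symmetric] using Bnz[of q] by simp
  qed
  moreover have "\<eta> p q = 0" if "q \<notin> K p" for p q
    using bump(4)[OF that] by (simp add: \<eta>_def)
  ultimately show ?thesis
    by (intro exI[of _ I] exI[of _ \<eta>] exI[of _ K] exI[of _ cs] conjI ballI allI impI)
       (assumption | rule I(1) cR(1) bump(2) bump(3))+
qed

text \<open>The vector field Z acting on \<eta> as a derivation, computed in the chart c.\<close>

definition along_field :: "('a, real^2) field \<Rightarrow> ('a \<Rightarrow> real) \<Rightarrow> ('a, real) field" where
  "along_field Z \<eta> c p = frechet_derivative (\<lambda>y. \<eta> (chart_inv c y)) (at (snd c p)) (Z c p)"

lemma scalar_along_field: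
  assumes \<eta>: "C1_fun \<eta>" and Z: "\<And>c. c \<in> A \<Longrightarrow> C1_on (snd c ` fst c) (loc c Z)"
    and tr: "\<And>c d p. valid_at A c p \<Longrightarrow> valid_at A d p \<Longrightarrow> Z d p = jacobian c d id p *v Z c p"
  shows "scalar (along_field Z \<eta>)"
  unfolding scalar_def
proof (intro conjI allI impI ballI)
  fix c assume c: "c \<in> A"
  note C = \<eta>[unfolded C1_fun_def, rule_format, OF c]
  let ?W = "snd c ` fst c" and ?h = "\<lambda>y. \<eta> (chart_inv c y)"
  have "continuous_on ?W (\<lambda>y. \<Sum>i\<in>UNIV. loc c Z y $ i *\<^sub>R frechet_derivative ?h (at y) (axis i 1))"
    by (intro continuous_intros C1_on_D(2)[OF C] C1_on_D(3)[OF Z[OF c]])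
  moreover have "(\<Sum>i\<in>UNIV. loc c Z y $ i *\<^sub>R frechet_derivative ?h (at y) (axis i 1)) = loc c (along_field Z \<eta>) y"
    if y: "y \<in> ?W" for y
    using fun_cong[OF frechet_derivative_at[OF pd_has_derivative[OF C1_on_differentiable[OF C y]]], of "loc c Z y"] y
    by (simp add: loc_def along_field_def pd_def dpartial_def chart_chart_inv[OF chart[OF c]])
  ultimately show "continuous_on ?W (loc c (along_field Z \<eta>))"
    by (rule continuous_on_eq)
next
  fix c d p assume v: "valid_at A c p" "valid_at A d p"
  hence c: "c \<in> A" "p \<in> fst c" and d: "d \<in> A" "p \<in> fst d" by (auto simp: valid_at_def)
  let ?U = "snd c ` (fst c \<inter> fst d)"
  have U: "open ?U" "snd c p \<in> ?U" using open_chart_image[OF c(1) open_chart(1)[OF d(1)]] c d by auto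
  have sid: "smooth_map A id" using id_symp symp_D(2) by blast
  have T: "(in_charts c d id has_derivative (\<lambda>v. jacobian c d id p *v v)) (at (snd c p))"
    using in_charts_derivative[OF sid c(1) d(1) c(2)] d(2) by simp
  have "in_charts c d id (snd c p) = snd d p" using in_charts_apply[OF c] by simp
  moreover have "((\<lambda>y. \<eta> (chart_inv d y)) has_derivative frechet_derivative (\<lambda>y. \<eta> (chart_inv d y)) (at (snd d p))) (at (snd d p))"
    using C1_on_D(1)[OF \<eta>[unfolded C1_fun_def, rule_format, OF d(1)]] d(2) by blast
  ultimately have "((\<lambda>y. \<eta> (chart_inv d (in_charts c d id y))) has_derivative
      (\<lambda>v. frechet_derivative (\<lambda>y. \<eta> (chart_inv d y)) (at (snd d p)) (jacobian c d id p *v v))) (at (snd c p))"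
    using has_derivative_compose[OF T] by simp
  hence "((\<lambda>y. \<eta> (chart_inv c y)) has_derivative
      (\<lambda>v. frechet_derivative (\<lambda>y. \<eta> (chart_inv d y)) (at (snd d p)) (jacobian c d id p *v v))) (at (snd c p))"
    by (rule has_derivative_transform_within_open[OF _ U])
       (auto simp: in_charts_apply[OF c(1)] chart_inv_chart[OF chart[OF c(1)]] chart_inv_chart[OF chart[OF d(1)]])
  from frechet_derivative_at[OF this] show "along_field Z \<eta> c p = along_field Z \<eta> d p"
    unfolding along_field_def tr[OF v] by metis
qed

text \<open>Put v_i = div(\<eta>_i Z) = \<eta>_i u + Z \<eta>_i. Each v_i is supported in one chart,
  where its integral is that of the divergence of a compactly supported field on the plane. The v_i
  add up to u, because the \<eta>_i add up to 1 and hence their derivatives to 0.\<close>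

theorem divergence_theorem:
  assumes Z: "\<And>c. c \<in> A \<Longrightarrow> C1_on (snd c ` fst c) (loc c Z)"
    and tr: "\<And>c d p. valid_at A c p \<Longrightarrow> valid_at A d p \<Longrightarrow> Z d p = jacobian c d id p *v Z c p"
    and u: "scalar u" "\<And>c p. valid_at A c p \<Longrightarrow> \<rho> c p * u c p = (\<Sum>i\<in>UNIV. pd i (\<lambda>y. loc c \<rho> y * loc c Z y $ i) (snd c p))"
  shows "surface_integral A \<rho> u = 0"
proof -
  obtain I :: "'a set" and \<eta> K cs where I: "finite I"
    and all: "\<forall>i\<in>I. (cs i :: 'a chart) \<in> A \<and> C1_fun (\<eta> i) \<and> compact (K i) \<and> K i \<subseteq> fst (cs i) \<and>
      (\<forall>q. q \<notin> K i \<longrightarrow> \<eta> i q = 0)" and ones: "\<forall>q. (\<Sum>i\<in>I. \<eta> i q) = 1"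
    using partition_of_unity by (elim exE conjE)
  note one = spec[OF ones]
  have P: "cs i \<in> A" "C1_fun (\<eta> i)" "compact (K i)" "K i \<subseteq> fst (cs i)" "\<And>q. q \<notin> K i \<Longrightarrow> \<eta> i q = 0" if "i \<in> I" for i
    using bspec[OF all that] by simp_all
  define v where "v i c p = \<eta> i p * u c p + along_field Z (\<eta> i) c p" for i c p
  have sv: "scalar (v i)" if i: "i \<in> I" for i
  proof -
    have a: "scalar (along_field Z (\<eta> i))" by (rule scalar_along_field[OF P(2)[OF i] Z tr])
    have "continuous_on (snd c ` fst c) (loc c (v i))" if c: "c \<in> A" for c
    proof -
      have "loc c (v i) = (\<lambda>y. \<eta> i (chart_inv c y) * loc c u y + loc c (along_field Z (\<eta> i)) y)"
        by (simp add: fun_eq_iff loc_def v_def)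
      moreover have "continuous_on (snd c ` fst c) (loc c u)" "continuous_on (snd c ` fst c) (loc c (along_field Z (\<eta> i)))"
        using u(1) a c unfolding scalar_def by blast+
      ultimately show ?thesis
        using C1_on_D(3)[OF P(2)[OF i, unfolded C1_fun_def, rule_format, OF c]]
        by (simp add: continuous_on_add continuous_on_mult)
    qed
    moreover have "v i c p = v i d p" if "valid_at A c p" "valid_at A d p" for c d p
    proof -
      have "u c p = u d p" "along_field Z (\<eta> i) c p = along_field Z (\<eta> i) d p"
        using u(1) a that unfolding scalar_def by blast+
      thus ?thesis by (simp add: v_def)
    qed
    ultimately show ?thesis unfolding scalar_def by blast
  qed
  have int0: "(\<integral>p. glue (v i) p \<partial>\<mu>) = 0" if i: "i \<in> I" for i
  proof -
    let ?c = "cs i"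
    note c = P(1)[OF i] and K = P(3)[OF i] and Kc = P(4)[OF i] and \<eta>0 = P(5)[OF i]
    let ?W = "snd ?c ` fst ?c" and ?e = "\<lambda>y. \<eta> i (chart_inv ?c y)"
    note C = P(2)[OF i, unfolded C1_fun_def, rule_format, OF c]
    have oK: "open (- K i)" using compact_imp_closed[OF K] by auto
    have v0: "glue (v i) p = 0" if p: "p \<notin> K i" for p
    proof -
      obtain d where d: "d \<in> A" "p \<in> fst d" using covering[of p] by (auto simp: valid_at_def)
      have "frechet_derivative (\<lambda>y. \<eta> i (chart_inv d y)) (at (snd d p)) (Z d p) = 0"
        by (rule frechet_derivative_zero[OF open_chart_image[OF d(1) oK]])
           (use d p in \<open>auto simp: \<eta>0 chart_inv_chart[OF chart[OF d(1)]]\<close>)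
      thus ?thesis using glue_eq[OF sv[OF i], of d p] d \<eta>0[OF p] by (simp add: v_def along_field_def valid_at_def)
    qed
    \<comment> \<open>Extended by zero to the plane; this stays continuously differentiable because
      it already vanishes off the compact image of K i.\<close>
    define G where "G k y = (if y \<in> ?W then ?e y * (loc ?c \<rho> y * loc ?c Z y $ k) else 0)" for k y
    let ?K' = "snd ?c ` K i"
    have K': "compact ?K'"
      by (rule compact_continuous_image[OF continuous_on_subset[OF continuous_on_chart(1)[OF c] Kc] K])
    have G0: "G k y = 0" if "y \<notin> ?K'" for k y
    proof (cases "y \<in> ?W")
      case True
      have "chart_inv ?c y \<notin> K i"
      proof
        assume "chart_inv ?c y \<in> K i"
        hence "snd ?c (chart_inv ?c y) \<in> ?K'" by (rule imageI)
        thus False using that chart_chart_inv[OF chart[OF c] True] by simp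
      qed
      thus ?thesis by (simp add: G_def \<eta>0)
    qed (simp add: G_def)
    have CZ: "C1_on ?W (\<lambda>y. loc ?c \<rho> y * loc ?c Z y $ k)" for k
      by (intro C1_on_mult C1_on_smooth[OF smooth_rho[OF c]] C1_on_bounded_linear[OF bounded_linear_vec_nth Z[OF c]])
    have CG: "C1_on UNIV (G k)" for k
    proof -
      have 1: "C1_on ?W (G k)"
        by (rule C1_on_cong[OF open_chart(2)[OF c] _ C1_on_mult[OF C CZ[of k]]]) (simp add: G_def)
      have o: "open (- ?K')" using compact_imp_closed[OF K'] by auto
      have 2: "C1_on (- ?K') (G k)"
        by (rule C1_on_cong[OF o _ C1_on_const[of _ 0]]) (simp add: G0)
      have "?W \<union> - ?K' = UNIV" using Kc by blast
      thus ?thesis using C1_on_Un_open[OF open_chart(2)[OF c] o 1 2] by simp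
    qed
    obtain R where R: "\<And>y. y \<in> ?K' \<Longrightarrow> norm y \<le> R" using compact_imp_bounded[OF K'] bounded_iff by metis
    have GR: "G k y = 0" if "norm y > R" for k y using G0[of y k] R[of y] that by fastforce
    have "(\<integral>p. glue (v i) p \<partial>\<mu>) = (\<integral>x. indicator ?W x * loc ?c \<rho> x * glue (v i) (chart_inv ?c x) \<partial>lborel)"
      by (rule integral_in_chart[OF c measurable_glue[OF sv[OF i]]]) (use v0 Kc in blast)
    also have "\<dots> = (\<integral>x. pd 1 (G 1) x + pd 2 (G 2) x \<partial>lborel)"
    proof (rule Bochner_Integration.integral_cong[OF refl])
      fix x
      show "indicator ?W x * loc ?c \<rho> x * glue (v i) (chart_inv ?c x) = pd 1 (G 1) x + pd 2 (G 2) x"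
      proof (cases "x \<in> ?W")
        case False
        hence "x \<in> - ?K'" using Kc by blast
        hence "pd k (G k) x = 0" for k
          using frechet_derivative_zero[of "- ?K'" x "G k"] open_Compl[OF compact_imp_closed[OF K']] G0
          by (simp add: pd_def dpartial_def)
        thus ?thesis using False by simp
      next
        case True
        then obtain p where p: "p \<in> fst ?c" "x = snd ?c p" by blast
        have val: "valid_at A ?c p" using p c by (simp add: valid_at_def)
        note dif = C1_on_differentiable[OF C True] C1_on_differentiable[OF CZ True]
        have "pd k (G k) x = pd k (\<lambda>y. ?e y * (loc ?c \<rho> y * loc ?c Z y $ k)) x" for k
          by (rule pd_cong_open[OF open_chart(2)[OF c] True]) (simp add: G_def)
        hence "pd k (G k) x = ?e x * pd k (\<lambda>y. loc ?c \<rho> y * loc ?c Z y $ k) x + pd k ?e x * (\<rho> ?c p * Z ?c p $ k)" for k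
          using pd_bounded_bilinear[OF bounded_bilinear_mult dif] by (simp add: p loc_chart[OF c])
        moreover have "frechet_derivative ?e (at x) (Z ?c p) = Z ?c p $ 1 * pd 1 ?e x + Z ?c p $ 2 * pd 2 ?e x"
          using fun_cong[OF frechet_derivative_at[OF pd_has_derivative[OF dif(1)]], of "Z ?c p"] by (simp add: sum_2)
        moreover have "glue (v i) (chart_inv ?c x) = \<eta> i p * u ?c p + frechet_derivative ?e (at x) (Z ?c p)"
          using glue_eq[OF sv[OF i] val] p by (simp add: chart_inv_chart[OF chart[OF c]] v_def along_field_def)
        moreover have "\<rho> ?c p * u ?c p = pd 1 (\<lambda>y. loc ?c \<rho> y * loc ?c Z y $ 1) x + pd 2 (\<lambda>y. loc ?c \<rho> y * loc ?c Z y $ 2) x"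
          using u(2)[OF val] by (simp add: sum_2 p)
        moreover have "?e x = \<eta> i p" "loc ?c \<rho> x = \<rho> ?c p"
          using p by (simp_all add: chart_inv_chart[OF chart[OF c]] loc_chart[OF c])
        ultimately show ?thesis using True by (simp add: algebra_simps)
      qed
    qed
    also have "\<dots> = 0"
    proof -
      have "integrable lborel (\<lambda>x. pd k (G k) x)" "(\<integral>x. pd k (G k) x \<partial>lborel) = 0" for k
        using integral_pd_compact_support[OF CG[of k] GR] by blast+
      thus ?thesis by (simp add: Bochner_Integration.integral_add)
    qed
    finally show ?thesis .
  qed
  have sum: "glue u p = (\<Sum>i\<in>I. glue (v i) p)" for p
  proof -
    obtain c where v: "valid_at A c p" using covering by blast
    hence c: "c \<in> A" "p \<in> fst c" by (auto simp: valid_at_def)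
    have "((\<lambda>y. \<Sum>i\<in>I. \<eta> i (chart_inv c y)) has_derivative
        (\<lambda>w. \<Sum>i\<in>I. frechet_derivative (\<lambda>y. \<eta> i (chart_inv c y)) (at (snd c p)) w)) (at (snd c p))"
      using P(2) c by (intro has_derivative_sum C1_on_D(1)[of "snd c ` fst c"]) (auto simp: C1_fun_def)
    hence "((\<lambda>y. 1) has_derivative
        (\<lambda>w. \<Sum>i\<in>I. frechet_derivative (\<lambda>y. \<eta> i (chart_inv c y)) (at (snd c p)) w)) (at (snd c p))"
      by (simp add: one)
    from has_derivative_unique[OF this has_derivative_const]
    have "(\<Sum>i\<in>I. along_field Z (\<eta> i) c p) = 0"
      unfolding along_field_def by metis
    hence "(\<Sum>i\<in>I. v i c p) = u c p"
      using one[of p] by (simp add: v_def sum.distrib sum_distrib_right[symmetric])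
    thus ?thesis using glue_eq[OF u(1) v] glue_eq[OF sv v] by simp
  qed
  have "surface_integral A \<rho> u = (\<integral>p. (\<Sum>i\<in>I. glue (v i) p) \<partial>\<mu>)"
    by (simp add: surface_integral_glue sum)
  also have "\<dots> = (\<Sum>i\<in>I. \<integral>p. glue (v i) p \<partial>\<mu>)"
    by (rule Bochner_Integration.integral_sum) (rule integrable_glue[OF sv])
  finally show ?thesis by (simp add: int0)
qed

end

section \<open>Velocities of rotations and of the function \<open>f\<close>\<close>

lemma rot_has_vector_derivative: "((\<lambda>\<theta>. rot \<theta> x) has_vector_derivative rot_velocity x) (at 0)"
proof -
  have c: "(cos has_vector_derivative 0) (at (0::real))" and s: "(sin has_vector_derivative 1) (at (0::real))"
    using DERIV_cos[of "0::real"] DERIV_sin[of "0::real"] by (simp_all add: has_real_derivative_iff_has_vector_derivative)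
  have "((\<lambda>\<theta>. cos \<theta> *\<^sub>R snd x + sin \<theta> *\<^sub>R (snd x ** fst x)) has_vector_derivative (0 *\<^sub>R snd x + 1 *\<^sub>R (snd x ** fst x))) (at 0)"
    by (intro has_vector_derivative_add bounded_linear.has_vector_derivative[OF bounded_linear_scaleR_left] c s)
  hence "((\<lambda>\<theta>. (fst x, cos \<theta> *\<^sub>R snd x + sin \<theta> *\<^sub>R (snd x ** fst x))) has_vector_derivative (0, snd x ** fst x)) (at 0)"
    by (intro has_vector_derivative_Pair has_vector_derivative_const) simp
  thus ?thesis by (simp add: rot_pair[symmetric] rot_velocity_def)
qed

lemma rot_vector_derivative: "vector_derivative (\<lambda>\<theta>. rot \<theta> x) (at 0) = rot_velocity x"
  by (rule vector_derivative_at[OF rot_has_vector_derivative])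

text \<open>Differentiate J^2 = -1 along the curve.\<close>

lemma TJ_velocity:
  assumes "\<And>t. fst (\<gamma> t) ** fst (\<gamma> t) = - mat 1" "(\<gamma> has_vector_derivative w) (at t)"
  shows "fst w \<in> TJ (fst (\<gamma> t))"
proof -
  have d: "((\<lambda>t. fst (\<gamma> t)) has_vector_derivative fst w) (at t)"
    by (rule bounded_linear.has_vector_derivative[OF bounded_linear_fst assms(2)])
  have "((\<lambda>t. fst (\<gamma> t) ** fst (\<gamma> t)) has_vector_derivative (fst (\<gamma> t) ** fst w + fst w ** fst (\<gamma> t))) (at t)"
    by (rule bounded_bilinear.has_vector_derivative[OF bounded_bilinear_matrix_mult d d])
  moreover have "((\<lambda>t. fst (\<gamma> t) ** fst (\<gamma> t)) has_vector_derivative 0) (at t)"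
    unfolding assms(1) by (rule has_vector_derivative_const)
  ultimately have "fst (\<gamma> t) ** fst w + fst w ** fst (\<gamma> t) = 0"
    by (rule vector_derivative_unique_at)
  thus ?thesis by (simp add: TJ_def add.commute)
qed

text \<open>Differentiating tr(s^2) along the curve produces tr(s ds), where ds differs from
  \<open>sdot\<close> by a multiple of the identity and by A J s, from the variation of the metric.
  Neither contributes: s is trace-free, and s^2 is scalar while A J is trace-free.\<close>

lemma ff_has_derivative:
  assumes r: "r > 0" and \<gamma>: "\<And>t. \<gamma> t \<in> cotangent_points r" and d: "(\<gamma> has_vector_derivative w) (at t)"
  shows "((\<lambda>t. ff r (\<gamma> t)) has_real_derivative
    inverse (ff r (\<gamma> t)) * trace (sharp r (fst (\<gamma> t)) (snd (\<gamma> t)) ** sdot r (\<gamma> t) w) / 2) (at t)"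
proof -
  define s where "s t = sharp r (fst (\<gamma> t)) (snd (\<gamma> t))" for t
  note p = cotangent_points_D[OF \<gamma> r]
  let ?J = "fst (\<gamma> t)" and ?A = "fst w"
  have A: "?A \<in> TJ ?J" by (rule TJ_velocity[OF p(1) d])
  have dJ: "((\<lambda>t. fst (\<gamma> t)) has_vector_derivative ?A) (at t)" and dS: "((\<lambda>t. snd (\<gamma> t)) has_vector_derivative snd w) (at t)"
    by (rule bounded_linear.has_vector_derivative[OF bounded_linear_fst d],
        rule bounded_linear.has_vector_derivative[OF bounded_linear_snd d])
  have s: "s t = (1 / r) *\<^sub>R (fst (\<gamma> t) ** (area_mat ** snd (\<gamma> t)))" for t
    unfolding s_def by (rule sharp_eq[OF p(1,2)])
  define ds where "ds = (1 / r) *\<^sub>R (?J ** (area_mat ** snd w) + ?A ** (area_mat ** snd (\<gamma> t)))"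
  have d_s: "(s has_vector_derivative ds) (at t)"
    unfolding s[abs_def] ds_def
    by (intro bounded_linear.has_vector_derivative[OF bounded_linear_scaleR_right]
        bounded_bilinear.has_vector_derivative[OF bounded_bilinear_matrix_mult]
        bounded_linear.has_vector_derivative[OF bounded_linear_mult_left] dJ dS)
  have sTJ: "s t \<in> TJ ?J" unfolding s_def by (rule p(3))
  have ds_eq: "ds = sharp r ?J (snd w) - ?A ** (?J ** s t)"
    using p(2) by (simp add: ds_def s sharp_eq[OF p(1,2)] mat2_algebra mult_complex_structure_twice[OF p(1)] algebra_simps)
  have "trace (s t ** (?A ** (?J ** s t))) = trace ((?A ** ?J) ** (s t ** s t))"
    using trace_mult_commute[of "s t" "?A ** (?J ** s t)"] by (simp add: mat2_algebra)
  also have "s t ** s t = (trace (s t ** s t) / 2) *\<^sub>R mat 1"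
  proof -
    have "trace (s t ** (s t ** ?J)) = 0"
      using TJ_trace_J(2)[OF p(1) sTJ sTJ] trace_mult_commute[of "s t" "s t ** ?J"] by simp
    thus ?thesis using TJ_mult[OF p(1) sTJ sTJ] by simp
  qed
  also have "trace ((?A ** ?J) ** ((trace (s t ** s t) / 2) *\<^sub>R mat 1)) = 0"
    using TJ_trace[OF p(1) TJ_mult_J[OF p(1) A]] by (simp add: scaleR_mult_right trace_linear)
  finally have tr: "trace (s t ** ds) = trace (s t ** sdot r (\<gamma> t) w)"
    using TJ_trace[OF p(1) sTJ]
    by (simp add: ds_eq sdot_def form0_def sharp_linear sharp_gJ[OF p(1,2)] mat2_algebra trace_linear)
  have "((\<lambda>t. trace (s t ** s t)) has_vector_derivative trace (s t ** ds + ds ** s t)) (at t)"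
    by (intro bounded_linear.has_vector_derivative[OF bounded_linear_trace]
        bounded_bilinear.has_vector_derivative[OF bounded_bilinear_matrix_mult] d_s)
  hence "((\<lambda>t. trace (s t ** s t)) has_real_derivative 2 * trace (s t ** sdot r (\<gamma> t) w)) (at t)"
    by (simp add: has_real_derivative_iff_has_vector_derivative trace_linear tr trace_mult_commute[of ds])
  hence "((\<lambda>t. 1 + trace (s t ** s t) / 2) has_real_derivative trace (s t ** sdot r (\<gamma> t) w)) (at t)"
    by (auto intro!: derivative_eq_intros)
  moreover have f2: "1 + trace (s t ** s t) / 2 = (ff r (\<gamma> t))\<^sup>2" for t
    using p(5)[of t] by (simp add: s_def)
  ultimately have "((\<lambda>t. (ff r (\<gamma> t))\<^sup>2) has_real_derivative trace (s t ** sdot r (\<gamma> t) w)) (at t)"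
    by simp
  hence "((\<lambda>t. sqrt ((ff r (\<gamma> t))\<^sup>2)) has_real_derivative
      (inverse (sqrt ((ff r (\<gamma> t))\<^sup>2)) / 2) * trace (s t ** sdot r (\<gamma> t) w)) (at t)"
    using p(4)[of t] by (intro DERIV_chain2[OF DERIV_real_sqrt]) auto
  moreover have "sqrt ((ff r (\<gamma> t))\<^sup>2) = ff r (\<gamma> t)" for t using p(4)[of t] by simp
  ultimately show ?thesis by (simp add: s_def)
qed

section \<open>Genus one\<close>

lemma torus_pts_iff: "p \<in> pts torus_mgh \<longleftrightarrow> p \<in> cotangent_points 1 \<and> snd p \<noteq> 0"
  by (cases p) (simp add: torus_mgh_def)

lemma torus_drot_eq: "torus_drot \<theta> p v = rot_deriv \<theta> p v"
  by (simp add: torus_drot_def rot_frechet_derivative)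

lemma torus_simps: "gauge_orbit torus_mgh x = {x}" "tangent torus_mgh = tangent_vectors 1" "orbit_tangent torus_mgh x = {0}"
  "smooth_curve torus_mgh = smooth_on UNIV" "velocity torus_mgh \<gamma> = vector_derivative \<gamma> (at 0)"
  "metric torus_mgh = pmetric 1" "opI torus_mgh = pI 1" "opJ torus_mgh = pJ 1"
  by (simp_all add: torus_mgh_def)

text \<open>Rotating back by -\<theta> recovers p, so a nonzero form cannot become zero.\<close>

lemma torus_rot_pts:
  assumes "p \<in> pts torus_mgh"
  shows "rot \<theta> p \<in> pts torus_mgh"
proof -
  have p: "p \<in> cotangent_points 1" "snd p \<noteq> 0" using assms by (simp_all add: torus_pts_iff)
  have "snd (rot \<theta> p) \<noteq> 0"
  proof
    assume "snd (rot \<theta> p) = 0"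
    hence "snd (rot (- \<theta>) (rot \<theta> p)) = 0" by (simp add: rot_components(2)[of "- \<theta>"] mult_0_left)
    thus False using rot_rot[OF cotangent_points_D(1)[OF p(1)], of "- \<theta>" \<theta>] p(2) by (simp add: rot_0)
  qed
  thus ?thesis using rot_cotangent_points(1)[OF p(1)] by (simp add: torus_pts_iff)
qed

lemma torus_circle_action: "circle_action torus_mgh rot torus_drot"
proof -
  have "rot (\<theta> + \<phi>) p = rot \<theta> (rot \<phi> p)" if "p \<in> pts torus_mgh" for p \<theta> \<phi>
    using rot_rot[OF cotangent_points_D(1)[of p 1]] that by (simp add: torus_pts_iff)
  moreover have "torus_drot \<theta> p ` tangent torus_mgh p \<subseteq> tangent torus_mgh (rot \<theta> p)" if "p \<in> pts torus_mgh" for p \<theta>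
    using rot_deriv_tangent_vectors[of p 1] that by (auto simp: torus_simps torus_drot_eq torus_pts_iff)
  ultimately show ?thesis
    unfolding circle_action_def by (simp add: rot_0 rot_2pi torus_rot_pts torus_simps(1))
qed

lemma torus_generates:
  assumes "p \<in> pts torus_mgh"
  shows "generates torus_mgh rot p v \<longleftrightarrow> v = rot_velocity p"
  using rot_velocity_tangent_vectors[of p 1] assms
  by (auto simp: generates_def projects_to_def torus_simps rot_vector_derivative torus_pts_iff)

text \<open>Gauge orbits are singletons here, and \<open>the_elem\<close> reads the point off its
  orbit; the Hamiltonian equation is then the pointwise one for f.\<close>

lemma torus_hamiltonian: "hamiltonian_function torus_mgh rot (\<lambda>C. ff 1 (the_elem C))"
  unfolding hamiltonian_function_def
proof (intro ballI allI impI, elim conjE)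
  fix p v w \<gamma>
  assume p: "p \<in> pts torus_mgh" and v: "generates torus_mgh rot p v" and w: "w \<in> tangent torus_mgh p"
    and "curve_in torus_mgh p w \<gamma>"
  hence \<gamma>: "smooth_on UNIV \<gamma>" "\<And>t. \<gamma> t \<in> cotangent_points 1" "\<gamma> 0 = p" "vector_derivative \<gamma> (at 0) = w"
    by (auto simp: curve_in_def torus_simps torus_pts_iff)
  have d: "(\<gamma> has_vector_derivative w) (at 0)"
    using vector_derivative_works[THEN iffD1, OF smooth_on_differentiable[OF \<gamma>(1), of 0]] \<gamma>(4) by simp
  have "p \<in> cotangent_points 1" "w \<in> tangent_vectors 1 p" using p w by (simp_all add: torus_pts_iff torus_simps)
  from omega_rot_velocity[OF this(1) _ this(2)]
  have e: "omegaI torus_mgh p v w = inverse (ff 1 p) * trace (sharp 1 (fst p) (snd p) ** sdot 1 p w) / 2"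
    unfolding omegaI_def torus_simps torus_generates[OF p, THEN iffD1, OF v] by simp
  show "((\<lambda>t. ff 1 (the_elem (gauge_orbit torus_mgh (\<gamma> t)))) has_real_derivative omegaI torus_mgh p v w) (at 0)"
    unfolding e using ff_has_derivative[OF _ \<gamma>(2) d] by (simp add: torus_simps \<gamma>(3))
qed

lemma torus_isometries:
  assumes "p \<in> pts torus_mgh" "v \<in> tangent torus_mgh p" "w \<in> tangent torus_mgh p"
  shows "metric torus_mgh (rot \<theta> p) (torus_drot \<theta> p v) (torus_drot \<theta> p w) = metric torus_mgh p v w"
    "omegaI torus_mgh (rot \<theta> p) (torus_drot \<theta> p v) (torus_drot \<theta> p w) = omegaI torus_mgh p v w"
    "omegaIC torus_mgh (rot \<theta> p) (torus_drot \<theta> p v) (torus_drot \<theta> p w) = cis (- \<theta>) * omegaIC torus_mgh p v w"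
proof -
  have "p \<in> cotangent_points 1" "v \<in> tangent_vectors 1 p" "w \<in> tangent_vectors 1 p"
    using assms by (simp_all add: torus_pts_iff torus_simps)
  note o = rot_deriv_omega[OF this(1) _ this(2,3), of \<theta>]
  show "metric torus_mgh (rot \<theta> p) (torus_drot \<theta> p v) (torus_drot \<theta> p w) = metric torus_mgh p v w"
    "omegaI torus_mgh (rot \<theta> p) (torus_drot \<theta> p v) (torus_drot \<theta> p w) = omegaI torus_mgh p v w"
    "omegaIC torus_mgh (rot \<theta> p) (torus_drot \<theta> p v) (torus_drot \<theta> p w) = cis (- \<theta>) * omegaIC torus_mgh p v w"
    using o by (simp_all add: torus_simps omegaI_def omegaIC_def omegaJ_def omegaK_def torus_drot_eq complex_eq_iff)
qed

section \<open>Genus at least two\<close>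

context surface
begin

section \<open>Fields on the surface read in charts\<close>

lemma jacobian_det_nonzero:
  assumes "\<phi> \<in> symp A \<rho>" "valid_at A c p" "valid_at A d (\<phi> p)"
  shows "det (jacobian c d \<phi> p) \<noteq> 0" "\<rho> c p = det (jacobian c d \<phi> p) * \<rho> d (\<phi> p)"
proof -
  show *: "\<rho> c p = det (jacobian c d \<phi> p) * \<rho> d (\<phi> p)"
    using symp_D(6)[OF assms(1)] assms(2,3) by (simp add: valid_at_def)
  show "det (jacobian c d \<phi> p) \<noteq> 0"
    using rho_pos[OF assms(2)] unfolding * by auto
qed

lemma transition_det:
  assumes "valid_at A c p" "valid_at A d p"
  shows "det (jacobian c d id p) \<noteq> 0" "\<rho> c p = det (jacobian c d id p) * \<rho> d p"
  using jacobian_det_nonzero[OF id_symp, of c p d] assms unfolding id_apply[of p] by blast+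

lemma cotangent_fields_D:
  assumes "x \<in> cotangent_fields A \<rho>"
  shows "valid_at A c p \<Longrightarrow> x c p \<in> cotangent_points (\<rho> c p)" "\<not> valid_at A c p \<Longrightarrow> x c p = 0"
    "c \<in> A \<Longrightarrow> smooth_on (snd c ` fst c) (loc c x)"
    "valid_at A c p \<Longrightarrow> valid_at A d p \<Longrightarrow> x c p = pull_pair (jacobian c d id p) (x d p)"
  using assms unfolding cotangent_fields_def pair_field_def smooth_field_def valid_at_def by blast+

lemma tangent_fields_D:
  assumes "v \<in> tangent_fields A \<rho> x"
  shows "valid_at A c p \<Longrightarrow> v c p \<in> tangent_vectors (\<rho> c p) (x c p)" "\<not> valid_at A c p \<Longrightarrow> v c p = 0"
    "c \<in> A \<Longrightarrow> smooth_on (snd c ` fst c) (loc c v)"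
    "valid_at A c p \<Longrightarrow> valid_at A d p \<Longrightarrow> v c p = pull_pair (jacobian c d id p) (v d p)"
  using assms unfolding tangent_fields_def pair_field_def smooth_field_def valid_at_def by blast+

lemma cotangent_points_at:
  assumes "x \<in> cotangent_fields A \<rho>" "valid_at A c p"
  shows "fst (x c p) ** fst (x c p) = - mat 1" "\<rho> c p \<noteq> 0"
  using cotangent_points_D[OF cotangent_fields_D(1)[OF assms] rho_pos[OF assms(2)]] by auto

lemma local_data_chart:
  assumes "x \<in> cotangent_fields A \<rho>" "c \<in> A"
  shows "local_data (snd c ` fst c) (loc c \<rho>) (loc c x)"
proof
  show "open (snd c ` fst c)" by (rule open_chart(2)[OF assms(2)])
  show "smooth_on (snd c ` fst c) (loc c \<rho>)" by (rule smooth_rho[OF assms(2)])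
  show "smooth_on (snd c ` fst c) (loc c x)" by (rule cotangent_fields_D(3)[OF assms])
  fix z assume z: "z \<in> snd c ` fst c"
  show "loc c \<rho> z > 0" by (rule loc_rho_pos[OF assms(2) z])
  from z obtain p where p: "p \<in> fst c" "z = snd c p" by blast
  show "loc c x z \<in> cotangent_points (loc c \<rho> z)"
    using cotangent_fields_D(1)[OF assms(1), of c p] p assms(2) by (simp add: loc_chart valid_at_def)
qed

lemma loc_comp: "loc c (\<lambda>c p. F (\<rho> c p) (x c p)) = (\<lambda>z. F (loc c \<rho> z) (loc c x z))"
  by (simp add: loc_def fun_eq_iff)

lemma MS0_iff:
  "x \<in> MS0 A \<rho> \<longleftrightarrow> x \<in> cotangent_fields A \<rho> \<and> (\<forall>c p. valid_at A c p \<longrightarrow>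
     (let h = \<lambda>z. (1 + ff (loc c \<rho> z) (loc c x z)) *\<^sub>R gJ (loc c \<rho> z) (fst (loc c x z)) in
      gauss_curvature h (snd c p) = - 1 - det (matrix_inv (h (snd c p)) ** snd (loc c x (snd c p)))) \<and>
     local_data.codazzi_at (loc c \<rho>) (loc c x) (snd c p))"
proof (cases "x \<in> cotangent_fields A \<rho>")
  case True
  have "local_data.codazzi_at (loc c \<rho>) (loc c x) y \<longleftrightarrow>
     (let h = \<lambda>z. (1 + ff (loc c \<rho> z) (loc c x z)) *\<^sub>R gJ (loc c \<rho> z) (fst (loc c x z)); B = \<lambda>z. matrix_inv (h z) ** snd (loc c x z) in
     \<forall>X Y. nabla_end h B y X *v Y - nabla_end h B y Y *v X = 0)" if "valid_at A c p" for c p y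
    using local_data.codazzi_at_def[OF local_data_chart[OF True]] that by (simp add: valid_at_def)
  thus ?thesis
    using True unfolding MS0_def
    by (simp add: Let_def loc_comp[where F = "\<lambda>r x. (1 + ff r x) *\<^sub>R gJ r (fst x)"])
next
  case False
  thus ?thesis by (simp add: MS0_def)
qed

lemma MS0_cotangent: "x \<in> MS0 A \<rho> \<Longrightarrow> x \<in> cotangent_fields A \<rho>"
  by (simp add: MS0_iff)

lemma V_space_iff:
  assumes x: "x \<in> cotangent_fields A \<rho>"
  shows "v \<in> V_space A \<rho> x \<longleftrightarrow> v \<in> tangent_fields A \<rho> x \<and>
    (\<forall>c p. valid_at A c p \<longrightarrow> local_data.V_at (loc c \<rho>) (loc c x) (loc c v) (snd c p))"
proof -
  have "local_data.V_at (loc c \<rho>) (loc c x) (loc c v) (snd c p) \<longleftrightarrow>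
     (let g = loc c (\<lambda>c p. gJ (\<rho> c p) (fst (x c p)));
          C = loc c (\<lambda>c p. inverse (ff (\<rho> c p) (x c p)) *\<^sub>R
                sharp (\<rho> c p) (fst (x c p)) (form0 (\<rho> c p) (x c p) (v c p)));
          S = loc c (\<lambda>c p. snd (x c p));
          Jdot = loc c (\<lambda>c p. fst (v c p));
          r = \<rho> c p; J = fst (x c p); f = ff r (x c p); S0 = form0 r (x c p) (v c p);
          y = snd c p
      in \<forall>X. divergence g C y X = - inverse f * pairing r J (nabla_form g S y (J *v X)) (Jdot y) \<and>
             divergence g Jdot y X = - inverse (f\<^sup>2) * inner_form r J (nabla_form g S y (J *v X)) S0)"
    if val: "valid_at A c p" for c p
  proof -
    have c: "c \<in> A" "p \<in> fst c" using val by (auto simp: valid_at_def)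
    have g: "loc c (\<lambda>c p. gJ (\<rho> c p) (fst (x c p))) = (\<lambda>z. gJ (loc c \<rho> z) (fst (loc c x z)))"
      "loc c (\<lambda>c p. inverse (ff (\<rho> c p) (x c p)) *\<^sub>R sharp (\<rho> c p) (fst (x c p)) (form0 (\<rho> c p) (x c p) (v c p)))
        = (\<lambda>z. inverse (ff (loc c \<rho> z) (loc c x z)) *\<^sub>R sharp (loc c \<rho> z) (fst (loc c x z)) (form0 (loc c \<rho> z) (loc c x z) (loc c v z)))"
      "loc c (\<lambda>c p. snd (x c p)) = (\<lambda>z. snd (loc c x z))" "loc c (\<lambda>c p. fst (v c p)) = (\<lambda>z. fst (loc c v z))"
      by (simp_all add: loc_def fun_eq_iff)
    show ?thesis
      unfolding local_data.V_at_def[OF local_data_chart[OF x c(1)]] g Let_def loc_chart[OF c] ..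
  qed
  thus ?thesis unfolding V_space_def by blast
qed

lemma V_space_tangent: "v \<in> V_space A \<rho> x \<Longrightarrow> v \<in> tangent_fields A \<rho> x"
  by (simp add: V_space_def)

section \<open>Rotations preserve solutions and the spaces V\<close>

lemma surface_rot_cotangent:
  assumes x: "x \<in> cotangent_fields A \<rho>"
  shows "surface_rot \<theta> x \<in> cotangent_fields A \<rho>"
proof -
  note D = cotangent_fields_D[OF x]
  have l: "loc c (surface_rot \<theta> x) = (\<lambda>z. rot \<theta> (loc c x z))" for c
    by (simp add: loc_def surface_rot_def fun_eq_iff)
  have "smooth_field A (surface_rot \<theta> x)"
    unfolding smooth_field_def l using smooth_on_rot[OF open_chart(2) D(3)] D(2)
    by (simp add: surface_rot_def rot_zero)
  moreover have "surface_rot \<theta> x c p = pull_pair (jacobian c d id p) (surface_rot \<theta> x d p)"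
    if "valid_at A c p" "valid_at A d p" for c d p
    unfolding surface_rot_def D(4)[OF that] by (rule rot_pull_pair[OF transition_det(1)[OF that]])
  moreover have "surface_rot \<theta> x c p \<in> cotangent_points (\<rho> c p)" if "valid_at A c p" for c p
    unfolding surface_rot_def by (rule rot_cotangent_points(1)[OF D(1)[OF that] rho_pos[OF that]])
  ultimately show ?thesis
    unfolding cotangent_fields_def pair_field_def valid_at_def by blast
qed

text \<open>Holds at every z, also outside the image of the chart, because a field is 0 where it
  carries no information and 0 is fixed by rotations.\<close>

lemma ff_surface_rot:
  assumes x: "x \<in> cotangent_fields A \<rho>"
  shows "ff (loc c \<rho> z) (rot \<theta> (loc c x z)) = ff (loc c \<rho> z) (loc c x z)"
proof (cases "valid_at A c (chart_inv c z)")
  case True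
  thus ?thesis
    using rot_cotangent_points(2)[OF cotangent_fields_D(1)[OF x True] rho_pos[OF True]] by (simp add: loc_def)
next
  case False
  thus ?thesis using cotangent_fields_D(2)[OF x False] by (simp add: loc_def rot_zero)
qed

text \<open>The metric h depends on J and f only, so its curvature does not change; det B does not
  change because cos \<theta> + sin \<theta> J has determinant 1.\<close>

lemma surface_rot_MS0:
  assumes x: "x \<in> MS0 A \<rho>"
  shows "surface_rot \<theta> x \<in> MS0 A \<rho>"
proof -
  note xc = MS0_cotangent[OF x]
  have l: "loc c (surface_rot \<theta> x) = (\<lambda>z. rot \<theta> (loc c x z))" for c
    by (simp add: loc_def surface_rot_def fun_eq_iff)
  show ?thesis
    unfolding MS0_iff
  proof (intro conjI allI impI)
    show "surface_rot \<theta> x \<in> cotangent_fields A \<rho>" by (rule surface_rot_cotangent[OF xc])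
    fix c p assume val: "valid_at A c p"
    hence c: "c \<in> A" and y: "snd c p \<in> snd c ` fst c" by (auto simp: valid_at_def)
    note ld = local_data_chart[OF xc c]
    have X: "let h = \<lambda>z. (1 + ff (loc c \<rho> z) (loc c x z)) *\<^sub>R gJ (loc c \<rho> z) (fst (loc c x z)) in
      gauss_curvature h (snd c p) = - 1 - det (matrix_inv (h (snd c p)) ** snd (loc c x (snd c p)))"
      "local_data.codazzi_at (loc c \<rho>) (loc c x) (snd c p)"
      using x val unfolding MS0_iff by blast+
    show "local_data.codazzi_at (loc c \<rho>) (loc c (surface_rot \<theta> x)) (snd c p)"
      unfolding l by (rule local_data.rotated_codazzi[OF ld y ff_surface_rot[OF xc] X(2)])
    show "let h = \<lambda>z. (1 + ff (loc c \<rho> z) (loc c (surface_rot \<theta> x) z)) *\<^sub>R gJ (loc c \<rho> z) (fst (loc c (surface_rot \<theta> x) z)) in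
      gauss_curvature h (snd c p) = - 1 - det (matrix_inv (h (snd c p)) ** snd (loc c (surface_rot \<theta> x) (snd c p)))"
      using X(1) unfolding l rot_components(1) ff_surface_rot[OF xc] Let_def local_data.rotated_det_Bh[OF ld y] .
  qed
qed

lemma surface_drot_eq: "surface_drot \<theta> x v = (\<lambda>c p. rot_deriv \<theta> (x c p) (v c p))"
  by (simp add: surface_drot_def rot_frechet_derivative)

lemma surface_drot_V:
  assumes x: "x \<in> MS0 A \<rho>" and v: "v \<in> V_space A \<rho> x"
  shows "surface_drot \<theta> x v \<in> V_space A \<rho> (surface_rot \<theta> x)"
proof -
  note xc = MS0_cotangent[OF x]
  note rc = surface_rot_cotangent[OF xc, of \<theta>]
  note vt = V_space_tangent[OF v]
  note D = cotangent_fields_D[OF xc] and T = tangent_fields_D[OF vt]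
  have l: "loc c (surface_rot \<theta> x) = (\<lambda>z. rot \<theta> (loc c x z))" for c
    by (simp add: loc_def surface_rot_def fun_eq_iff)
  have ld: "loc c (surface_drot \<theta> x v) = (\<lambda>z. rot_deriv \<theta> (loc c x z) (loc c v z))" for c
    by (simp add: loc_def surface_drot_eq fun_eq_iff)
  have "smooth_field A (surface_drot \<theta> x v)"
    unfolding smooth_field_def ld using smooth_on_rot_deriv[OF open_chart(2) D(3) T(3)] D(2) T(2)
    by (simp add: surface_drot_eq rot_zero)
  moreover have "surface_drot \<theta> x v c p = pull_pair (jacobian c d id p) (surface_drot \<theta> x v d p)"
    if "valid_at A c p" "valid_at A d p" for c d p
    unfolding surface_drot_eq D(4)[OF that] T(4)[OF that] by (rule rot_deriv_pull_pair[OF transition_det(1)[OF that]])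
  moreover have "surface_drot \<theta> x v c p \<in> tangent_vectors (\<rho> c p) (surface_rot \<theta> x c p)" if "valid_at A c p" for c p
    unfolding surface_rot_def surface_drot_eq by (rule rot_deriv_tangent_vectors[OF D(1)[OF that] rho_pos[OF that] T(1)[OF that]])
  ultimately have t: "surface_drot \<theta> x v \<in> tangent_fields A \<rho> (surface_rot \<theta> x)"
    unfolding tangent_fields_def pair_field_def valid_at_def by blast
  show ?thesis
    unfolding V_space_iff[OF rc]
  proof (intro conjI t allI impI)
    fix c p assume val: "valid_at A c p"
    hence c: "c \<in> A" and y: "snd c p \<in> snd c ` fst c" by (auto simp: valid_at_def)
    note lc = local_data_chart[OF xc c]
    show "local_data.V_at (loc c \<rho>) (loc c (surface_rot \<theta> x)) (loc c (surface_drot \<theta> x v)) (snd c p)"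
      unfolding l ld
    proof (rule local_data.rotated_V[OF lc y _ C1_on_smooth[OF T(3)[OF c]]])
      show "local_data.codazzi_at (loc c \<rho>) (loc c x) (snd c p)" using x val unfolding MS0_iff by blast
      show "local_data.V_at (loc c \<rho>) (loc c x) (loc c v) (snd c p)" using v val unfolding V_space_iff[OF xc] by blast
      fix z assume "z \<in> snd c ` fst c"
      then obtain q where q: "q \<in> fst c" "z = snd c q" by blast
      show "loc c v z \<in> tangent_vectors (loc c \<rho> z) (loc c x z)"
        using T(1)[of c q] q c by (simp add: loc_chart valid_at_def)
    qed
  qed
qed

section \<open>Gauge orbits and the circle action\<close>

lemma symp0_symp: "\<phi> \<in> symp0 A \<rho> \<Longrightarrow> \<phi> \<in> symp A \<rho>"
proof -
  assume "\<phi> \<in> symp0 A \<rho>"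
  hence "connected_component_of (subtopology (smooth_topology A) (symp A \<rho>)) id \<phi>" by (simp add: symp0_def)
  then obtain T where "connectedin (subtopology (smooth_topology A) (symp A \<rho>)) T" "\<phi> \<in> T"
    unfolding connected_component_of_def by blast
  hence "\<phi> \<in> topspace (subtopology (smooth_topology A) (symp A \<rho>))"
    unfolding connectedin_def by blast
  thus ?thesis by simp
qed

lemma id_symp0: "id \<in> symp0 A \<rho>"
proof -
  obtain c where c: "c \<in> A" using covering unfolding valid_at_def by blast
  have "id \<in> topspace (smooth_topology A)"
    unfolding smooth_topology_def topology_generated_by_topspace
  proof (rule UnionI)
    \<comment> \<open>For the empty compact set the subbasic condition is void, so the space of all
      maps is itself a subbasic open set.\<close>
    show "UNIV \<in> {N. \<exists>\<phi> c d K bs \<epsilon>. smooth_map A \<phi> \<and> c \<in> A \<and> d \<in> A \<and> compact K \<and> K \<subseteq> fst c \<and>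
        \<phi> ` K \<subseteq> fst d \<and> set bs \<subseteq> Basis \<and> \<epsilon> > 0 \<and>
        N = {\<psi>. \<psi> ` K \<subseteq> fst d \<and>
               (\<forall>x \<in> snd c ` K. norm (foldr dpartial bs (in_charts c d \<psi>) x
                                    - foldr dpartial bs (in_charts c d \<phi>) x) < \<epsilon>)}}"
      using c symp_D(2)[OF id_symp]
      by (intro CollectI exI[of _ id] exI[of _ c] exI[of _ "{}"] exI[of _ "[]"] exI[of _ "1::real"]) simp
  qed simp
  hence "id \<in> topspace (subtopology (smooth_topology A) (symp A \<rho>))" using id_symp by simp
  thus ?thesis by (simp add: symp0_def connected_component_of_refl)
qed

text \<open>Both sides use the same chart around \<phi> p, and rotation commutes with pulling back
  components by an invertible matrix.\<close>

lemma pullback_surface_rot: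
  assumes \<phi>: "\<phi> \<in> symp A \<rho>"
  shows "pullback A \<phi> (surface_rot \<theta> x) = surface_rot \<theta> (pullback A \<phi> x)"
proof (intro ext)
  fix c p
  let ?d = "SOME d. valid_at A d (\<phi> p)"
  show "pullback A \<phi> (surface_rot \<theta> x) c p = surface_rot \<theta> (pullback A \<phi> x) c p"
  proof (cases "valid_at A c p")
    case True
    have "det (jacobian c ?d \<phi> p) \<noteq> 0" by (rule jacobian_det_nonzero(1)[OF \<phi> True valid_at_SOME])
    thus ?thesis using True by (simp add: pullback_def surface_rot_def Let_def rot_pull_pair)
  qed (simp add: pullback_def surface_rot_def rot_zero)
qed

lemma surface_circle_action: "circle_action (surface_mgh A \<rho>) surface_rot surface_drot"
proof -
  have rr: "surface_rot (\<theta> + \<phi>) x = surface_rot \<theta> (surface_rot \<phi> x)" if x: "x \<in> MS0 A \<rho>" for x \<theta> \<phi>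
  proof (intro ext)
    fix c p
    show "surface_rot (\<theta> + \<phi>) x c p = surface_rot \<theta> (surface_rot \<phi> x) c p"
    proof (cases "valid_at A c p")
      case True
      thus ?thesis using rot_rot[OF cotangent_points_at(1)[OF MS0_cotangent[OF x] True]] by (simp add: surface_rot_def)
    next
      case False
      thus ?thesis using cotangent_fields_D(2)[OF MS0_cotangent[OF x] False] by (simp add: surface_rot_def rot_zero)
    qed
  qed
  have orb: "{pullback A \<phi> (surface_rot \<theta> x) |\<phi>. \<phi> \<in> symp0 A \<rho>} = surface_rot \<theta> ` {pullback A \<phi> x |\<phi>. \<phi> \<in> symp0 A \<rho>}" for \<theta> x
    using pullback_surface_rot[OF symp0_symp] by (auto simp: image_iff) metis+
  show ?thesis
    unfolding circle_action_def surface_mgh_def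
    using surface_rot_MS0 surface_drot_V rr orb
    by (auto simp: surface_rot_def[of 0] surface_rot_def[of "2 * pi"] rot_0 rot_2pi)
qed

section \<open>Invariance of the integrated structure\<close>

lemma scalar_pointwise:
  assumes x: "x \<in> cotangent_fields A \<rho>" and v: "v \<in> tangent_fields A \<rho> x" and w: "w \<in> tangent_fields A \<rho> x"
  shows "scalar (\<lambda>c p. pmetric (\<rho> c p) (x c p) (v c p) (w c p))"
    "scalar (\<lambda>c p. pmetric (\<rho> c p) (x c p) (v c p) (pI (\<rho> c p) (x c p) (w c p)))"
    "scalar (\<lambda>c p. pmetric (\<rho> c p) (x c p) (v c p) (pJ (\<rho> c p) (x c p) (w c p)))"
    "scalar (\<lambda>c p. pmetric (\<rho> c p) (x c p) (v c p) (pI (\<rho> c p) (x c p) (pJ (\<rho> c p) (x c p) (w c p))))"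
proof -
  note D = cotangent_fields_D[OF x] and V = tangent_fields_D[OF v] and W = tangent_fields_D[OF w]
  have inv: "pmetric (\<rho> c p) (x c p) (v c p) (w c p) = pmetric (\<rho> d p) (x d p) (v d p) (w d p)"
    "pmetric (\<rho> c p) (x c p) (v c p) (pI (\<rho> c p) (x c p) (w c p)) = pmetric (\<rho> d p) (x d p) (v d p) (pI (\<rho> d p) (x d p) (w d p))"
    "pmetric (\<rho> c p) (x c p) (v c p) (pJ (\<rho> c p) (x c p) (w c p)) = pmetric (\<rho> d p) (x d p) (v d p) (pJ (\<rho> d p) (x d p) (w d p))"
    "pmetric (\<rho> c p) (x c p) (v c p) (pI (\<rho> c p) (x c p) (pJ (\<rho> c p) (x c p) (w c p)))
      = pmetric (\<rho> d p) (x d p) (v d p) (pI (\<rho> d p) (x d p) (pJ (\<rho> d p) (x d p) (w d p)))"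
    if cd: "valid_at A c p" "valid_at A d p" for c d p
  proof -
    note t = transition_det[OF cd] and q = cotangent_points_at[OF x cd(2)]
    show "pmetric (\<rho> c p) (x c p) (v c p) (w c p) = pmetric (\<rho> d p) (x d p) (v d p) (w d p)"
      "pmetric (\<rho> c p) (x c p) (v c p) (pI (\<rho> c p) (x c p) (w c p)) = pmetric (\<rho> d p) (x d p) (v d p) (pI (\<rho> d p) (x d p) (w d p))"
      "pmetric (\<rho> c p) (x c p) (v c p) (pJ (\<rho> c p) (x c p) (w c p)) = pmetric (\<rho> d p) (x d p) (v d p) (pJ (\<rho> d p) (x d p) (w d p))"
      "pmetric (\<rho> c p) (x c p) (v c p) (pI (\<rho> c p) (x c p) (pJ (\<rho> c p) (x c p) (w c p)))
        = pmetric (\<rho> d p) (x d p) (v d p) (pI (\<rho> d p) (x d p) (pJ (\<rho> d p) (x d p) (w d p)))"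
      unfolding D(4)[OF cd] V(4)[OF cd] W(4)[OF cd] t(2)
        pI_pull_pair[OF t(1) q] pJ_pull_pair[OF t(1) q] pmetric_pull_pair[OF t(1) q] by (rule refl)+
  qed
  have cont: "continuous_on (snd c ` fst c) (loc c (\<lambda>c p. pmetric (\<rho> c p) (x c p) (v c p) (w c p)))"
    "continuous_on (snd c ` fst c) (loc c (\<lambda>c p. pmetric (\<rho> c p) (x c p) (v c p) (pI (\<rho> c p) (x c p) (w c p))))"
    "continuous_on (snd c ` fst c) (loc c (\<lambda>c p. pmetric (\<rho> c p) (x c p) (v c p) (pJ (\<rho> c p) (x c p) (w c p))))"
    "continuous_on (snd c ` fst c) (loc c (\<lambda>c p. pmetric (\<rho> c p) (x c p) (v c p) (pI (\<rho> c p) (x c p) (pJ (\<rho> c p) (x c p) (w c p)))))"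
    if c: "c \<in> A" for c
  proof -
    let ?W = "snd c ` fst c"
    interpret L: local_data ?W "loc c \<rho>" "loc c x" by (rule local_data_chart[OF x c])
    note cv = C1_on_smooth[OF V(3)[OF c]] and cw = C1_on_smooth[OF W(3)[OF c]]
    have at: "loc c x z \<in> cotangent_points (loc c \<rho> z)" "loc c \<rho> z > 0"
      "loc c v z \<in> tangent_vectors (loc c \<rho> z) (loc c x z)" "loc c w z \<in> tangent_vectors (loc c \<rho> z) (loc c x z)" if z: "z \<in> ?W" for z
    proof -
      show "loc c x z \<in> cotangent_points (loc c \<rho> z)" "loc c \<rho> z > 0" by (rule L.x_in[OF z], rule L.r_pos[OF z])
      from z obtain q where q: "q \<in> fst c" "z = snd c q" by blast
      hence "valid_at A c q" using c by (simp add: valid_at_def)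
      thus "loc c v z \<in> tangent_vectors (loc c \<rho> z) (loc c x z)" "loc c w z \<in> tangent_vectors (loc c \<rho> z) (loc c x z)"
        using V(1) W(1) q c by (simp_all add: loc_chart)
    qed
    note C = C1_on_D(3)[OF L.C1_J] C1_on_D(3)[OF L.C1_f] C1_on_D(3)[OF L.C1_inverse_f] C1_on_D(3)[OF L.C1_sdot[OF cv]] C1_on_D(3)[OF L.C1_sdot[OF cw]]
      C1_on_D(3)[OF C1_on_fst[OF cv]] C1_on_D(3)[OF C1_on_fst[OF cw]]
    note ci = bounded_bilinear.continuous_on[OF bounded_bilinear_matrix_mult] bounded_linear.continuous_on[OF bounded_linear_trace]
    have k: "continuous_on ?W (\<lambda>z. (1 / 2 :: real) * trace (F z))" if "continuous_on ?W F" for F :: "real^2 \<Rightarrow> mat2"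
      by (intro continuous_on_mult continuous_on_const ci that)
    show "continuous_on ?W (loc c (\<lambda>c p. pmetric (\<rho> c p) (x c p) (v c p) (w c p)))"
    proof (rule continuous_on_eq)
      show "continuous_on ?W (\<lambda>z. ff (loc c \<rho> z) (loc c x z) * ((1 / 2) * trace (fst (loc c v z) ** fst (loc c w z)))
          - inverse (ff (loc c \<rho> z) (loc c x z)) * ((1 / 2) * trace (sdot (loc c \<rho> z) (loc c x z) (loc c v z) ** sdot (loc c \<rho> z) (loc c x z) (loc c w z))))"
        by (intro continuous_on_diff continuous_on_mult C k ci continuous_on_const)
    qed (simp add: loc_def pmetric_sdot)
    show "continuous_on ?W (loc c (\<lambda>c p. pmetric (\<rho> c p) (x c p) (v c p) (pI (\<rho> c p) (x c p) (w c p))))"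
    proof (rule continuous_on_eq)
      show "continuous_on ?W (\<lambda>z. inverse (ff (loc c \<rho> z) (loc c x z)) * ((1 / 2) * trace (sdot (loc c \<rho> z) (loc c x z) (loc c v z) ** (sdot (loc c \<rho> z) (loc c x z) (loc c w z) ** fst (loc c x z))))
          - ff (loc c \<rho> z) (loc c x z) * ((1 / 2) * trace (fst (loc c v z) ** (fst (loc c x z) ** fst (loc c w z)))))"
        by (intro continuous_on_diff continuous_on_mult C k ci continuous_on_const)
    qed (use omega_components(1)[OF at] in \<open>simp add: loc_def\<close>)
    show "continuous_on ?W (loc c (\<lambda>c p. pmetric (\<rho> c p) (x c p) (v c p) (pJ (\<rho> c p) (x c p) (w c p))))"
    proof (rule continuous_on_eq)
      show "continuous_on ?W (\<lambda>z. (1 / 2) * trace (fst (loc c v z) ** sdot (loc c \<rho> z) (loc c x z) (loc c w z))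
          - (1 / 2) * trace (sdot (loc c \<rho> z) (loc c x z) (loc c v z) ** fst (loc c w z)))"
        by (intro continuous_on_diff C k ci)
    qed (use omega_components(2)[OF at] in \<open>simp add: loc_def\<close>)
    show "continuous_on ?W (loc c (\<lambda>c p. pmetric (\<rho> c p) (x c p) (v c p) (pI (\<rho> c p) (x c p) (pJ (\<rho> c p) (x c p) (w c p)))))"
    proof (rule continuous_on_eq)
      show "continuous_on ?W (\<lambda>z. (1 / 2) * trace (fst (loc c v z) ** (sdot (loc c \<rho> z) (loc c x z) (loc c w z) ** fst (loc c x z)))
          - (1 / 2) * trace (sdot (loc c \<rho> z) (loc c x z) (loc c v z) ** (fst (loc c x z) ** fst (loc c w z))))"
        by (intro continuous_on_diff C k ci)
    qed (use omega_components(3)[OF at] in \<open>simp add: loc_def\<close>)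
  qed
  show "scalar (\<lambda>c p. pmetric (\<rho> c p) (x c p) (v c p) (w c p))"
    "scalar (\<lambda>c p. pmetric (\<rho> c p) (x c p) (v c p) (pI (\<rho> c p) (x c p) (w c p)))"
    "scalar (\<lambda>c p. pmetric (\<rho> c p) (x c p) (v c p) (pJ (\<rho> c p) (x c p) (w c p)))"
    "scalar (\<lambda>c p. pmetric (\<rho> c p) (x c p) (v c p) (pI (\<rho> c p) (x c p) (pJ (\<rho> c p) (x c p) (w c p))))"
    unfolding scalar_def using inv cont by blast+
qed

lemma surface_integral_cong:
  assumes "\<And>c p. valid_at A c p \<Longrightarrow> u c p = v c p"
  shows "surface_integral A \<rho> u = surface_integral A \<rho> v"
  unfolding surface_integral_def by (rule Bochner_Integration.integral_cong[OF refl]) (rule assms[OF valid_at_SOME])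

lemma surface_integral_combination:
  assumes "scalar u" "scalar v"
  shows "surface_integral A \<rho> (\<lambda>c p. a * u c p + b * v c p) = a * surface_integral A \<rho> u + b * surface_integral A \<rho> v"
proof -
  have "surface_integral A \<rho> (\<lambda>c p. a * u c p + b * v c p) = (\<integral>p. a * glue u p + b * glue v p \<partial>\<mu>)"
    by (simp add: surface_integral_glue glue_def)
  thus ?thesis using integrable_glue[OF assms(1)] integrable_glue[OF assms(2)]
    by (simp add: surface_integral_glue)
qed

text \<open>For the metric and \<omega>_I the integrands agree. For \<omega>_J and \<omega>_K the
  pointwise identity mixes two integrands, so their integrability is used to split the
  integral.\<close>

lemma surface_isometries:
  assumes x: "x \<in> MS0 A \<rho>" and v: "v \<in> V_space A \<rho> x" and w: "w \<in> V_space A \<rho> x"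
  defines "M \<equiv> surface_mgh A \<rho>"
  shows "metric M (surface_rot \<theta> x) (surface_drot \<theta> x v) (surface_drot \<theta> x w) = metric M x v w"
    "omegaI M (surface_rot \<theta> x) (surface_drot \<theta> x v) (surface_drot \<theta> x w) = omegaI M x v w"
    "omegaIC M (surface_rot \<theta> x) (surface_drot \<theta> x v) (surface_drot \<theta> x w) = cis (- \<theta>) * omegaIC M x v w"
proof -
  note xc = MS0_cotangent[OF x]
  note V = V_space_tangent[OF v] and W = V_space_tangent[OF w]
  note sc = scalar_pointwise[OF xc V W]
  note o = rot_deriv_omega[OF cotangent_fields_D(1)[OF xc] rho_pos tangent_fields_D(1)[OF V] tangent_fields_D(1)[OF W]]
  show "metric M (surface_rot \<theta> x) (surface_drot \<theta> x v) (surface_drot \<theta> x w) = metric M x v w"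
    unfolding M_def surface_mgh_def surface_rot_def surface_drot_eq by (simp, rule surface_integral_cong) (rule o(1))
  show "omegaI M (surface_rot \<theta> x) (surface_drot \<theta> x v) (surface_drot \<theta> x w) = omegaI M x v w"
    unfolding M_def surface_mgh_def surface_rot_def surface_drot_eq omegaI_def by (simp, rule surface_integral_cong) (rule o(2))
  have J: "omegaJ M (surface_rot \<theta> x) (surface_drot \<theta> x v) (surface_drot \<theta> x w) = cos \<theta> * omegaJ M x v w + sin \<theta> * omegaK M x v w"
    unfolding M_def surface_mgh_def surface_rot_def surface_drot_eq omegaJ_def omegaK_def
    by (simp add: surface_integral_combination[OF sc(3,4), symmetric], rule surface_integral_cong) (rule o(3))
  have K: "omegaK M (surface_rot \<theta> x) (surface_drot \<theta> x v) (surface_drot \<theta> x w) = cos \<theta> * omegaK M x v w + (- sin \<theta>) * omegaJ M x v w"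
    unfolding M_def surface_mgh_def surface_rot_def surface_drot_eq omegaJ_def omegaK_def
    by (simp add: surface_integral_combination[OF sc(4,3), of "cos \<theta>" "- sin \<theta>", simplified, symmetric], rule surface_integral_cong)
       (simp add: o(4))
  show "omegaIC M (surface_rot \<theta> x) (surface_drot \<theta> x v) (surface_drot \<theta> x w) = cis (- \<theta>) * omegaIC M x v w"
    unfolding omegaIC_def J K by (simp add: complex_eq_iff algebra_simps)
qed

end

section \<open>The area of the maximal surface\<close>

context surface
begin

lemma surface_simps:
  "pts (surface_mgh A \<rho>) = MS0 A \<rho>" "gauge_orbit (surface_mgh A \<rho>) x = {pullback A \<phi> x | \<phi>. \<phi> \<in> symp0 A \<rho>}"
  "tangent (surface_mgh A \<rho>) = V_space A \<rho>"
  "orbit_tangent (surface_mgh A \<rho>) x = {lie_derivative A X x | X. symplectic_vector_field A \<rho> X}"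
  "smooth_curve (surface_mgh A \<rho>) \<gamma> \<longleftrightarrow> (\<forall>c \<in> A. smooth_on (UNIV \<times> snd c ` fst c) (\<lambda>(t, y). loc c (\<gamma> t) y))"
  "velocity (surface_mgh A \<rho>) \<gamma> = (\<lambda>c p. vector_derivative (\<lambda>t. \<gamma> t c p) (at 0))"
  "omegaI (surface_mgh A \<rho>) x v w = surface_integral A \<rho> (\<lambda>c p. pmetric (\<rho> c p) (x c p) (v c p) (pI (\<rho> c p) (x c p) (w c p)))"
  by (simp_all add: surface_mgh_def omegaI_def)

lemma scalar_area:
  assumes x: "x \<in> cotangent_fields A \<rho>"
  shows "scalar (\<lambda>c p. 1 + ff (\<rho> c p) (x c p))"
  unfolding scalar_def
proof (intro conjI allI impI ballI)
  fix c d p assume v: "valid_at A c p" "valid_at A d p"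
  show "1 + ff (\<rho> c p) (x c p) = 1 + ff (\<rho> d p) (x d p)"
    unfolding cotangent_fields_D(4)[OF x v] transition_det(2)[OF v]
      ff_pull_pair[OF transition_det(1)[OF v] cotangent_points_at[OF x v(2)]] ..
next
  fix c assume c: "c \<in> A"
  interpret L: local_data "snd c ` fst c" "loc c \<rho>" "loc c x" by (rule local_data_chart[OF x c])
  have "continuous_on (snd c ` fst c) (\<lambda>z. 1 + ff (loc c \<rho> z) (loc c x z))"
    by (intro continuous_on_add continuous_on_const C1_on_D(3)[OF L.C1_f])
  thus "continuous_on (snd c ` fst c) (loc c (\<lambda>c p. 1 + ff (\<rho> c p) (x c p)))"
    by (simp add: loc_comp[where F = "\<lambda>r x. 1 + ff r x"])
qed

text \<open>The function f of the pulled-back pair is f composed with \<phi>, and \<phi> preserves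
  the area measure.\<close>

lemma area_pullback:
  assumes x: "x \<in> cotangent_fields A \<rho>" and \<phi>: "\<phi> \<in> symp A \<rho>"
  shows "maximal_surface_area A \<rho> (pullback A \<phi> x) = maximal_surface_area A \<rho> x"
proof -
  let ?u = "\<lambda>c p. 1 + ff (\<rho> c p) (x c p)"
  have "1 + ff (\<rho> c p) (pullback A \<phi> x c p) = glue ?u (\<phi> p)" if v: "valid_at A c p" for c p
  proof -
    let ?d = "SOME d. valid_at A d (\<phi> p)"
    note j = jacobian_det_nonzero[OF \<phi> v valid_at_SOME]
    have "ff (\<rho> c p) (pullback A \<phi> x c p) = ff (\<rho> ?d (\<phi> p)) (x ?d (\<phi> p))"
      using v by (simp add: pullback_def Let_def j(2) ff_pull_pair[OF j(1) cotangent_points_at[OF x valid_at_SOME]])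
    thus ?thesis by (simp add: glue_def)
  qed
  from this[OF valid_at_SOME]
  have "maximal_surface_area A \<rho> (pullback A \<phi> x) = (\<integral>p. glue ?u (\<phi> p) \<partial>\<mu>)"
    by (simp add: maximal_surface_area_def surface_integral_def)
  also have "\<dots> = (\<integral>p. glue ?u p \<partial>distr \<mu> borel \<phi>)"
    by (rule integral_distr[symmetric])
       (intro area_measurable borel_measurable_continuous_onI symp_D(4)[OF \<phi>], rule measurable_glue[OF scalar_area[OF x]])
  also have "\<dots> = maximal_surface_area A \<rho> x"
    by (simp add: distr_symp[OF \<phi>] maximal_surface_area_def surface_integral_glue)
  finally show ?thesis .
qed

lemma area_function_orbit:
  assumes x: "x \<in> MS0 A \<rho>" and y: "y \<in> gauge_orbit (surface_mgh A \<rho>) x"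
  shows "area_function A \<rho> (gauge_orbit (surface_mgh A \<rho>) x) = maximal_surface_area A \<rho> y"
    "maximal_surface_area A \<rho> y = maximal_surface_area A \<rho> x"
proof -
  have *: "maximal_surface_area A \<rho> z = maximal_surface_area A \<rho> x" if "z \<in> gauge_orbit (surface_mgh A \<rho>) x" for z
    using that area_pullback[OF MS0_cotangent[OF x] symp0_symp] unfolding surface_simps by blast
  show "maximal_surface_area A \<rho> y = maximal_surface_area A \<rho> x" by (rule *[OF y])
  show "area_function A \<rho> (gauge_orbit (surface_mgh A \<rho>) x) = maximal_surface_area A \<rho> y"
    unfolding area_function_def
  proof (rule the_equality)
    show "\<forall>z\<in>gauge_orbit (surface_mgh A \<rho>) x. maximal_surface_area A \<rho> z = maximal_surface_area A \<rho> y"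
      using * y by metis
    show "a = maximal_surface_area A \<rho> y" if "\<forall>z\<in>gauge_orbit (surface_mgh A \<rho>) x. maximal_surface_area A \<rho> z = a" for a
      using bspec[OF that y] by simp
  qed
qed

lemma area_function_gauge_orbit:
  assumes x: "x \<in> MS0 A \<rho>"
  shows "area_function A \<rho> (gauge_orbit (surface_mgh A \<rho>) x) = maximal_surface_area A \<rho> x"
proof -
  \<comment> \<open>This element shows that the orbit is nonempty, and its area is already known to
    equal that of x.\<close>
  have "pullback A id x \<in> gauge_orbit (surface_mgh A \<rho>) x"
    using id_symp0 unfolding surface_simps by blast
  from area_function_orbit[OF x this] show ?thesis by simp
qed

section \<open>Pairing with infinitesimal gauge transformations\<close>

lemma rot_velocity_tangent_fields:
  assumes x: "x \<in> cotangent_fields A \<rho>"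
  shows "(\<lambda>c p. rot_velocity (x c p)) \<in> tangent_fields A \<rho> x"
proof -
  note D = cotangent_fields_D[OF x]
  have "smooth_on (snd c ` fst c) (\<lambda>z. (0 :: mat2, snd (loc c x z) ** fst (loc c x z)))" if c: "c \<in> A" for c
    using D(3)[OF c] by (intro smooth_on_Pair smooth_on_const smooth_on_bounded_bilinear[OF bounded_bilinear_matrix_mult]
        smooth_on_bounded_linear[OF bounded_linear_fst] smooth_on_bounded_linear[OF bounded_linear_snd] open_chart(2)[OF c])
  moreover have "loc c (\<lambda>c p. rot_velocity (x c p)) = (\<lambda>z. (0, snd (loc c x z) ** fst (loc c x z)))" for c
    by (simp add: loc_def rot_velocity_def fun_eq_iff)
  ultimately have "smooth_field A (\<lambda>c p. rot_velocity (x c p))"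
    using D(2) by (simp add: smooth_field_def rot_velocity_def mult_0_left zero_prod_def)
  moreover have "rot_velocity (x c p) = pull_pair (jacobian c d id p) (rot_velocity (x d p))"
    if "valid_at A c p" "valid_at A d p" for c d p
    unfolding D(4)[OF that] by (rule rot_velocity_pull_pair[OF transition_det(1)[OF that]])
  moreover have "rot_velocity (x c p) \<in> tangent_vectors (\<rho> c p) (x c p)" if "valid_at A c p" for c p
    by (rule rot_velocity_tangent_vectors[OF D(1)[OF that] rho_pos[OF that]])
  ultimately show ?thesis
    unfolding tangent_fields_def pair_field_def valid_at_def by blast
qed

definition flux_field :: "('a, mat2 \<times> mat2) field \<Rightarrow> ('a, mat2 \<times> mat2) field \<Rightarrow> ('a, mat2) field" where
  "flux_field x w c p = (let r = \<rho> c p; f = ff r (x c p); J = fst (x c p); s = sharp r J (snd (x c p)); t = sdot r (x c p) (w c p) in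
     f *\<^sub>R fst (w c p) + (inverse f * trace (s ** t) / 2) *\<^sub>R J + (inverse f * trace ((s ** J) ** t) / 2) *\<^sub>R mat 1)"

lemma flux_field_loc:
  assumes "x \<in> cotangent_fields A \<rho>" "c \<in> A"
  shows "loc c (flux_field x w) = local_data.flux (loc c \<rho>) (loc c x) (loc c w)"
  unfolding local_data.flux_def[OF local_data_chart[OF assms], abs_def]
  by (simp add: loc_def flux_field_def Let_def fun_eq_iff)

text \<open>The flux combines endomorphisms with scalar coefficients that are invariant traces, so a
  change of chart conjugates it. The form without an inverse is the one needed to transform its
  product with X.\<close>

lemma flux_field_transform:
  assumes x: "x \<in> cotangent_fields A \<rho>" and w: "w \<in> tangent_fields A \<rho> x" and v: "valid_at A c p" "valid_at A d p"
  defines "D \<equiv> jacobian c d id p"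
  shows "D ** flux_field x w c p = flux_field x w d p ** D"
proof -
  note det = transition_det(1)[OF v, folded D_def] and q = cotangent_points_at[OF x v(2)]
  have r: "\<rho> c p = det D * \<rho> d p" unfolding D_def by (rule transition_det(2)[OF v])
  have xw: "x c p = pull_pair D (x d p)" "w c p = pull_pair D (w d p)"
    unfolding D_def by (rule cotangent_fields_D(4)[OF x v], rule tangent_fields_D(4)[OF w v])
  let ?s = "sharp (\<rho> d p) (fst (x d p)) (snd (x d p))" and ?t = "sdot (\<rho> d p) (x d p) (w d p)" and ?J = "fst (x d p)"
  have s: "sharp (det D * \<rho> d p) (fst (pull_pair D (x d p))) (snd (pull_pair D (x d p))) = matrix_inv D ** (?s ** D)"
    unfolding pull_pair_snd by (rule sharp_pull_pair[OF det q])
  have t1: "trace (matrix_inv D ** (?s ** D) ** (matrix_inv D ** (?t ** D))) = trace (?s ** ?t)"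
    using trace_conj[OF det, of "?s ** ?t"] by (simp add: mat2_algebra matrix_inv_cancel[OF det])
  have t2: "trace (matrix_inv D ** (?s ** D) ** (matrix_inv D ** (?J ** D)) ** (matrix_inv D ** (?t ** D))) = trace (?s ** ?J ** ?t)"
    using trace_conj[OF det, of "?s ** ?J ** ?t"] by (simp add: mat2_algebra matrix_inv_cancel[OF det])
  show ?thesis
    unfolding flux_field_def Let_def xw r s ff_pull_pair[OF det q] sdot_pull_pair[OF det q] t1
    unfolding pull_pair_fst t2
    by (simp add: mat2_algebra matrix_inv_cancel[OF det])
qed

text \<open>Formulated for two tangent fields differing by a Lie derivative: each pairs with w to a
  continuous chart-independent function, so no separate proof is required that the Lie derivative is
  a tangent field. The divergence theorem is applied to the flux evaluated on X.\<close>

lemma omega_orbit_tangent: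
  assumes x: "x \<in> MS0 A \<rho>" and w: "w \<in> V_space A \<rho> x" and v1: "v1 \<in> tangent_fields A \<rho> x" and v2: "v2 \<in> tangent_fields A \<rho> x"
    and X: "symplectic_vector_field A \<rho> X" and L: "v1 - v2 = lie_derivative A X x"
  shows "omegaI (surface_mgh A \<rho>) x v1 w = omegaI (surface_mgh A \<rho>) x v2 w"
proof -
  note xc = MS0_cotangent[OF x] and wt = V_space_tangent[OF w]
  let ?o = "\<lambda>v c p. pmetric (\<rho> c p) (x c p) (v c p) (pI (\<rho> c p) (x c p) (w c p))"
  note s1 = scalar_pointwise(2)[OF xc v1 wt] and s2 = scalar_pointwise(2)[OF xc v2 wt]
  \<comment> \<open>The order of the difference absorbs the minus sign in
    \<open>omega_lie_derivative\<close>, and the shape fits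
    \<open>surface_integral_combination\<close>.\<close>
  define u where "u c p = 1 * ?o v2 c p + (- 1) * ?o v1 c p" for c p
  define Z where "Z c p = flux_field x w c p *v X c p" for c p
  have vf: "smooth_field A X" "\<And>c d p. valid_at A c p \<Longrightarrow> valid_at A d p \<Longrightarrow> X d p = jacobian c d id p *v X c p"
    using X unfolding symplectic_vector_field_def vector_field_def valid_at_def by blast+
  have sX: "smooth_on (snd c ` fst c) (loc c X)" if "c \<in> A" for c
    using vf(1) that unfolding smooth_field_def by blast
  have lZ: "loc c Z = (\<lambda>y. local_data.flux (loc c \<rho>) (loc c x) (loc c w) y *v loc c X y)" if "c \<in> A" for c
    unfolding flux_field_loc[OF xc that, symmetric] by (simp add: loc_def Z_def fun_eq_iff)
  have cw: "C1_on (snd c ` fst c) (loc c w)" if "c \<in> A" for c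
    by (rule C1_on_smooth[OF tangent_fields_D(3)[OF wt that]])
  have "surface_integral A \<rho> u = 0"
  proof (rule divergence_theorem[where Z = Z])
    show "C1_on (snd c ` fst c) (loc c Z)" if c: "c \<in> A" for c
      unfolding lZ[OF c]
      by (intro C1_on_bounded_bilinear[OF bounded_bilinear_matrix_vector_mult] C1_on_smooth[OF sX[OF c]]
          local_data.C1_flux[OF local_data_chart[OF xc c]] cw[OF c])
    show "Z d p = jacobian c d id p *v Z c p" if v: "valid_at A c p" "valid_at A d p" for c d p
      unfolding Z_def vf(2)[OF v] matrix_vector_mul_assoc flux_field_transform[OF xc wt v] ..
    have *: "u c p = ?o (\<lambda>c p. v2 c p - v1 c p) c p" for c p by (simp add: u_def pmetric_diff)
    have "continuous_on (snd c ` fst c) (loc c u)" if "c \<in> A" for c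
    proof -
      have "loc c u = (\<lambda>y. loc c (?o v2) y - loc c (?o v1) y)" by (simp add: loc_def u_def fun_eq_iff)
      thus ?thesis using s1 s2 that unfolding scalar_def by (simp add: continuous_on_diff)
    qed
    moreover have "u c p = u d p" if v: "valid_at A c p" "valid_at A d p" for c d p
    proof -
      have "?o v1 c p = ?o v1 d p" "?o v2 c p = ?o v2 d p" using s1 s2 v unfolding scalar_def by blast+
      thus ?thesis by (simp add: u_def)
    qed
    ultimately show "scalar u" unfolding scalar_def by blast
    fix c p assume v: "valid_at A c p"
    hence c: "c \<in> A" "p \<in> fst c" and y: "snd c p \<in> snd c ` fst c" by (auto simp: valid_at_def)
    note ld = local_data_chart[OF xc c(1)]
    let ?y = "snd c p"
    have wt': "loc c w z \<in> tangent_vectors (loc c \<rho> z) (loc c x z)" if "z \<in> snd c ` fst c" for z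
    proof -
      from that obtain q where q: "q \<in> fst c" "z = snd c q" by blast
      thus ?thesis using tangent_fields_D(1)[OF wt, of c q] c(1) by (simp add: loc_chart valid_at_def)
    qed
    have V: "local_data.V_at (loc c \<rho>) (loc c x) (loc c w) ?y" using w v unfolding V_space_iff[OF xc] by blast
    have cod: "local_data.codazzi_at (loc c \<rho>) (loc c x) ?y" using x v unfolding MS0_iff by blast
    have dX: "loc c X differentiable at ?y" by (rule smooth_on_differentiable[OF sX[OF c(1)] y])
    have div: "(\<Sum>i\<in>UNIV. pd i (\<lambda>z. loc c \<rho> z * loc c X z $ i) ?y) = 0"
      using X v unfolding symplectic_vector_field_def by blast
    have lie: "lie_derivative A X x c p =
      (fst (frechet_derivative (loc c x) (at ?y) (loc c X ?y)) + fst (loc c x ?y) ** matrix (frechet_derivative (loc c X) (at ?y))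
        - matrix (frechet_derivative (loc c X) (at ?y)) ** fst (loc c x ?y),
       snd (frechet_derivative (loc c x) (at ?y) (loc c X ?y)) + transpose (matrix (frechet_derivative (loc c X) (at ?y))) ** snd (loc c x ?y)
        + snd (loc c x ?y) ** matrix (frechet_derivative (loc c X) (at ?y)))"
      using v by (simp add: lie_derivative_def Let_def loc_chart[OF c])
    have "v1 c p - v2 c p = lie_derivative A X x c p"
      using fun_cong[OF fun_cong[OF L, of c], of p] by simp
    hence "u c p = - pmetric (\<rho> c p) (x c p) (lie_derivative A X x c p) (pI (\<rho> c p) (x c p) (w c p))"
      by (simp add: u_def pmetric_diff[symmetric] flip: \<open>v1 c p - v2 c p = lie_derivative A X x c p\<close>)
         (simp add: pmetric_diff)
    hence "\<rho> c p * u c p = - (loc c \<rho> ?y * pmetric (loc c \<rho> ?y) (loc c x ?y) (lie_derivative A X x c p)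
        (pI (loc c \<rho> ?y) (loc c x ?y) (loc c w ?y)))"
      by (simp add: loc_chart[OF c])
    also have "\<dots> = (\<Sum>i\<in>UNIV. pd i (\<lambda>z. loc c \<rho> z * (local_data.flux (loc c \<rho>) (loc c x) (loc c w) z *v loc c X z) $ i) ?y)"
    proof -
      have "loc c \<rho> ?y * pmetric (loc c \<rho> ?y) (loc c x ?y) (lie_derivative A X x c p) (pI (loc c \<rho> ?y) (loc c x ?y) (loc c w ?y))
        = - (\<Sum>i\<in>UNIV. pd i (\<lambda>z. loc c \<rho> z * (local_data.flux (loc c \<rho>) (loc c x) (loc c w) z *v loc c X z) $ i) ?y)"
        unfolding lie by (rule local_data.omega_lie_derivative[OF ld y cw[OF c(1)] wt' V cod dX div])
      thus ?thesis by simp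
    qed
    finally show "\<rho> c p * u c p = (\<Sum>i\<in>UNIV. pd i (\<lambda>y. loc c \<rho> y * loc c Z y $ i) (snd c p))"
      unfolding lZ[OF c(1)] .
  qed
  thus ?thesis
    unfolding u_def surface_integral_combination[OF s2 s1] surface_simps by simp
qed

section \<open>The rotation curve and the derivative of the area\<close>

lemma surface_velocity_rot: "velocity (surface_mgh A \<rho>) (\<lambda>\<theta>. surface_rot \<theta> x) = (\<lambda>c p. rot_velocity (x c p))"
  by (simp add: surface_simps surface_rot_def rot_vector_derivative)

lemma surface_rot_curve:
  assumes x: "x \<in> MS0 A \<rho>"
  shows "curve_in (surface_mgh A \<rho>) x (velocity (surface_mgh A \<rho>) (\<lambda>\<theta>. surface_rot \<theta> x)) (\<lambda>\<theta>. surface_rot \<theta> x)"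
proof -
  have "(\<lambda>(t, y). loc c (surface_rot t x) y) = (\<lambda>z. rot (fst z) (loc c x (snd z)))" for c
    by (simp add: loc_def surface_rot_def fun_eq_iff)
  hence "smooth_on (UNIV \<times> snd c ` fst c) (\<lambda>(t, y). loc c (surface_rot t x) y)" if "c \<in> A" for c
    using smooth_on_rot_joint[OF open_chart(2)[OF that] cotangent_fields_D(3)[OF MS0_cotangent[OF x] that]] by simp
  moreover have "surface_rot 0 x = x" by (simp add: surface_rot_def rot_0)
  ultimately show ?thesis
    unfolding curve_in_def using surface_rot_MS0[OF x] by (simp add: surface_simps(1,5))
qed

text \<open>Since f is jointly continuously differentiable in time and position, its time derivative
  is bounded on [-1, 1] times the compact surface, and one may differentiate under the integral. At
  time 0 the integrand is the pointwise pairing with the velocity of the rotation.\<close>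

lemma area_derivative:
  assumes \<gamma>: "curve_in (surface_mgh A \<rho>) x w \<gamma>" and w: "w \<in> V_space A \<rho> x"
  shows "((\<lambda>t. maximal_surface_area A \<rho> (\<gamma> t)) has_real_derivative
    omegaI (surface_mgh A \<rho>) x (\<lambda>c p. rot_velocity (x c p)) w) (at 0)"
proof -
  have sm: "smooth_on (UNIV \<times> snd c ` fst c) (\<lambda>(t, y). loc c (\<gamma> t) y)" if "c \<in> A" for c
    using \<gamma> that unfolding curve_in_def surface_simps by blast
  have g: "\<gamma> t \<in> MS0 A \<rho>" "\<gamma> 0 = x" for t using \<gamma> unfolding curve_in_def surface_simps by blast+
  have vel: "vector_derivative (\<lambda>t. \<gamma> t c p) (at 0) = w c p" for c p
    using \<gamma> unfolding curve_in_def surface_simps by (metis (no_types, lifting))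
  note gc = MS0_cotangent[OF g(1)]
  have xc: "x \<in> cotangent_fields A \<rho>" using gc[of 0] g(2) by simp
  define G where "G c z = ff (loc c \<rho> (snd z)) (loc c (\<gamma> (fst z)) (snd z))" for c and z :: "real \<times> (real^2)"
  have CG: "C1_on (UNIV \<times> snd c ` fst c) (G c)" if c: "c \<in> A" for c
    unfolding G_def
  proof (rule C1_on_ff)
    show "open ((UNIV :: real set) \<times> snd c ` fst c)" by (intro open_Times open_UNIV open_chart(2)[OF c])
    show "C1_on ((UNIV :: real set) \<times> snd c ` fst c) (\<lambda>z. loc c \<rho> (snd z))"
      by (rule C1_on_smooth[OF smooth_on_compose_snd[OF open_chart(2)[OF c] smooth_rho[OF c]]])
    show "C1_on (UNIV \<times> snd c ` fst c) (\<lambda>z. loc c (\<gamma> (fst z)) (snd z))"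
      using C1_on_smooth[OF sm[OF c]] by (simp add: case_prod_beta')
    fix z :: "real \<times> (real^2)" assume "z \<in> UNIV \<times> snd c ` fst c"
    hence z: "snd z \<in> snd c ` fst c" by auto
    show "loc c \<rho> (snd z) > 0" by (rule loc_rho_pos[OF c z])
    show "loc c (\<gamma> (fst z)) (snd z) \<in> cotangent_points (loc c \<rho> (snd z))"
      by (rule local_data.x_in[OF local_data_chart[OF gc c] z])
  qed
  define G' where "G' c z = frechet_derivative (G c) (at z) (1, 0)" for c z
  have G': "((\<lambda>t. 1 + ff (\<rho> c p) (\<gamma> t c p)) has_real_derivative G' c (t, snd c p)) (at t)" if v: "valid_at A c p" for c p t
  proof -
    have c: "c \<in> A" "p \<in> fst c" using v by (auto simp: valid_at_def)
    have z: "(t, snd c p) \<in> UNIV \<times> snd c ` fst c" using c by simp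
    note d = C1_on_D(1)[OF CG[OF c(1)] z]
    have "((\<lambda>s. (s, snd c p)) has_derivative (\<lambda>h. (h, 0))) (at t)" by (auto intro!: derivative_eq_intros)
    from has_derivative_compose[OF this d]
    have "((\<lambda>s. G c (s, snd c p)) has_derivative (\<lambda>h. frechet_derivative (G c) (at (t, snd c p)) (h, 0))) (at t)" .
    moreover have "frechet_derivative (G c) (at (t, snd c p)) (h, 0) = G' c (t, snd c p) * h" for h
      using linear_cmul[OF has_derivative_linear[OF d], of h "(1, 0)"] by (simp add: G'_def)
    ultimately have "((\<lambda>s. G c (s, snd c p)) has_real_derivative G' c (t, snd c p)) (at t)"
      by (simp add: has_field_derivative_def)
    hence "((\<lambda>s. ff (\<rho> c p) (\<gamma> s c p)) has_real_derivative G' c (t, snd c p)) (at t)"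
      by (simp add: G_def loc_chart[OF c])
    thus ?thesis by (auto intro!: derivative_eq_intros)
  qed
  define u where "u t c p = G' c (t, snd c p)" for t c p
  have u_eq: "u t c p = u t d p" if v: "valid_at A c p" "valid_at A d p" for t c d p
  proof -
    have "1 + ff (\<rho> c p) (\<gamma> s c p) = 1 + ff (\<rho> d p) (\<gamma> s d p)" for s
      using scalar_area[OF gc[of s]] v unfolding scalar_def by blast
    thus ?thesis using DERIV_unique[OF G'[OF v(1), of t]] G'[OF v(2), of t] by (simp add: u_def)
  qed
  have su: "scalar (u t)" for t
    unfolding scalar_def
  proof (intro conjI allI impI ballI u_eq)
    fix c assume c: "c \<in> A"
    have "continuous_on (snd c ` fst c) (\<lambda>y. G' c (t, y))"
      unfolding G'_def
      by (rule continuous_on_compose2[OF C1_on_D(2)[OF CG[OF c]]]) (auto intro!: continuous_intros)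
    moreover have "G' c (t, y) = loc c (u t) y" if "y \<in> snd c ` fst c" for y
      using that by (simp add: loc_def u_def chart_chart_inv[OF chart[OF c]])
    ultimately show "continuous_on (snd c ` fst c) (loc c (u t))" by (rule continuous_on_eq)
  qed
  \<comment> \<open>The time derivative as a function on time times the surface. Its joint
    continuity, obtained chart by chart, provides the constant dominating function.\<close>
  define U where "U z = glue (u (fst z)) (snd z)" for z :: "real \<times> 'a"
  have U: "continuous_on UNIV U"
  proof -
    have "continuous_on (UNIV \<times> fst c) U" if c: "c \<in> A" for c
    proof (rule continuous_on_eq)
      show "continuous_on (UNIV \<times> fst c) (\<lambda>z. G' c (fst z, snd c (snd z)))"
        unfolding G'_def
        by (rule continuous_on_compose2[OF C1_on_D(2)[OF CG[OF c]]])
           (auto intro!: continuous_intros continuous_on_compose2[OF continuous_on_chart(1)[OF c]])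
      show "G' c (fst z, snd c (snd z)) = U z" if "z \<in> UNIV \<times> fst c" for z
        using that c glue_eq[OF su, of c "snd z" "fst z"] by (auto simp: U_def u_def valid_at_def)
    qed
    moreover have "open ((UNIV :: real set) \<times> fst c)" if "c \<in> A" for c
      by (intro open_Times open_UNIV open_chart(1)[OF that])
    ultimately have "continuous_on (\<Union>c\<in>A. (UNIV :: real set) \<times> fst c) U"
      by (intro continuous_on_open_UN) auto
    moreover have "(\<Union>c\<in>A. (UNIV :: real set) \<times> fst c) = UNIV \<times> (\<Union>c\<in>A. fst c)" by blast
    moreover have "(\<Union>c\<in>A. fst c) = UNIV" using closed by (simp add: closed_oriented_surface_def oriented_atlas_def)
    ultimately show ?thesis by simp
  qed
  have "compact (U ` ({-1..1} \<times> UNIV))"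
    by (intro compact_continuous_image continuous_on_subset[OF U] compact_Times compact_surface) auto
  then obtain B where B: "\<And>z. z \<in> {-1..1} \<times> UNIV \<Longrightarrow> \<bar>U z\<bar> \<le> B"
    using compact_imp_bounded bounded_iff by (metis image_eqI real_norm_def)
  have der: "((\<lambda>t. \<integral>p. glue (\<lambda>c p. 1 + ff (\<rho> c p) (\<gamma> t c p)) p \<partial>\<mu>) has_real_derivative (\<integral>p. glue (u 0) p \<partial>\<mu>)) (at 0)"
  proof (rule has_derivative_under_integral[where g = "\<lambda>_. B" and F' = "\<lambda>t. glue (u t)"])
    show "integrable \<mu> (glue (\<lambda>c p. 1 + ff (\<rho> c p) (\<gamma> t c p)))" for t
      by (rule integrable_glue[OF scalar_area[OF gc]])
    show "glue (u 0) \<in> borel_measurable \<mu>" by (rule area_measurable[OF measurable_glue[OF su]])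
    show "integrable \<mu> (\<lambda>_. B)" using finite_measure.integrable_const[OF finite_area_measure] .
    show "((\<lambda>t. glue (\<lambda>c p. 1 + ff (\<rho> c p) (\<gamma> t c p)) p) has_real_derivative glue (u t) p) (at t)" for t p
      unfolding glue_def u_def by (rule G'[OF valid_at_SOME])
    show "\<bar>glue (u t) p\<bar> \<le> B" if "\<bar>t\<bar> \<le> 1" for t p
      using B[of "(t, p)"] that by (simp add: U_def abs_le_iff)
  qed
  have "u 0 c p = pmetric (\<rho> c p) (x c p) (rot_velocity (x c p)) (pI (\<rho> c p) (x c p) (w c p))" if v: "valid_at A c p" for c p
  proof -
    have c: "c \<in> A" "p \<in> fst c" using v by (auto simp: valid_at_def)
    have "(\<lambda>(t, y). loc c (\<gamma> t) y) differentiable at (0, snd c p)"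
      using smooth_on_differentiable[OF sm[OF c(1)]] c by simp
    note d = differentiable_has_derivative[OF this]
    have "((\<lambda>s. (s, snd c p)) has_derivative (\<lambda>h. (h, 0))) (at 0)" by (auto intro!: derivative_eq_intros)
    from has_derivative_compose[OF this d]
    have "(\<lambda>s. loc c (\<gamma> s) (snd c p)) differentiable at 0" by (auto intro: differentiableI)
    hence "(\<lambda>s. \<gamma> s c p) differentiable at 0" by (simp add: loc_chart[OF c])
    hence vd: "((\<lambda>s. \<gamma> s c p) has_vector_derivative w c p) (at 0)"
      using vector_derivative_works vel by metis
    have "((\<lambda>t. ff (\<rho> c p) (\<gamma> t c p)) has_real_derivative
        inverse (ff (\<rho> c p) (x c p)) * trace (sharp (\<rho> c p) (fst (x c p)) (snd (x c p)) ** sdot (\<rho> c p) (x c p) (w c p)) / 2) (at 0)"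
      using ff_has_derivative[OF rho_pos[OF v] cotangent_fields_D(1)[OF gc v] vd] by (simp add: g(2))
    hence "((\<lambda>t. 1 + ff (\<rho> c p) (\<gamma> t c p)) has_real_derivative
        inverse (ff (\<rho> c p) (x c p)) * trace (sharp (\<rho> c p) (fst (x c p)) (snd (x c p)) ** sdot (\<rho> c p) (x c p) (w c p)) / 2) (at 0)"
      by (auto intro!: derivative_eq_intros)
    from DERIV_unique[OF G'[OF v, of 0] this] show ?thesis
      using omega_rot_velocity[OF cotangent_fields_D(1)[OF xc v] rho_pos[OF v] tangent_fields_D(1)[OF V_space_tangent[OF w] v]]
      by (simp add: u_def)
  qed
  hence "surface_integral A \<rho> (u 0) = omegaI (surface_mgh A \<rho>) x (\<lambda>c p. rot_velocity (x c p)) w"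
    unfolding surface_simps by (rule surface_integral_cong)
  thus ?thesis using der unfolding maximal_surface_area_def surface_integral_glue by simp
qed

lemma surface_hamiltonian: "hamiltonian_function (surface_mgh A \<rho>) surface_rot (area_function A \<rho>)"
  unfolding hamiltonian_function_def
proof (intro ballI allI impI, elim conjE)
  fix x v w \<gamma>
  assume "x \<in> pts (surface_mgh A \<rho>)" and v: "generates (surface_mgh A \<rho>) surface_rot x v"
    and "w \<in> tangent (surface_mgh A \<rho>) x" and \<gamma>: "curve_in (surface_mgh A \<rho>) x w \<gamma>"
  hence x: "x \<in> MS0 A \<rho>" and w: "w \<in> V_space A \<rho> x" by (simp_all add: surface_simps)
  have g: "\<gamma> t \<in> MS0 A \<rho>" for t using \<gamma> unfolding curve_in_def surface_simps by blast
  have vV: "v \<in> V_space A \<rho> x" and "(\<lambda>c p. rot_velocity (x c p)) - v \<in> orbit_tangent (surface_mgh A \<rho>) x"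
    using v unfolding generates_def projects_to_def surface_velocity_rot surface_simps(3) by blast+
  then obtain X where "symplectic_vector_field A \<rho> X" "(\<lambda>c p. rot_velocity (x c p)) - v = lie_derivative A X x"
    unfolding surface_simps by blast
  from omega_orbit_tangent[OF x w rot_velocity_tangent_fields[OF MS0_cotangent[OF x]] V_space_tangent[OF vV] this]
  have "omegaI (surface_mgh A \<rho>) x (\<lambda>c p. rot_velocity (x c p)) w = omegaI (surface_mgh A \<rho>) x v w" .
  thus "((\<lambda>t. area_function A \<rho> (gauge_orbit (surface_mgh A \<rho>) (\<gamma> t))) has_real_derivative omegaI (surface_mgh A \<rho>) x v w) (at 0)"
    using area_derivative[OF \<gamma> w] unfolding area_function_gauge_orbit[OF g] by simp
qed

text \<open>The rotation traces a smooth curve of representatives, so the identification of tangent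
  spaces applies to its velocity.\<close>

lemma surface_generates:
  assumes "tangent_identified (surface_mgh A \<rho>)" "x \<in> MS0 A \<rho>"
  shows "\<exists>!v. generates (surface_mgh A \<rho>) surface_rot x v"
  using assms(1) surface_rot_curve[OF assms(2)] assms(2)
  unfolding tangent_identified_def generates_def surface_simps(1) by blast

end

theorem theoremE:
  fixes A :: "'a::t2_space chart set" and \<rho> :: "('a, real) field" and genus :: nat
  shows
    "(circle_action torus_mgh rot torus_drot \<and>
      (\<forall>p \<in> pts torus_mgh. \<exists>!v. generates torus_mgh rot p v) \<and>
      (\<exists>H. hamiltonian_function torus_mgh rot H) \<and>
      (\<forall>\<theta>. \<forall>p \<in> pts torus_mgh. \<forall>v \<in> tangent torus_mgh p. \<forall>w \<in> tangent torus_mgh p.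
         metric torus_mgh (rot \<theta> p) (torus_drot \<theta> p v) (torus_drot \<theta> p w)
           = metric torus_mgh p v w \<and>
         omegaI torus_mgh (rot \<theta> p) (torus_drot \<theta> p v) (torus_drot \<theta> p w)
           = omegaI torus_mgh p v w \<and>
         omegaIC torus_mgh (rot \<theta> p) (torus_drot \<theta> p v) (torus_drot \<theta> p w)
           = cis (- \<theta>) * omegaIC torus_mgh p v w))
     \<and>
     (closed_oriented_surface A \<longrightarrow> has_genus TYPE('a) genus \<longrightarrow> genus \<ge> 2 \<longrightarrow>
      area_form_field A \<rho> \<longrightarrow>
      measure (area_measure A \<rho>) UNIV = - pi * (2 - 2 * real genus) \<longrightarrow>
      (let M = surface_mgh A \<rho> in
       circle_action M surface_rot surface_drot \<and>
       (tangent_identified M \<longrightarrow> (\<forall>p \<in> pts M. \<exists>!v. generates M surface_rot p v)) \<and>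
       (\<exists>H. hamiltonian_function M surface_rot H) \<and>
       (\<forall>\<theta>. \<forall>p \<in> pts M. \<forall>v \<in> tangent M p. \<forall>w \<in> tangent M p.
          metric M (surface_rot \<theta> p) (surface_drot \<theta> p v) (surface_drot \<theta> p w)
            = metric M p v w \<and>
          omegaI M (surface_rot \<theta> p) (surface_drot \<theta> p v) (surface_drot \<theta> p w)
            = omegaI M p v w \<and>
          omegaIC M (surface_rot \<theta> p) (surface_drot \<theta> p v) (surface_drot \<theta> p w)
            = cis (- \<theta>) * omegaIC M p v w) \<and>
       (\<forall>C \<in> moduli M. \<forall>x \<in> C. area_function A \<rho> C = maximal_surface_area A \<rho> x) \<and>
       hamiltonian_function M surface_rot (area_function A \<rho>)))"
proof (intro conjI impI)
  show "circle_action torus_mgh rot torus_drot" by (rule torus_circle_action)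
  show "\<forall>p \<in> pts torus_mgh. \<exists>!v. generates torus_mgh rot p v" using torus_generates by auto
  show "\<exists>H. hamiltonian_function torus_mgh rot H" using torus_hamiltonian by blast
  show "\<forall>\<theta>. \<forall>p \<in> pts torus_mgh. \<forall>v \<in> tangent torus_mgh p. \<forall>w \<in> tangent torus_mgh p.
         metric torus_mgh (rot \<theta> p) (torus_drot \<theta> p v) (torus_drot \<theta> p w)
           = metric torus_mgh p v w \<and>
         omegaI torus_mgh (rot \<theta> p) (torus_drot \<theta> p v) (torus_drot \<theta> p w)
           = omegaI torus_mgh p v w \<and>
         omegaIC torus_mgh (rot \<theta> p) (torus_drot \<theta> p v) (torus_drot \<theta> p w)
           = cis (- \<theta>) * omegaIC torus_mgh p v w"
    using torus_isometries by blast
next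
  assume "closed_oriented_surface A" "genus \<ge> 2" "area_form_field A \<rho>"
    and m: "measure (area_measure A \<rho>) UNIV = - pi * (2 - 2 * real genus)"
  moreover have "measure (area_measure A \<rho>) UNIV > 0"
    unfolding m using \<open>genus \<ge> 2\<close> by (simp add: mult_less_0_iff)
  ultimately interpret surface A \<rho> by unfold_locales
  have "area_function A \<rho> C = maximal_surface_area A \<rho> x" if "C \<in> moduli (surface_mgh A \<rho>)" "x \<in> C" for C x
    using that area_function_orbit(1) unfolding moduli_def surface_simps(1) by blast
  thus "let M = surface_mgh A \<rho> in
       circle_action M surface_rot surface_drot \<and>
       (tangent_identified M \<longrightarrow> (\<forall>p \<in> pts M. \<exists>!v. generates M surface_rot p v)) \<and>
       (\<exists>H. hamiltonian_function M surface_rot H) \<and>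
       (\<forall>\<theta>. \<forall>p \<in> pts M. \<forall>v \<in> tangent M p. \<forall>w \<in> tangent M p.
          metric M (surface_rot \<theta> p) (surface_drot \<theta> p v) (surface_drot \<theta> p w)
            = metric M p v w \<and>
          omegaI M (surface_rot \<theta> p) (surface_drot \<theta> p v) (surface_drot \<theta> p w)
            = omegaI M p v w \<and>
          omegaIC M (surface_rot \<theta> p) (surface_drot \<theta> p v) (surface_drot \<theta> p w)
            = cis (- \<theta>) * omegaIC M p v w) \<and>
       (\<forall>C \<in> moduli M. \<forall>x \<in> C. area_function A \<rho> C = maximal_surface_area A \<rho> x) \<and>
       hamiltonian_function M surface_rot (area_function A \<rho>)"
    unfolding Let_def
  proof (intro conjI impI allI ballI)
    show "circle_action (surface_mgh A \<rho>) surface_rot surface_drot" by (rule surface_circle_action)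
    show "\<exists>!v. generates (surface_mgh A \<rho>) surface_rot p v"
      if "tangent_identified (surface_mgh A \<rho>)" "p \<in> pts (surface_mgh A \<rho>)" for p
      using surface_generates[OF that(1)] that(2) unfolding surface_simps(1) by blast
    show "\<exists>H. hamiltonian_function (surface_mgh A \<rho>) surface_rot H" using surface_hamiltonian by blast
    show "hamiltonian_function (surface_mgh A \<rho>) surface_rot (area_function A \<rho>)" by (rule surface_hamiltonian)
  qed (use surface_isometries in \<open>simp_all add: surface_simps(1,3)\<close>)
qed

end
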